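(* Let $\Sigma$ be a family of implications on a finite set $E$. It can be decided in polynomial time whether $\mathcal{F}(\Sigma)$, ordered by inclusion, is a modular semilattice.
   Context: An implication on $E$ is a pair $A\to B$ with $A,B\subseteq E$; it is proper if $B\ne\emptyset$. $\mathcal{F}(\Sigma)$ is the family of $X\subseteq E$ such that both of the following hold: - $A\subseteq X$ implies $B\subseteq X$ for each proper $A\to B\in\Sigma$; - $A\not\subseteq X$ for each $A\to\emptyset\in\Sigma$. $\mathcal{F}(\Sigma)$ is $\cap$-closed and is a meet-semilattice under inclusion; the join $X\vee Y$, when it exists, is the least member containing $X\cup Y$. A (meet-)semilattice is modular if both of the following hold: every principal ideal is a modular lattice; and $X\vee Y\vee Z$ exists whenever $X\vee Y$, $Y\vee Z$, $Z\vee X$ exist. *)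

theory Defs
  imports "HOL-Algebra.Lattice" "HOL-Computational_Algebra.Polynomial"
begin

section \<open>Modular semilattices\<close>

definition modular_lattice :: "('a, 'b) gorder_scheme \<Rightarrow> bool" where
  "modular_lattice L \<longleftrightarrow> Lattice.lattice L \<and>
     (\<forall>x \<in> carrier L. \<forall>y \<in> carrier L. \<forall>z \<in> carrier L.
        x \<sqsubseteq>\<^bsub>L\<^esub> z \<longrightarrow> x \<squnion>\<^bsub>L\<^esub> (y \<sqinter>\<^bsub>L\<^esub> z) = (x \<squnion>\<^bsub>L\<^esub> y) \<sqinter>\<^bsub>L\<^esub> z)"

definition principal_ideal :: "('a, 'b) gorder_scheme \<Rightarrow> 'a \<Rightarrow> ('a, 'b) gorder_scheme" where
  "principal_ideal L x = L\<lparr>carrier := {y \<in> carrier L. y \<sqsubseteq>\<^bsub>L\<^esub> x}\<rparr>"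

definition join_exists :: "('a, 'b) gorder_scheme \<Rightarrow> 'a set \<Rightarrow> bool" where
  "join_exists L A \<longleftrightarrow> (\<exists>j. least L j (Upper L A))"

definition modular_semilattice :: "('a, 'b) gorder_scheme \<Rightarrow> bool" where
  "modular_semilattice L \<longleftrightarrow> lower_semilattice L \<and>
     (\<forall>x \<in> carrier L. modular_lattice (principal_ideal L x)) \<and>
     (\<forall>x \<in> carrier L. \<forall>y \<in> carrier L. \<forall>z \<in> carrier L.
        join_exists L {x, y} \<and> join_exists L {y, z} \<and> join_exists L {z, x}
          \<longrightarrow> join_exists L {x, y, z})"


section \<open>Families of sets given by implications\<close>

type_synonym 'a implication = "'a set \<times> 'a set"

definition implications_on :: "'a set \<Rightarrow> 'a implication set \<Rightarrow> bool" where
  "implications_on E \<Sigma> \<longleftrightarrow> (\<forall>(A, B) \<in> \<Sigma>. A \<subseteq> E \<and> B \<subseteq> E)"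

definition implication_family :: "'a set \<Rightarrow> 'a implication set \<Rightarrow> 'a set set" where
  "implication_family E \<Sigma> = {X. X \<subseteq> E \<and>
     (\<forall>(A, B) \<in> \<Sigma>. B \<noteq> {} \<longrightarrow> A \<subseteq> X \<longrightarrow> B \<subseteq> X) \<and>
     (\<forall>(A, B) \<in> \<Sigma>. B = {} \<longrightarrow> \<not> A \<subseteq> X)}"

definition inclusion_order :: "'a set set \<Rightarrow> 'a set gorder" where
  "inclusion_order F = \<lparr>carrier = F, eq = (=), le = (\<subseteq>)\<rparr>"


section \<open>Deterministic multi-tape Turing machines\<close>

text \<open>States and symbols are initial segments of the natural numbers. Symbol 0 is the blank,
  symbols 1 and 2 are the input bits False and True. All tapes are infinite in both directions.
  A transition maps a state and the scanned symbols (one per tape) to the next state and one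
  action (symbol to write, head movement) per tape.\<close>

datatype move = Move_Left | Move_None | Move_Right

record tm =
  num_tapes :: nat
  num_symbols :: nat
  num_states :: nat
  start_state :: nat
  accept_state :: nat
  reject_state :: nat
  trans_fun :: "nat \<Rightarrow> nat list \<Rightarrow> nat \<times> (nat \<times> move) list"

definition wf_tm :: "tm \<Rightarrow> bool" where
  "wf_tm M \<longleftrightarrow> num_tapes M \<ge> 1 \<and> num_symbols M \<ge> 3 \<and>
     start_state M < num_states M \<and> accept_state M < num_states M \<and>
     reject_state M < num_states M \<and> accept_state M \<noteq> reject_state M \<and>
     (\<forall>q ss. q < num_states M \<longrightarrow> length ss = num_tapes M \<longrightarrow> set ss \<subseteq> {..<num_symbols M} \<longrightarrow>
        fst (trans_fun M q ss) < num_states M \<and>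
        length (snd (trans_fun M q ss)) = num_tapes M \<and>
        fst ` set (snd (trans_fun M q ss)) \<subseteq> {..<num_symbols M})"

text \<open>A tape consists of its contents and the position of its head.\<close>

type_synonym tape = "(int \<Rightarrow> nat) \<times> int"
type_synonym config = "nat \<times> tape list"

fun move_head :: "move \<Rightarrow> int \<Rightarrow> int" where
  "move_head Move_Left p = p - 1"
| "move_head Move_None p = p"
| "move_head Move_Right p = p + 1"

fun read_tape :: "tape \<Rightarrow> nat" where
  "read_tape (f, p) = f p"

fun act_tape :: "nat \<times> move \<Rightarrow> tape \<Rightarrow> tape" where
  "act_tape (s, m) (f, p) = (f(p := s), move_head m p)"

text \<open>Configurations in the accepting or rejecting state are halting, hence left unchanged.\<close>

fun step_tm :: "tm \<Rightarrow> config \<Rightarrow> config" where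
  "step_tm M (q, ts) =
     (if q = accept_state M \<or> q = reject_state M then (q, ts)
      else let (q', as) = trans_fun M q (map read_tape ts) in (q', map2 act_tape as ts))"

definition bit_symbol :: "bool \<Rightarrow> nat" where
  "bit_symbol b = (if b then 2 else 1)"

definition blank_tape :: tape where
  "blank_tape = ((\<lambda>_. 0), 0)"

definition input_tape :: "bool list \<Rightarrow> tape" where
  "input_tape w =
     ((\<lambda>i. if 0 \<le> i \<and> i < int (length w) then bit_symbol (w ! nat i) else 0), 0)"

definition init_config :: "tm \<Rightarrow> bool list \<Rightarrow> config" where
  "init_config M w =
     (start_state M, input_tape w # replicate (num_tapes M - 1) blank_tape)"

definition decides_in_time :: "tm \<Rightarrow> bool list set \<Rightarrow> (nat \<Rightarrow> nat) \<Rightarrow> bool" where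
  "decides_in_time M L T \<longleftrightarrow> (\<forall>w. \<exists>t \<le> T (length w).
     fst ((step_tm M ^^ t) (init_config M w)) =
       (if w \<in> L then accept_state M else reject_state M))"

definition PTIME :: "bool list set set" where
  "PTIME = {L. \<exists>M (p :: nat poly). wf_tm M \<and> decides_in_time M L (poly p)}"


section \<open>Encoding of implication systems as bit strings\<close>

text \<open>The ground set is presented by a list \<open>es\<close> enumerating it without repetition, the implications
  by a list of pairs of sets. The code word is the size of the ground set in unary, closed by a
  False bit, followed, for each implication, by a True bit and the characteristic vectors of its
  premise and conclusion. The leading True bit keeps the number of implications readable
  when the ground set is empty. The code word determines the instance up to renaming the elements
  of the ground set, and its length is
  \<open>length es + 1 + length \<Sigma> * (2 * length es + 1)\<close>.\<close>

definition char_vector :: "'a list \<Rightarrow> 'a set \<Rightarrow> bool list" where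
  "char_vector es A = map (\<lambda>e. e \<in> A) es"

fun encode_implication :: "'a list \<Rightarrow> 'a implication \<Rightarrow> bool list" where
  "encode_implication es (A, B) = True # char_vector es A @ char_vector es B"

definition encode :: "'a list \<Rightarrow> 'a implication list \<Rightarrow> bool list" where
  "encode es \<Sigma> =
     replicate (length es) True @ False # concat (map (encode_implication es) \<Sigma>)"

end

theory Submission
  imports Defs
begin

text \<open>Let \<open>cl\<close> be the closure under the proper implications, and call a set consistent if
  it contains no premise of an improper one. The family is a modular semilattice if and only if
  the modular law holds below every consistent closed set and consistency of joins is determined by
  pairs. Both laws reduce to polynomially many conditions on the set \<open>J\<close> of elements generating a
  join-irreducible closed set: as in projective geometry, in a modular lattice a join-irreducible
  below \<open>A \<squnion> B\<close> lies below \<open>q \<squnion> r\<close> for join-irreducibles \<open>q \<le> A\<close> and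
  \<open>r \<le> B\<close>. Hence the closure on \<open>J\<close> is generated by its values on pairs, which is checked by
  running a fixpoint computation on the premise of every implication; the remaining conditions
  involve at most five elements of \<open>J\<close>.

  These conditions are written as a formula of first-order logic with addition and monadic fixpoints
  over the positions of the code word. A formula is compiled to a program on tapes whose variables
  are head positions and whose sets are bit vectors, and the program to a Turing machine; each
  construct multiplies the running time by at most a polynomial in the length of the word.\<close>

section \<open>Tape programs\<close>

text \<open>The obstacle is that both laws quantify over closed sets, of which there may be
  exponentially many. Under \<open>generation\<close>, the consistent closed sets correspond to the
  subsets of \<open>J\<close> that are line-closed and pairwise consistent, and this is what reduces
  the laws to points. \<open>projectivity\<close> then describes joins, \<open>exchange\<close> is
  the modular law read at a point, and \<open>flag\<close> carries consistency from pairs of points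
  to triples. Consistency is kept apart from closure because the family may lack a top, while the
  closed sets always have the top \<open>E\<close>. A fixpoint logic is used because
  \<open>cl\<close> and the line hull are least fixpoints of monotone operators on sets of
  positions. The whole test becomes one fixed formula, and a single correctness proof of the
  compiler gives the time bound for all conditions at once. Positions run from 0 to the word length
  inclusive, since the end of the word must be addressable in order to check the length.\<close>

datatype com =
    Mv nat move
  | Wr nat nat
  | Seq com com (infixr ";;" 60)
  | IfEq nat nat com com
  | While nat com

text \<open>The step counts mirror the machine code. A branch spends one step on the test and, if
  the first alternative is taken, one more on the jump over the second. A loop round spends one step
  on the test and one on the jump back; the blank symbol 0 ends a loop.\<close>

inductive exec :: "com \<Rightarrow> (nat \<Rightarrow> tape) \<Rightarrow> nat \<Rightarrow> (nat \<Rightarrow> tape) \<Rightarrow> bool" where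
  Mv: "exec (Mv k m) T 1 (T(k := (fst (T k), move_head m (snd (T k)))))"
| Wr: "exec (Wr k s) T 1 (T(k := ((fst (T k))(snd (T k) := s), snd (T k))))"
| Seq: "exec c T t T' \<Longrightarrow> exec c' T' t' T'' \<Longrightarrow> exec (c ;; c') T (t + t') T''"
| IfTrue: "read_tape (T k) = s \<Longrightarrow> exec c T t T' \<Longrightarrow> exec (IfEq k s c c') T (t + 2) T'"
| IfFalse: "read_tape (T k) \<noteq> s \<Longrightarrow> exec c' T t T' \<Longrightarrow> exec (IfEq k s c c') T (t + 1) T'"
| WhileFalse: "read_tape (T k) = 0 \<Longrightarrow> exec (While k c) T 1 T"
| WhileTrue: "read_tape (T k) \<noteq> 0 \<Longrightarrow> exec c T t T' \<Longrightarrow> exec (While k c) T' t' T'' \<Longrightarrow>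
    exec (While k c) T (t + t' + 2) T''"

fun well_formed :: "nat \<Rightarrow> com \<Rightarrow> bool" where
  "well_formed K (Mv k m) \<longleftrightarrow> k < K"
| "well_formed K (Wr k s) \<longleftrightarrow> k < K \<and> s < 3"
| "well_formed K (c ;; c') \<longleftrightarrow> well_formed K c \<and> well_formed K c'"
| "well_formed K (IfEq k s c c') \<longleftrightarrow> k < K \<and> well_formed K c \<and> well_formed K c'"
| "well_formed K (While k c) \<longleftrightarrow> k < K \<and> well_formed K c"

lemma well_formed_mono: "well_formed K c \<Longrightarrow> K \<le> K' \<Longrightarrow> well_formed K' c"
  by (induction c) auto

section \<open>Translation of tape programs into Turing machines\<close>

type_synonym instr = "nat list \<Rightarrow> nat \<times> (nat \<times> move) list"

definition idle :: "nat list \<Rightarrow> (nat \<times> move) list" where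
  "idle ss = map (\<lambda>s. (s, Move_None)) ss"

fun code_size :: "com \<Rightarrow> nat" where
  "code_size (Mv k m) = 1"
| "code_size (Wr k s) = 1"
| "code_size (c ;; c') = code_size c + code_size c'"
| "code_size (IfEq k s c c') = code_size c + code_size c' + 2"
| "code_size (While k c) = code_size c + 2"

text \<open>Addresses are absolute: \<open>b\<close> is the state of the first instruction, and
  control leaves through the state \<open>b + code_size c\<close>. Jumps use \<open>idle\<close>, so
  they leave all tapes as they are.\<close>

fun code :: "nat \<Rightarrow> com \<Rightarrow> instr list" where
  "code b (Mv k m) = [\<lambda>ss. (b + 1, (idle ss)[k := (ss ! k, m)])]"
| "code b (Wr k s) = [\<lambda>ss. (b + 1, (idle ss)[k := (s, Move_None)])]"
| "code b (c ;; c') = code b c @ code (b + code_size c) c'"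
| "code b (IfEq k s c c') =
     [\<lambda>ss. (if ss ! k = s then b + 1 else b + 2 + code_size c, idle ss)] @ code (b + 1) c @
     [\<lambda>ss. (b + 2 + code_size c + code_size c', idle ss)] @ code (b + 2 + code_size c) c'"
| "code b (While k c) =
     [\<lambda>ss. (if ss ! k \<noteq> 0 then b + 1 else b + 2 + code_size c, idle ss)] @ code (b + 1) c @
     [\<lambda>ss. (b, idle ss)]"

lemma length_code [simp]: "length (code b c) = code_size c"
  by (induction c arbitrary: b) auto

lemma length_idle [simp]: "length (idle ss) = length ss"
  by (simp add: idle_def)

lemma symbols_idle: "fst ` set (idle ss) = set ss"
  by (force simp: idle_def)

lemma symbols_idle_update:
  "set ss \<subseteq> {..<n} \<Longrightarrow> s < n \<Longrightarrow> fst ` set ((idle ss)[k := (s, m)]) \<subseteq> {..<n}"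
  using set_update_subset_insert[of "idle ss" k "(s, m)"] symbols_idle[of ss]
  by (smt (verit) image_subset_iff insert_iff lessThan_iff prod.sel(1) subset_eq image_eqI)

lemma code_valid:
  assumes "well_formed K c" "g \<in> set (code b c)" "length ss = K" "set ss \<subseteq> {..<3}"
  shows "fst (g ss) \<le> b + code_size c" "length (snd (g ss)) = K"
    "fst ` set (snd (g ss)) \<subseteq> {..<3}"
proof -
  have "fst (g ss) \<le> b + code_size c \<and> length (snd (g ss)) = K \<and>
      fst ` set (snd (g ss)) \<subseteq> {..<3}"
    using assms(1,2)
  proof (induction c arbitrary: b)
    case (Mv k m)
    then have "ss ! k < 3" using assms(3,4) by (auto simp: subset_eq)
    then show ?case using Mv assms(3,4) symbols_idle_update[of ss 3] by simp
  next
    case (Wr k s)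
    then show ?case using assms(3,4) symbols_idle_update[of ss 3 s] by simp
  next
    case (Seq c1 c2)
    then show ?case by fastforce
  next
    case (IfEq k s c1 c2)
    from IfEq.prems(2) consider "g \<in> set (code (b + 1) c1)" | "g \<in> set (code (b + 2 + code_size c1) c2)"
      | "fst (g ss) \<le> b + code_size (IfEq k s c1 c2)" "snd (g ss) = idle ss"
      by auto
    then show ?case
      using IfEq.IH(1)[of "b + 1"] IfEq.IH(2)[of "b + 2 + code_size c1"] IfEq.prems(1) assms(3,4)
      by cases (auto simp: symbols_idle)
  next
    case (While k c)
    from While.prems(2) consider "g \<in> set (code (b + 1) c)"
      | "fst (g ss) \<le> b + code_size (While k c)" "snd (g ss) = idle ss"
      by auto
    then show ?case
      using While.IH[of "b + 1"] While.prems(1) assms(3,4)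
      by cases (auto simp: symbols_idle)
  qed
  then show "fst (g ss) \<le> b + code_size c" "length (snd (g ss)) = K"
    "fst ` set (snd (g ss)) \<subseteq> {..<3}" by auto
qed

lemma map_act_idle: "map2 act_tape (idle (map read_tape ts)) ts = ts"
proof (rule nth_equalityI)
  fix i assume "i < length (map2 act_tape (idle (map read_tape ts)) ts)"
  then show "map2 act_tape (idle (map read_tape ts)) ts ! i = ts ! i"
    by (cases "ts ! i") (auto simp: idle_def)
qed (simp add: idle_def)

lemma map_act_update:
  assumes "k < K"
  shows "map2 act_tape ((idle (map read_tape (map T [0..<K])))[k := a]) (map T [0..<K]) =
    map (T(k := act_tape a (T k))) [0..<K]"
proof (rule nth_equalityI)
  fix i assume "i < length (map2 act_tape ((idle (map read_tape (map T [0..<K])))[k := a]) (map T [0..<K]))"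
  then have "i < K" by (simp add: idle_def)
  then show "map2 act_tape ((idle (map read_tape (map T [0..<K])))[k := a]) (map T [0..<K]) ! i =
      map (T(k := act_tape a (T k))) [0..<K] ! i"
    using assms by (cases "T i") (auto simp: idle_def nth_list_update)
qed (simp add: idle_def)

text \<open>The exit state \<open>code_size c\<close> of the program turns the answer into a
  verdict: symbol 2 on tape 1 leads to acceptance, any other symbol to rejection.\<close>

definition machine :: "nat \<Rightarrow> com \<Rightarrow> tm" where
  "machine K c = \<lparr>num_tapes = K, num_symbols = 3, num_states = code_size c + 3, start_state = 0,
     accept_state = code_size c + 1, reject_state = code_size c + 2,
     trans_fun = (\<lambda>q ss.
       if q < code_size c then (code 0 c ! q) ss
       else if q = code_size c then (if ss ! 1 = 2 then q + 1 else q + 2, idle ss)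
       else (q, idle ss))\<rparr>"

lemma wf_machine:
  assumes "well_formed K c" "K \<ge> 1"
  shows "wf_tm (machine K c)"
proof -
  have "fst (trans_fun (machine K c) q ss) < code_size c + 3 \<and>
      length (snd (trans_fun (machine K c) q ss)) = K \<and>
      fst ` set (snd (trans_fun (machine K c) q ss)) \<subseteq> {..<3}"
    if "q < code_size c + 3" "length ss = K" "set ss \<subseteq> {..<3}" for q ss
  proof (cases "q < code_size c")
    case True
    then have "code 0 c ! q \<in> set (code 0 c)" by simp
    from code_valid[OF assms(1) this that(2,3)] True show ?thesis
      by (simp add: machine_def)
  next
    case False
    then show ?thesis using that by (auto simp: machine_def symbols_idle)
  qed
  then show ?thesis using assms(2) by (auto simp: wf_tm_def machine_def)
qed

lemma step_machine:
  assumes "q < code_size c" "(code 0 c ! q) (map read_tape (map T [0..<K])) = (q', as)"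
  shows "step_tm (machine K c) (q, map T [0..<K]) = (q', map2 act_tape as (map T [0..<K]))"
  using assms by (simp add: machine_def)

lemma step_machine_code:
  assumes "code 0 c = pre @ g # post" "g (map read_tape (map T [0..<K])) = (q', as)"
  shows "step_tm (machine K c) (length pre, map T [0..<K]) = (q', map2 act_tape as (map T [0..<K]))"
proof (rule step_machine)
  show "length pre < code_size c"
    using arg_cong[OF assms(1), of length] by simp
  show "(code 0 c ! length pre) (map read_tape (map T [0..<K])) = (q', as)"
    using assms by simp
qed

text \<open>The code of \<open>c\<close> may stand between \<open>pre\<close> and
  \<open>post\<close> inside a larger program \<open>d\<close>, so that the induction over
  \<open>exec\<close> can treat subprograms in place.\<close>

lemma exec_machine:
  assumes "exec c T t T'" "well_formed K c" "code 0 d = pre @ code b c @ post" "length pre = b"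
  shows "(step_tm (machine K d) ^^ t) (b, map T [0..<K]) = (b + code_size c, map T' [0..<K])"
  using assms
proof (induction arbitrary: pre b post rule: exec.induct)
  case (Mv k m T)
  show ?case
    using step_machine_code[of d pre _ post T K] map_act_update[of k K T "(read_tape (T k), m)"] Mv
    by (cases "T k") auto
next
  case (Wr k s T)
  show ?case
    using step_machine_code[of d pre _ post T K] map_act_update[of k K T "(s, Move_None)"] Wr
    by (cases "T k") auto
next
  case (Seq c T t T' c' t' T'')
  have 1: "(step_tm (machine K d) ^^ t) (b, map T [0..<K]) = (b + code_size c, map T' [0..<K])"
    using Seq.IH(1)[of pre b "code (b + code_size c) c' @ post"] Seq.prems by simp
  have 2: "(step_tm (machine K d) ^^ t') (b + code_size c, map T' [0..<K]) =
      (b + code_size c + code_size c', map T'' [0..<K])"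
    using Seq.IH(2)[of "pre @ code b c" "b + code_size c" post] Seq.prems by simp
  show ?case using 1 2
    by (subst add.commute, subst funpow_add) (simp add: add.assoc)
next
  case (IfTrue T k s c t T' c')
  let ?M = "step_tm (machine K d)"
  have 1: "?M (b, map T [0..<K]) = (b + 1, map T [0..<K])"
    using step_machine_code[of d pre _ "tl (code b (IfEq k s c c')) @ post" T K "b + 1" "idle (map read_tape (map T [0..<K]))"]
      IfTrue.prems IfTrue.hyps by (simp only: map_act_idle) simp
  have 2: "(?M ^^ t) (b + 1, map T [0..<K]) = (b + 1 + code_size c, map T' [0..<K])"
    using IfTrue.IH[of "pre @ [hd (code b (IfEq k s c c'))]" "b + 1"] IfTrue.prems by simp
  have 3: "?M (b + 1 + code_size c, map T' [0..<K]) =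
      (b + code_size (IfEq k s c c'), map T' [0..<K])"
    using step_machine_code[of d "pre @ hd (code b (IfEq k s c c')) # code (b + 1) c"
        "\<lambda>ss. (b + 2 + code_size c + code_size c', idle ss)" "code (b + 2 + code_size c) c' @ post" T' K
        "b + 2 + code_size c + code_size c'" "idle (map read_tape (map T' [0..<K]))"]
      IfTrue.prems by (simp only: map_act_idle) simp
  have "(?M ^^ (t + 2)) (b, map T [0..<K]) = ?M ((?M ^^ t) (?M (b, map T [0..<K])))"
    by (simp add: funpow_swap1)
  then show ?case using 1 2 3 by simp
next
  case (IfFalse T k s c' t T' c)
  let ?M = "step_tm (machine K d)"
  have 1: "?M (b, map T [0..<K]) = (b + 2 + code_size c, map T [0..<K])"
    using step_machine_code[of d pre _ "tl (code b (IfEq k s c c')) @ post" T K "b + 2 + code_size c" "idle (map read_tape (map T [0..<K]))"]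
      IfFalse.prems IfFalse.hyps by (simp only: map_act_idle) simp
  have 2: "(?M ^^ t) (b + 2 + code_size c, map T [0..<K]) =
      (b + 2 + code_size c + code_size c', map T' [0..<K])"
    using IfFalse.IH[of "pre @ hd (code b (IfEq k s c c')) # code (b + 1) c @
        [\<lambda>ss. (b + 2 + code_size c + code_size c', idle ss)]" "b + 2 + code_size c"] IfFalse.prems by simp
  have "(?M ^^ (t + 1)) (b, map T [0..<K]) = (?M ^^ t) (?M (b, map T [0..<K]))"
    by (simp add: funpow_swap1)
  then show ?case using 1 2 by simp
next
  case (WhileFalse T k c)
  then show ?case
    using step_machine_code[of d pre _ "tl (code b (While k c)) @ post" T K "b + 2 + code_size c" "idle (map read_tape (map T [0..<K]))"]
    by (simp only: map_act_idle) simp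
next
  case (WhileTrue T k c t T' t' T'')
  let ?M = "step_tm (machine K d)"
  have 1: "?M (b, map T [0..<K]) = (b + 1, map T [0..<K])"
    using step_machine_code[of d pre _ "tl (code b (While k c)) @ post" T K "b + 1" "idle (map read_tape (map T [0..<K]))"]
      WhileTrue.prems WhileTrue.hyps by (simp only: map_act_idle) simp
  have 2: "(?M ^^ t) (b + 1, map T [0..<K]) = (b + 1 + code_size c, map T' [0..<K])"
    using WhileTrue.IH(1)[of "pre @ [hd (code b (While k c))]" "b + 1"] WhileTrue.prems by simp
  have 3: "?M (b + 1 + code_size c, map T' [0..<K]) = (b, map T' [0..<K])"
    using step_machine_code[of d "pre @ hd (code b (While k c)) # code (b + 1) c"
        "\<lambda>ss. (b, idle ss)" post T' K b "idle (map read_tape (map T' [0..<K]))"]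
      WhileTrue.prems by (simp only: map_act_idle) simp
  have 4: "(?M ^^ t') (b, map T' [0..<K]) = (b + code_size (While k c), map T'' [0..<K])"
    using WhileTrue.IH(2)[of pre b post] WhileTrue.prems by simp
  have "(?M ^^ (t + t' + 2)) (b, map T [0..<K]) = (?M ^^ (t' + 1 + t + 1)) (b, map T [0..<K])"
    by (simp add: algebra_simps)
  also have "\<dots> = (?M ^^ t') (?M ((?M ^^ t) (?M (b, map T [0..<K]))))"
    unfolding funpow_add by simp
  finally show ?case using 1 2 3 4 by simp
qed

text \<open>Tapes from \<open>K\<close> on are invisible to the machine, so \<open>T\<close> may be
  chosen freely there. In the proof the bound grows by one for the step that reads the
  answer.\<close>

lemma PTIME_I:
  assumes "well_formed K c" "K \<ge> 2"
    and "\<And>w. \<exists>T t T'. map T [0..<K] = input_tape w # replicate (K - 1) blank_tape \<and>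
      exec c T t T' \<and> t \<le> poly p (length w) \<and> (read_tape (T' 1) = 2 \<longleftrightarrow> w \<in> L)"
  shows "L \<in> PTIME"
proof -
  have "decides_in_time (machine K c) L (poly (p + 1))"
    unfolding decides_in_time_def
  proof (intro allI)
    fix w
    obtain T t T' where T: "map T [0..<K] = input_tape w # replicate (K - 1) blank_tape"
      "exec c T t T'" "t \<le> poly p (length w)" "read_tape (T' 1) = 2 \<longleftrightarrow> w \<in> L"
      using assms(3)[of w] by auto
    have "(step_tm (machine K c) ^^ t) (0, map T [0..<K]) = (code_size c, map T' [0..<K])"
      using exec_machine[OF T(2) assms(1), of c "[]" 0 "[]"] by simp
    moreover have "fst (step_tm (machine K c) (code_size c, map T' [0..<K])) =
        (if w \<in> L then accept_state (machine K c) else reject_state (machine K c))"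
      using assms(2) T(4) by (simp add: machine_def)
    moreover have "init_config (machine K c) w = (0, map T [0..<K])"
      using T(1) by (simp add: init_config_def machine_def)
    ultimately show "\<exists>t\<le>poly (p + 1) (length w). fst ((step_tm (machine K c) ^^ t) (init_config (machine K c) w)) =
        (if w \<in> L then accept_state (machine K c) else reject_state (machine K c))"
      using T(3) by (intro exI[of _ "Suc t"]) simp
  qed
  then show ?thesis
    using wf_machine[OF assms(1)] assms(2) unfolding PTIME_def by force
qed

section \<open>Formulas over word positions\<close>

text \<open>\<open>Close\<close> carries the formula that uses the computed set, so that the set is
  stored on a tape once and then queried, instead of being recomputed at every membership
  test.\<close>

datatype fm =
    Mem nat nat
  | Lin "nat list" nat "nat list"
  | Neg fm
  | Conj fm fm
  | Exist nat fm
  | Close nat nat fm fm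

text \<open>The set is updated in place: an element added at \<open>u\<close> is visible at later
  positions of the same pass, as it is on a tape.\<close>

definition sweep :: "nat \<Rightarrow> (nat \<Rightarrow> nat set \<Rightarrow> bool) \<Rightarrow> nat set \<Rightarrow> nat set" where
  "sweep n P S = fold (\<lambda>u S. if P u S then insert u S else S) [0..<n] S"

definition generated :: "nat \<Rightarrow> (nat \<Rightarrow> nat set \<Rightarrow> bool) \<Rightarrow> nat set" where
  "generated N P = (sweep (N + 1) P ^^ (N + 1)) {}"

fun sem :: "nat \<Rightarrow> fm \<Rightarrow> (nat \<Rightarrow> nat) \<Rightarrow> (nat \<Rightarrow> nat set) \<Rightarrow> bool" where
  "sem N (Mem a x) v A \<longleftrightarrow> v x \<in> A a"
| "sem N (Lin xs c ys) v A \<longleftrightarrow> sum_list (map v xs) + c = sum_list (map v ys)"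
| "sem N (Neg \<phi>) v A \<longleftrightarrow> \<not> sem N \<phi> v A"
| "sem N (Conj \<phi> \<psi>) v A \<longleftrightarrow> sem N \<phi> v A \<and> sem N \<psi> v A"
| "sem N (Exist x \<phi>) v A \<longleftrightarrow> (\<exists>u\<le>N. sem N \<phi> (v(x := u)) A)"
| "sem N (Close a x \<phi> \<psi>) v A \<longleftrightarrow>
     sem N \<psi> v (A(a := generated N (\<lambda>u S. sem N \<phi> (v(x := u)) (A(a := S)))))"

text \<open>A binder of \<open>x\<close> also reserves \<open>x + 1\<close> as a counter, hence the
  depth \<open>x + 2\<close>. A set name may not be rebound while it is in scope, because its tape
  would be overwritten.\<close>

fun scoped :: "nat set \<Rightarrow> nat \<Rightarrow> nat set \<Rightarrow> fm \<Rightarrow> bool" where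
  "scoped V d Y (Mem a x) \<longleftrightarrow> a \<in> Y \<and> x \<in> V"
| "scoped V d Y (Lin xs c ys) \<longleftrightarrow> set xs \<subseteq> V \<and> set ys \<subseteq> V"
| "scoped V d Y (Neg \<phi>) \<longleftrightarrow> scoped V d Y \<phi>"
| "scoped V d Y (Conj \<phi> \<psi>) \<longleftrightarrow> scoped V d Y \<phi> \<and> scoped V d Y \<psi>"
| "scoped V d Y (Exist x \<phi>) \<longleftrightarrow> d \<le> x \<and> scoped (insert x V) (x + 2) Y \<phi>"
| "scoped V d Y (Close a x \<phi> \<psi>) \<longleftrightarrow> d \<le> x \<and> a \<notin> Y \<and>
     scoped (insert x V) (x + 2) (insert a Y) \<phi> \<and> scoped V d (insert a Y) \<psi>"

text \<open>The first loop drains the head of tape \<open>j\<close> down to the blank cell -1, which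
  takes one round more than its position. A head of tape \<open>k\<close> resting on -1 thus arrives
  exactly at the index stored in \<open>j\<close>. Tape 3 records the count and brings the head of
  \<open>j\<close> back.\<close>

definition shift :: "nat \<Rightarrow> nat \<Rightarrow> move \<Rightarrow> com" where
  "shift j k m =
     While j (Mv j Move_Left ;; Mv 3 Move_Right ;; Mv k m) ;;
     While 3 (Mv 3 Move_Left ;; Mv j Move_Right)"

definition scan :: "nat \<Rightarrow> com \<Rightarrow> com" where
  "scan j c = Mv j Move_Right ;; While j (c ;; Mv j Move_Right) ;;
     Mv j Move_Left ;; While j (Mv j Move_Left)"

abbreviation skip :: com where
  "skip \<equiv> Mv 0 Move_None"

definition opposite :: "move \<Rightarrow> move" where
  "opposite m = (case m of Move_Left \<Rightarrow> Move_Right | Move_None \<Rightarrow> Move_None | Move_Right \<Rightarrow> Move_Left)"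

text \<open>\<open>shift\<close> overshoots by one cell, which the opposite move corrects.\<close>

definition shift_sum :: "nat list \<Rightarrow> move \<Rightarrow> com" where
  "shift_sum xs m = foldr (\<lambda>x c. shift (2 * x + 1) 5 m ;; Mv 5 (opposite m) ;; c) xs skip"

definition repeat_mv :: "nat \<Rightarrow> move \<Rightarrow> com" where
  "repeat_mv n m = ((\<lambda>c. Mv 5 m ;; c) ^^ n) skip"

text \<open>Cell 0 is recognized as the nonblank cell whose left neighbour is blank. The first test
  guards against heads that have left the cells 0 to \<open>N\<close>, where both cells would be
  blank.\<close>

definition test_zero :: com where
  "test_zero = IfEq 5 1
     (Mv 5 Move_Left ;; IfEq 5 0 (Wr 1 2) (Wr 1 1) ;; Mv 5 Move_Right)
     (Wr 1 1)"

text \<open>Writes the symbol at the cell of tape \<open>k\<close> whose index is the head position of tape \<open>j\<close>.\<close>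

definition write_at :: "nat \<Rightarrow> nat \<Rightarrow> nat \<Rightarrow> com" where
  "write_at j k s = shift j k Move_Right ;; Wr k s ;; shift j k Move_Left"

text \<open>Even tapes hold sets as bit vectors; odd tapes hold variables as head positions over a
  unary ruler. Tape 1 returns the truth value, and tapes 3 and 5 are scratch. Evaluating the body
  overwrites tape 1, so \<open>Exist\<close> counts witnesses by the head on the tape of
  \<open>x + 1\<close>; \<open>Close\<close> counts its sweeps on the same tape. Apart from tape 1
  and sets out of scope, everything is restored.\<close>

fun compile :: "fm \<Rightarrow> com" where
  "compile (Mem a x) =
     shift (2 * x + 1) (2 * a) Move_Right ;; IfEq (2 * a) 2 (Wr 1 2) (Wr 1 1) ;;
     shift (2 * x + 1) (2 * a) Move_Left"
| "compile (Lin xs c ys) =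
     shift_sum xs Move_Right ;; shift_sum ys Move_Left ;; repeat_mv (c + 1) Move_Right ;;
     test_zero ;;
     repeat_mv (c + 1) Move_Left ;; shift_sum ys Move_Right ;; shift_sum xs Move_Left"
| "compile (Neg \<phi>) = compile \<phi> ;; IfEq 1 2 (Wr 1 1) (Wr 1 2)"
| "compile (Conj \<phi> \<psi>) = compile \<phi> ;; IfEq 1 2 (compile \<psi>) skip"
| "compile (Exist x \<phi>) =
     scan (2 * x + 1) (compile \<phi> ;; IfEq 1 2 (Mv (2 * (x + 1) + 1) Move_Right) skip) ;;
     IfEq (2 * (x + 1) + 1) 0 (Wr 1 1)
       (While (2 * (x + 1) + 1) (Mv (2 * (x + 1) + 1) Move_Left) ;; Wr 1 2)"
| "compile (Close a x \<phi> \<psi>) =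
     scan (2 * x + 1) (write_at (2 * x + 1) (2 * a) 1) ;;
     scan (2 * (x + 1) + 1) (scan (2 * x + 1)
       (compile \<phi> ;; IfEq 1 2 (write_at (2 * x + 1) (2 * a) 2) skip)) ;;
     compile \<psi>"

section \<open>Tape invariants and time-bounded execution\<close>

definition cells :: "nat \<Rightarrow> nat set \<Rightarrow> int \<Rightarrow> nat" where
  "cells N S i = (if 0 \<le> i \<and> i \<le> int N then if nat i \<in> S then 2 else 1 else 0)"

lemma cells_insert: "u \<le> N \<Longrightarrow> (cells N S)(int u := 2) = cells N (insert u S)"
  by (auto simp: cells_def fun_eq_iff)

lemma cells_remove: "u \<le> N \<Longrightarrow> (cells N S)(int u := Suc 0) = cells N (S - {u})"
  by (auto simp: cells_def fun_eq_iff)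

definition offset :: "move \<Rightarrow> int" where
  "offset m = (case m of Move_Left \<Rightarrow> -1 | Move_None \<Rightarrow> 0 | Move_Right \<Rightarrow> 1)"

lemma move_head_offset: "move_head m p = p + offset m"
  by (cases m) (auto simp: offset_def)

lemma offset_simps [simp]: "offset Move_Left = -1" "offset Move_None = 0" "offset Move_Right = 1"
  "offset (opposite m) = - offset m"
  by (cases m; simp add: offset_def opposite_def)+

lemma exec_Mv: "T' = T(k := (fst (T k), snd (T k) + offset m)) \<Longrightarrow> exec (Mv k m) T 1 T'"
  using exec.Mv[of k m T] by (simp add: move_head_offset)

lemma exec_Wr: "T' = T(k := ((fst (T k))(snd (T k) := s), snd (T k))) \<Longrightarrow> exec (Wr k s) T 1 T'"
  using exec.Wr[of k s T] by simp

lemma exec_skip: "exec skip T 1 T"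
  by (rule exec_Mv) simp

lemma read_tape_eq: "read_tape t = fst t (snd t)"
  by (cases t) simp

text \<open>\<open>runs c T b Q\<close>: started in \<open>T\<close>, the program \<open>c\<close> stops after at most \<open>b\<close> steps in a
  configuration satisfying \<open>Q\<close>.\<close>

definition runs :: "com \<Rightarrow> (nat \<Rightarrow> tape) \<Rightarrow> nat \<Rightarrow> ((nat \<Rightarrow> tape) \<Rightarrow> bool) \<Rightarrow> bool" where
  "runs c T b Q \<longleftrightarrow> (\<exists>T' t. exec c T t T' \<and> t \<le> b \<and> Q T')"

lemma runsI: "exec c T t T' \<Longrightarrow> t \<le> b \<Longrightarrow> Q T' \<Longrightarrow> runs c T b Q"
  unfolding runs_def by blast

lemma runs_mono: "runs c T b Q \<Longrightarrow> b \<le> b' \<Longrightarrow> (\<And>T'. Q T' \<Longrightarrow> Q' T') \<Longrightarrow> runs c T b' Q'"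
  unfolding runs_def by (meson le_trans)

lemma runs_Mv: "Q (T(k := (fst (T k), snd (T k) + offset m))) \<Longrightarrow> runs (Mv k m) T 1 Q"
  by (rule runsI[OF exec_Mv[OF refl]]) simp_all

lemma runs_Wr: "Q (T(k := ((fst (T k))(snd (T k) := s), snd (T k)))) \<Longrightarrow> runs (Wr k s) T 1 Q"
  by (rule runsI[OF exec_Wr[OF refl]]) simp_all

lemma runs_skip: "Q T \<Longrightarrow> 0 < b \<Longrightarrow> runs skip T b Q"
  by (rule runsI[OF exec_skip]) simp_all

lemma runs_Seq:
  assumes "runs c T b R" "\<And>T'. R T' \<Longrightarrow> runs c' T' b' Q" "b + b' \<le> B"
  shows "runs (c ;; c') T B Q"
proof -
  obtain T' t where 1: "exec c T t T'" "t \<le> b" "R T'" using assms(1) unfolding runs_def by blast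
  obtain T'' t' where 2: "exec c' T' t' T''" "t' \<le> b'" "Q T''" using assms(2)[OF 1(3)] unfolding runs_def by blast
  show ?thesis by (rule runsI[OF exec.Seq[OF 1(1) 2(1)]]) (use 1 2 assms(3) in auto)
qed

lemma runs_IfEq:
  assumes "read_tape (T k) = s \<Longrightarrow> runs c T b Q" "read_tape (T k) \<noteq> s \<Longrightarrow> runs c' T b Q" "b + 2 \<le> B"
  shows "runs (IfEq k s c c') T B Q"
proof (cases "read_tape (T k) = s")
  case True
  then obtain T' t where *: "exec c T t T'" "t \<le> b" "Q T'" using assms(1) unfolding runs_def by blast
  show ?thesis by (rule runsI[OF exec.IfTrue[OF True *(1)]]) (use * assms(3) in auto)
next
  case False
  then obtain T' t where *: "exec c' T t T'" "t \<le> b" "Q T'" using assms(2) unfolding runs_def by blast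
  show ?thesis by (rule runsI[OF exec.IfFalse[OF False *(1)]]) (use * assms(3) in auto)
qed

lemma runs_While:
  assumes "read_tape (T k) \<noteq> 0" "runs c T b R" "\<And>T'. R T' \<Longrightarrow> runs (While k c) T' b' Q" "b + b' + 2 \<le> B"
  shows "runs (While k c) T B Q"
proof -
  obtain T' t where 1: "exec c T t T'" "t \<le> b" "R T'" using assms(2) unfolding runs_def by blast
  obtain T'' t' where 2: "exec (While k c) T' t' T''" "t' \<le> b'" "Q T''"
    using assms(3)[OF 1(3)] unfolding runs_def by blast
  show ?thesis by (rule runsI[OF exec.WhileTrue[OF assms(1) 1(1) 2(1)]]) (use 1 2 assms(4) in auto)
qed

text \<open>\<open>I i\<close> is the invariant with \<open>i\<close> rounds left. The head position
  \<open>i - 1\<close> ties the number of rounds to the tape, so the loop ends exactly on the blank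
  cell -1.\<close>

lemma runs_drain:
  assumes step: "\<And>i T. I (Suc i) T \<Longrightarrow> runs c T b (I i)"
    and head: "\<And>i T. I i T \<Longrightarrow> T j = (cells N S, int i - 1)" and "I n T" "n \<le> N + 1"
  shows "runs (While j c) T (n * (b + 2) + 1) (I 0)"
  using assms(3,4)
proof (induction n arbitrary: T)
  case 0
  have "read_tape (T j) = 0" using head[OF 0(1)] by (simp add: cells_def)
  from exec.WhileFalse[of T j, OF this] show ?case by (rule runsI) (use 0 in auto)
next
  case (Suc n)
  have "read_tape (T j) \<noteq> 0" using head[OF Suc.prems(1)] Suc.prems(2) by (simp add: cells_def)
  then show ?case by (rule runs_While[OF _ step[OF Suc.prems(1)] Suc.IH]) (use Suc.prems in auto)
qed

lemma runs_rewind: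
  assumes "T j = (cells N S, int n - 1)" "n \<le> N + 1" "Q (T(j := (cells N S, -1)))"
  shows "runs (While j (Mv j Move_Left)) T (3 * N + 4) Q"
proof -
  let ?I = "\<lambda>i T'. T' = T(j := (cells N S, int i - 1))"
  have "runs (While j (Mv j Move_Left)) T (n * (1 + 2) + 1) (?I 0)"
  proof (rule runs_drain[where I = ?I])
    show "runs (Mv j Move_Left) T' 1 (?I i)" if "?I (Suc i) T'" for i T'
      by (rule runs_Mv) (simp add: that)
  qed (use assms in \<open>auto simp: fun_upd_idem\<close>)
  then show ?thesis by (rule runs_mono) (use assms in auto)
qed

lemma runs_shift:
  assumes "T j = (cells N {}, int x)" "T 3 = (cells N {}, -1)" "x \<le> N" "j \<noteq> k" "j \<noteq> 3" "k \<noteq> 3"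
    and "Q (T(k := (fst (T k), snd (T k) + offset m * (int x + 1))))"
  shows "runs (shift j k m) T (9 * N + 11) Q"
proof -
  \<comment> \<open>\<open>out i\<close> and \<open>rest i\<close> describe the first and the second
    loop with \<open>i\<close> rounds left. The positions of the heads of \<open>j\<close> and of
    tape 3 always add up to \<open>x - 1\<close>.\<close>
  define out where "out i = T(j := (cells N {}, int i - 1), 3 := (cells N {}, int x - int i),
    k := (fst (T k), snd (T k) + offset m * (int x + 1 - int i)))" for i
  define rest where "rest i = T(j := (cells N {}, int x - int i), 3 := (cells N {}, int i - 1),
    k := (fst (T k), snd (T k) + offset m * (int x + 1)))" for i
  have 1: "runs (While j (Mv j Move_Left ;; Mv 3 Move_Right ;; Mv k m)) T ((x + 1) * (3 + 2) + 1) (\<lambda>T'. T' = out 0)"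
  proof (rule runs_drain[where I = "\<lambda>i T'. T' = out i"])
    show "runs (Mv j Move_Left ;; Mv 3 Move_Right ;; Mv k m) T' 3 (\<lambda>T'. T' = out i)" if "T' = out (Suc i)" for i T'
      by (rule runsI[OF exec.Seq[OF exec_Mv[OF refl] exec.Seq[OF exec_Mv[OF refl] exec_Mv[OF refl]]]])
        (use that assms in \<open>auto simp: out_def fun_eq_iff algebra_simps\<close>)
  qed (use assms in \<open>auto simp: out_def fun_eq_iff\<close>)
  have 2: "runs (While 3 (Mv 3 Move_Left ;; Mv j Move_Right)) T' ((x + 1) * (2 + 2) + 1) (\<lambda>T'. T' = rest 0)"
    if "T' = out 0" for T'
  proof (rule runs_drain[where I = "\<lambda>i T'. T' = rest i"])
    show "runs (Mv 3 Move_Left ;; Mv j Move_Right) T' 2 (\<lambda>T'. T' = rest i)" if "T' = rest (Suc i)" for i T'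
      by (rule runsI[OF exec.Seq[OF exec_Mv[OF refl] exec_Mv[OF refl]]])
        (use that assms in \<open>auto simp: rest_def fun_eq_iff\<close>)
  qed (use that assms in \<open>auto simp: out_def rest_def fun_eq_iff\<close>)
  have "rest 0 = T(k := (fst (T k), snd (T k) + offset m * (int x + 1)))"
    using assms by (auto simp: rest_def fun_eq_iff)
  with assms(7) have Q: "Q (rest 0)" by simp
  have "runs (shift j k m) T (9 * N + 11) (\<lambda>T'. T' = rest 0)"
    unfolding shift_def by (rule runs_Seq[OF 1 2]) (use assms(3) in auto)
  then show ?thesis by (rule runs_mono) (use Q in auto)
qed

text \<open>Head positions are kept in a separate function \<open>h\<close>, since a tape in use as
  a counter has a position that is not the value of a variable in \<open>V\<close>. Variables from
  \<open>d\<close> on are parked at -1. Every set tape holds some bit vector, but its content is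
  known only for names in \<open>Y\<close>; tape 1 is unconstrained.\<close>

definition rep :: "nat \<Rightarrow> nat set \<Rightarrow> nat \<Rightarrow> nat set \<Rightarrow> (nat \<Rightarrow> int) \<Rightarrow> (nat \<Rightarrow> nat) \<Rightarrow>
    (nat \<Rightarrow> nat set) \<Rightarrow> (nat \<Rightarrow> tape) \<Rightarrow> bool" where
  "rep N V d Y h v A T \<longleftrightarrow>
     (\<forall>x>0. T (2 * x + 1) = (cells N {}, h x)) \<and>
     (\<forall>x\<in>V. 3 \<le> x \<and> x < d \<and> v x \<le> N \<and> h x = int (v x)) \<and>
     (\<forall>x. x = 1 \<or> x = 2 \<or> d \<le> x \<longrightarrow> h x = -1) \<and> 3 \<le> d \<and>
     (\<forall>a. \<exists>S. T (2 * a) = (cells N S, -1)) \<and>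
     (\<forall>a\<in>Y. T (2 * a) = (cells N (A a), -1))"

lemma rep_var: "rep N V d Y h v A T \<Longrightarrow> x > 0 \<Longrightarrow> T (2 * x + 1) = (cells N {}, h x)"
  by (auto simp: rep_def)

lemma rep_var_in: "rep N V d Y h v A T \<Longrightarrow> x \<in> V \<Longrightarrow>
    T (2 * x + 1) = (cells N {}, int (v x)) \<and> v x \<le> N \<and> 3 \<le> x \<and> x < d"
  by (auto simp: rep_def)

lemma rep_temp:
  assumes "rep N V d Y h v A T"
  shows "T 3 = (cells N {}, -1)" "T 5 = (cells N {}, -1)"
proof -
  have "h 1 = -1" "h 2 = -1" using assms by (auto simp: rep_def)
  then show "T 3 = (cells N {}, -1)" "T 5 = (cells N {}, -1)"
    using rep_var[OF assms, of 1] rep_var[OF assms, of 2] by auto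
qed

lemma rep_flag: "rep N V d Y h v A T \<Longrightarrow> (\<And>k. k \<noteq> 1 \<Longrightarrow> T' k = T k) \<Longrightarrow> rep N V d Y h v A T'"
proof -
  assume "rep N V d Y h v A T" "\<And>k. k \<noteq> 1 \<Longrightarrow> T' k = T k"
  moreover have "2 * x + 1 \<noteq> 1" if "x > 0" for x :: nat using that by simp
  moreover have "2 * a \<noteq> 1" for a :: nat by presburger
  ultimately show ?thesis by (auto simp: rep_def)
qed

definition answers :: "nat \<Rightarrow> nat set \<Rightarrow> nat \<Rightarrow> nat set \<Rightarrow> (nat \<Rightarrow> int) \<Rightarrow> (nat \<Rightarrow> nat) \<Rightarrow>
    (nat \<Rightarrow> nat set) \<Rightarrow> bool \<Rightarrow> (nat \<Rightarrow> tape) \<Rightarrow> bool" where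
  "answers N V d Y h v A b T \<longleftrightarrow> rep N V d Y h v A T \<and> (read_tape (T 1) = 2 \<longleftrightarrow> b)"

lemma runs_answer:
  assumes "rep N V d Y h v A T" "s = 2 \<longleftrightarrow> b"
  shows "runs (Wr 1 s) T 1 (answers N V d Y h v A b)"
  by (rule runs_Wr) (use assms in \<open>auto simp: answers_def read_tape_eq intro: rep_flag[of N V d Y h v A T]\<close>)

text \<open>The polynomial depends on the formula and its scope, not on the word, the assignment or
  the sets; this uniformity is what a polynomial time bound demands.\<close>

definition realizes :: "nat set \<Rightarrow> nat \<Rightarrow> nat set \<Rightarrow> fm \<Rightarrow> nat poly \<Rightarrow> bool" where
  "realizes V d Y \<phi> p \<longleftrightarrow> (\<forall>N h v A T. rep N V d Y h v A T \<longrightarrow>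
     runs (compile \<phi>) T (poly p N) (answers N V d Y h v A (sem N \<phi> v A)))"

lemma realizesD:
  "realizes V d Y \<phi> p \<Longrightarrow> rep N V d Y h v A T \<Longrightarrow>
    runs (compile \<phi>) T (poly p N) (answers N V d Y h v A (sem N \<phi> v A))"
  by (simp add: realizes_def)

lemma realizes_Mem:
  assumes "a \<in> Y" "x \<in> V"
  shows "realizes V d Y (Mem a x) [:30, 18:]"
  unfolding realizes_def
proof (intro allI impI)
  fix N h v A T
  let ?Q = "answers N V d Y h v A (sem N (Mem a x) v A)"
  assume rep: "rep N V d Y h v A T"
  let ?j = "2 * x + 1" and ?k = "2 * a"
  have x: "T ?j = (cells N {}, int (v x))" "v x \<le> N" "?j \<noteq> 1" "?j \<noteq> 3" "?j \<noteq> ?k"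
    using rep_var_in[OF rep assms(2)] by (auto, presburger)
  have a: "T ?k = (cells N (A a), -1)" using rep assms(1) by (simp add: rep_def)
  have ne: "?k \<noteq> 1" "?k \<noteq> 3" by presburger+
  let ?T1 = "T(?k := (cells N (A a), int (v x)))"
  let ?R = "\<lambda>T'. \<exists>f. T' = ?T1(1 := f) \<and> (read_tape f = 2 \<longleftrightarrow> v x \<in> A a)"
  have wr: "runs (Wr 1 s) ?T1 1 ?R" if "s = 2 \<longleftrightarrow> v x \<in> A a" for s
    by (rule runs_Wr, rule exI, rule conjI[OF refl]) (use that in \<open>simp add: read_tape_eq\<close>)
  have 1: "runs (shift ?j ?k Move_Right) T (9 * N + 11) (\<lambda>T'. T' = ?T1)"
    by (rule runs_shift) (use x a ne rep_temp[OF rep] in auto)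
  have 2: "runs (IfEq ?k 2 (Wr 1 2) (Wr 1 1)) T' 3 ?R" if "T' = ?T1" for T'
    unfolding that by (rule runs_IfEq[OF wr wr]) (use x(2) in \<open>auto simp: cells_def split: if_splits\<close>)
  have 3: "runs (shift ?j ?k Move_Left) T' (9 * N + 11) ?Q"
    if "?R T'" for T'
  proof -
    from that obtain f where f: "T' = ?T1(1 := f)" "read_tape f = 2 \<longleftrightarrow> v x \<in> A a" by blast
    have "T'(?k := (cells N (A a), -1)) = T(1 := f)" using f a ne by (auto simp: fun_eq_iff)
    moreover have "?Q (T(1 := f))"
      using rep_flag[OF rep, of "T(1 := f)"] f(2) by (simp add: answers_def)
    ultimately show ?thesis
      by (intro runs_shift[where x = "v x"]) (use f x ne rep_temp[OF rep] in auto)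
  qed
  show "runs (compile (Mem a x)) T (poly [:30, 18:] N) ?Q"
    unfolding compile.simps by (rule runs_Seq[OF 1 runs_Seq[OF 2 3 le_refl]]) simp_all
qed

text \<open>Tape 5 is the scratch tape on which the two sums of an equation are compared.\<close>

definition tracks :: "nat \<Rightarrow> (nat \<Rightarrow> tape) \<Rightarrow> int \<Rightarrow> (nat \<Rightarrow> tape) \<Rightarrow> bool" where
  "tracks N T p T' \<longleftrightarrow> (\<forall>k. k \<noteq> 1 \<longrightarrow> k \<noteq> 5 \<longrightarrow> T' k = T k) \<and> T' 5 = (cells N {}, p)"

lemma runs_shift_sum:
  assumes "set xs \<subseteq> V" "rep N V d Y h v A T" "tracks N T p T'" "q = p + offset m * int (sum_list (map v xs))"
  shows "runs (shift_sum xs m) T' (length xs * (9 * N + 12) + 1) (\<lambda>T''. tracks N T q T'' \<and> T'' 1 = T' 1)"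
  using assms(1,3,4)
proof (induction xs arbitrary: T' p)
  case Nil
  then show ?case unfolding shift_sum_def by (auto intro: runs_skip)
next
  case (Cons x xs)
  have x: "T' (2 * x + 1) = (cells N {}, int (v x))" "v x \<le> N" "2 * x + 1 \<noteq> 1" "2 * x + 1 \<noteq> 3" "2 * x + 1 \<noteq> 5"
    using rep_var_in[OF assms(2), of x] Cons.prems by (auto simp: tracks_def)
  have "T' 3 = (cells N {}, -1)" using rep_temp[OF assms(2)] Cons.prems by (auto simp: tracks_def)
  then have "runs (shift (2 * x + 1) 5 m) T' (9 * N + 11)
      (\<lambda>T''. tracks N T (p + offset m * (int (v x) + 1)) T'' \<and> T'' 1 = T' 1)"
    by (intro runs_shift[where x = "v x"]) (use x Cons.prems in \<open>auto simp: tracks_def\<close>)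
  moreover have "runs (Mv 5 (opposite m) ;; shift_sum xs m) T'' (length xs * (9 * N + 12) + 2)
      (\<lambda>T''. tracks N T q T'' \<and> T'' 1 = T' 1)"
    if T'': "tracks N T (p + offset m * (int (v x) + 1)) T'' \<and> T'' 1 = T' 1" for T''
  proof (rule runs_Seq)
    show "runs (Mv 5 (opposite m)) T'' 1 (\<lambda>T''. tracks N T (p + offset m * int (v x)) T'' \<and> T'' 1 = T' 1)"
      by (rule runs_Mv) (use T'' in \<open>auto simp: tracks_def algebra_simps\<close>)
    show "runs (shift_sum xs m) T3 (length xs * (9 * N + 12) + 1) (\<lambda>T''. tracks N T q T'' \<and> T'' 1 = T' 1)"
      if "tracks N T (p + offset m * int (v x)) T3 \<and> T3 1 = T' 1" for T3
      using Cons.IH[of "p + offset m * int (v x)" T3] Cons.prems that by (auto simp: algebra_simps)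
  qed simp
  ultimately show ?case
    unfolding shift_sum_def foldr.simps o_apply by (rule runs_Seq) simp_all
qed

lemma runs_repeat_mv:
  assumes "tracks N T p T'" "q = p + offset m * int n"
  shows "runs (repeat_mv n m) T' (n + 1) (\<lambda>T''. tracks N T q T'' \<and> T'' 1 = T' 1)"
  using assms
proof (induction n arbitrary: T' p)
  case 0
  then show ?case unfolding repeat_mv_def by (auto intro: runs_skip)
next
  case (Suc n)
  have "runs (Mv 5 m) T' 1 (\<lambda>T''. tracks N T (p + offset m) T'' \<and> T'' 1 = T' 1)"
    by (rule runs_Mv) (use Suc.prems in \<open>auto simp: tracks_def\<close>)
  moreover have "runs (repeat_mv n m) T'' (n + 1) (\<lambda>T''. tracks N T q T'' \<and> T'' 1 = T' 1)"
    if "tracks N T (p + offset m) T'' \<and> T'' 1 = T' 1" for T''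
    using Suc.IH[of "p + offset m" T''] Suc.prems that by (auto simp: algebra_simps)
  ultimately show ?case
    unfolding repeat_mv_def funpow.simps o_apply by (rule runs_Seq) simp_all
qed

lemma runs_test_zero:
  assumes "tracks N T p T'"
  shows "runs test_zero T' 8 (\<lambda>T''. tracks N T p T'' \<and> (read_tape (T'' 1) = 2 \<longleftrightarrow> p = 0))"
proof -
  have T5: "T' 5 = (cells N {}, p)" using assms by (simp add: tracks_def)
  have wr: "runs (Wr 1 s) S 1 (\<lambda>S. tracks N T r S \<and> (read_tape (S 1) = 2 \<longleftrightarrow> p = 0))"
    if "tracks N T r S" "s = 2 \<longleftrightarrow> p = 0" for s S r
    by (rule runs_Wr) (use that in \<open>auto simp: tracks_def read_tape_eq\<close>)
  have "runs (Mv 5 Move_Left ;; IfEq 5 0 (Wr 1 2) (Wr 1 1) ;; Mv 5 Move_Right) T' 5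
      (\<lambda>S. tracks N T p S \<and> (read_tape (S 1) = 2 \<longleftrightarrow> p = 0))" if p: "0 \<le> p" "p \<le> int N"
  proof (rule runs_Seq)
    show "runs (Mv 5 Move_Left) T' 1 (tracks N T (p - 1))"
      by (rule runs_Mv) (use assms in \<open>auto simp: tracks_def\<close>)
    show "runs (IfEq 5 0 (Wr 1 2) (Wr 1 1) ;; Mv 5 Move_Right) S 4
        (\<lambda>S. tracks N T p S \<and> (read_tape (S 1) = 2 \<longleftrightarrow> p = 0))" if S: "tracks N T (p - 1) S" for S
    proof (rule runs_Seq)
      show "runs (IfEq 5 0 (Wr 1 2) (Wr 1 1)) S 3
          (\<lambda>S. tracks N T (p - 1) S \<and> (read_tape (S 1) = 2 \<longleftrightarrow> p = 0))"
        by (rule runs_IfEq[OF wr wr]) (use S p in \<open>auto simp: tracks_def cells_def split: if_splits\<close>)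
      show "runs (Mv 5 Move_Right) S' 1 (\<lambda>S. tracks N T p S \<and> (read_tape (S 1) = 2 \<longleftrightarrow> p = 0))"
        if "tracks N T (p - 1) S' \<and> (read_tape (S' 1) = 2 \<longleftrightarrow> p = 0)" for S'
        by (rule runs_Mv) (use that in \<open>auto simp: tracks_def\<close>)
    qed simp
  qed simp
  moreover have "0 \<le> p \<and> p \<le> int N" if "read_tape (T' 5) = 1"
    using that T5 by (simp add: cells_def split: if_splits)
  moreover have "p \<noteq> 0" if "read_tape (T' 5) \<noteq> 1" using that T5 by (auto simp: cells_def)
  then have "runs (Wr 1 1) T' 5 (\<lambda>S. tracks N T p S \<and> (read_tape (S 1) = 2 \<longleftrightarrow> p = 0))"
    if "read_tape (T' 5) \<noteq> 1" using that wr[OF assms, of 1] by (auto intro: runs_mono)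
  ultimately show ?thesis unfolding test_zero_def by (intro runs_IfEq[where b = 5]) auto
qed

lemma realizes_Lin:
  assumes xs: "set xs \<subseteq> V" and ys: "set ys \<subseteq> V"
  shows "realizes V d Y (Lin xs c ys) ([:2 * length xs + 2 * length ys:] * [:12, 9:] + [:16 + 2 * c:])"
  unfolding realizes_def
proof (intro allI impI)
  fix N h v A T
  assume rep: "rep N V d Y h v A T"
  let ?x = "int (sum_list (map v xs))" and ?y = "int (sum_list (map v ys))"
  \<comment> \<open>The head of tape 5 starts at -1. The \<open>c + 1\<close> extra moves compensate
    for this, so that it comes to rest on cell \<open>?z\<close>, and the equation holds if and only
    if that is cell 0.\<close>
  let ?z = "?x - ?y + int c"
  let ?X = "length xs * (9 * N + 12) + 1" and ?Y = "length ys * (9 * N + 12) + 1"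
  let ?R = "\<lambda>p T'. tracks N T p T' \<and> (read_tape (T' 1) = 2 \<longleftrightarrow> ?z = 0)"
  note sx = runs_shift_sum[OF xs rep] and sy = runs_shift_sum[OF ys rep]
  have "tracks N T (-1) T" using rep_temp[OF rep] by (simp add: tracks_def)
  then have 1: "runs (shift_sum xs Move_Right) T ?X (tracks N T (-1 + ?x))"
    by (intro runs_mono[OF sx[where q = "-1 + ?x"]]) auto
  have 2: "runs (shift_sum ys Move_Left) T' ?Y (tracks N T (-1 + ?x - ?y))"
    if "tracks N T (-1 + ?x) T'" for T' using that by (intro runs_mono[OF sy[where q = "-1 + ?x - ?y"]]) auto
  have 3: "runs (repeat_mv (c + 1) Move_Right) T' (c + 2) (tracks N T ?z)"
    if "tracks N T (-1 + ?x - ?y) T'" for T' using that by (intro runs_mono[OF runs_repeat_mv[where q = ?z]]) auto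
  have 4: "runs test_zero T' 8 (?R ?z)" if "tracks N T ?z T'" for T'
    using that by (rule runs_test_zero)
  have 5: "runs (repeat_mv (c + 1) Move_Left) T' (c + 2) (?R (-1 + ?x - ?y))" if "?R ?z T'" for T'
    using that by (intro runs_mono[OF runs_repeat_mv[where q = "-1 + ?x - ?y"]]) auto
  have 6: "runs (shift_sum ys Move_Right) T' ?Y (?R (-1 + ?x))" if "?R (-1 + ?x - ?y) T'" for T'
    using that by (intro runs_mono[OF sy[where q = "-1 + ?x"]]) auto
  have 7: "runs (shift_sum xs Move_Left) T' ?X (?R (-1))" if "?R (-1 + ?x) T'" for T'
    using that by (intro runs_mono[OF sx[where q = "-1"]]) auto
  have "runs (compile (Lin xs c ys)) T (?X + (?Y + (c + 2 + (8 + (c + 2 + (?Y + ?X)))))) (?R (-1))"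
    unfolding compile.simps
    by (rule runs_Seq[OF 1 runs_Seq[OF 2 runs_Seq[OF 3 runs_Seq[OF 4 runs_Seq[OF 5
      runs_Seq[OF 6 7 le_refl] le_refl] le_refl] le_refl] le_refl]]) simp_all
  then show "runs (compile (Lin xs c ys)) T
      (poly ([:2 * length xs + 2 * length ys:] * [:12, 9:] + [:16 + 2 * c:]) N)
      (answers N V d Y h v A (sem N (Lin xs c ys) v A))"
  proof (rule runs_mono)
    fix T' assume T': "?R (-1) T'"
    have "T' k = T k" if "k \<noteq> 1" for k
      using T' that rep_temp(2)[OF rep] by (cases "k = 5") (auto simp: tracks_def)
    moreover have "?z = 0 \<longleftrightarrow> int (sum_list (map v xs) + c) = ?y" by auto
    ultimately show "answers N V d Y h v A (sem N (Lin xs c ys) v A) T'"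
      using T' rep_flag[OF rep, of T'] unfolding answers_def of_nat_eq_iff by simp
  qed (simp add: algebra_simps)
qed

lemma realizes_Neg:
  assumes "realizes V d Y \<phi> p"
  shows "realizes V d Y (Neg \<phi>) (p + 3)"
  unfolding realizes_def compile.simps
proof (intro allI impI)
  fix N h v A T
  let ?Q = "answers N V d Y h v A (sem N (Neg \<phi>) v A)"
  assume "rep N V d Y h v A T"
  from realizesD[OF assms this]
  show "runs (compile \<phi> ;; IfEq 1 2 (Wr 1 1) (Wr 1 2)) T (poly (p + 3) N) ?Q"
  proof (rule runs_Seq)
    show "runs (IfEq 1 2 (Wr 1 1) (Wr 1 2)) T' 3 ?Q"
      if "answers N V d Y h v A (sem N \<phi> v A) T'" for T'
      by (rule runs_IfEq[OF runs_answer runs_answer]) (use that in \<open>simp_all add: answers_def\<close>)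
  qed simp
qed

lemma realizes_Conj:
  assumes "realizes V d Y \<phi> p" "realizes V d Y \<psi> q"
  shows "realizes V d Y (Conj \<phi> \<psi>) (p + q + 3)"
  unfolding realizes_def compile.simps
proof (intro allI impI)
  fix N h v A T
  let ?Q = "answers N V d Y h v A (sem N (Conj \<phi> \<psi>) v A)"
  assume "rep N V d Y h v A T"
  from realizesD[OF assms(1) this]
  show "runs (compile \<phi> ;; IfEq 1 2 (compile \<psi>) skip) T (poly (p + q + 3) N) ?Q"
  proof (rule runs_Seq)
    fix T' assume T': "answers N V d Y h v A (sem N \<phi> v A) T'"
    then have rep': "rep N V d Y h v A T'" by (simp add: answers_def)
    show "runs (IfEq 1 2 (compile \<psi>) skip) T' (poly q N + 1 + 2) ?Q"
    proof (rule runs_IfEq)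
      assume "read_tape (T' 1) = 2"
      then have "sem N (Conj \<phi> \<psi>) v A \<longleftrightarrow> sem N \<psi> v A" using T' by (simp add: answers_def)
      then show "runs (compile \<psi>) T' (poly q N + 1) ?Q"
        using realizesD[OF assms(2) rep'] by (auto intro: runs_mono)
    next
      assume "read_tape (T' 1) \<noteq> 2"
      then have "?Q T'" using T' by (simp add: answers_def)
      then show "runs skip T' (poly q N + 1) ?Q"
        by (rule runs_skip) simp
    qed simp
  qed simp
qed

lemma rep_bind:
  assumes "rep N V (x + 2) Y h v A T" "h x = int u" "u \<le> N" "d \<le> x" "3 \<le> d" "\<forall>y\<in>V. y < d"
  shows "rep N (insert x V) (x + 2) Y h (v(x := u)) A T"
  using assms unfolding rep_def by fastforce

lemma rep_unbind:
  assumes "rep N (insert x V) (x + 2) Y h (v(x := u)) A T" "d \<le> x" "\<forall>y\<in>V. y < d"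
  shows "rep N V (x + 2) Y h v A T"
  using assms unfolding rep_def by fastforce

lemma rep_move:
  assumes "rep N V e Y h v A T" "d \<le> x" "0 < x" "x < e" "\<forall>y\<in>V. y < d" "3 \<le> d"
  shows "rep N V e Y (h(x := p)) v A (T(2 * x + 1 := (cells N {}, p)))"
proof -
  let ?T = "T(2 * x + 1 := (cells N {}, p))"
  have "2 * a \<noteq> 2 * x + 1" for a by presburger
  then have even: "?T (2 * a) = T (2 * a)" for a by (metis fun_upd_other)
  have odd: "?T (2 * y + 1) = (if x = y then (cells N {}, p) else T (2 * y + 1))" for y by simp
  show ?thesis using assms unfolding rep_def even odd by auto
qed

lemma rep_deepen:
  assumes "rep N V d Y h v A T" "d \<le> e" shows "rep N V e Y h v A T"
  using assms unfolding rep_def by fastforce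

text \<open>Both representations share the head positions \<open>h\<close>, so the variables that an
  inner computation used between \<open>d\<close> and \<open>e\<close> are parked again.\<close>

lemma rep_shallow:
  assumes "rep N V d Y h v A T" "rep N V e Y h v A T'" shows "rep N V d Y h v A T'"
  using assms unfolding rep_def by fastforce

lemma runs_move_var:
  assumes "rep N V e Y h v A T" "d \<le> x" "x < e" "\<forall>y\<in>V. y < d" "3 \<le> d" "h' = h(x := h x + offset m)"
  shows "runs (Mv (2 * x + 1) m) T 1 (rep N V e Y h' v A)"
proof (rule runs_Mv)
  have "T (2 * x + 1) = (cells N {}, h x)" using rep_var[OF assms(1), of x] assms(2,5) by simp
  then show "rep N V e Y h' v A (T(2 * x + 1 := (fst (T (2 * x + 1)), snd (T (2 * x + 1)) + offset m)))"
    using rep_move[OF assms(1,2) _ assms(3,4,5), of "h x + offset m"] assms(2,5,6) by simp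
qed

lemma runs_rewind_var:
  assumes "rep N V e Y h v A T" "d \<le> x" "x < e" "\<forall>y\<in>V. y < d" "3 \<le> d" "h x = int n - 1" "n \<le> N + 1"
    and "h' = h(x := -1)"
  shows "runs (While (2 * x + 1) (Mv (2 * x + 1) Move_Left)) T (3 * N + 4) (rep N V e Y h' v A)"
proof (rule runs_rewind)
  show "T (2 * x + 1) = (cells N {}, int n - 1)" using rep_var[OF assms(1), of x] assms by simp
  show "rep N V e Y h' v A (T(2 * x + 1 := (cells N {}, -1)))"
    unfolding assms(8) by (rule rep_move[OF assms(1,2) _ assms(3,4,5)]) (use assms in simp)
qed (rule assms)

text \<open>\<open>g i\<close> and \<open>A i\<close> are the other head positions and the sets once
  the body has treated the positions below \<open>i\<close>. In this form one lemma serves counting,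
  clearing and sweeping.\<close>

lemma runs_scan:
  assumes d: "d \<le> x" "x < e" "\<forall>y\<in>V. y < d" "3 \<le> d" and g: "\<And>i. g i x = -1"
    and rep: "rep N V e Y (g 0) v (A 0) T"
    and step: "\<And>i T. i \<le> N \<Longrightarrow> rep N V e Y ((g i)(x := int i)) v (A i) T \<Longrightarrow>
      runs c T B (rep N V e Y ((g (Suc i))(x := int i)) v (A (Suc i)))"
  shows "runs (scan (2 * x + 1) c) T ((N + 1) * (B + 6) + 4) (rep N V e Y (g (N + 1)) v (A (N + 1)))"
proof -
  let ?j = "2 * x + 1"
  let ?I = "\<lambda>i. rep N V e Y ((g i)(x := int i)) v (A i)"
  have pos: "T ?j = (cells N {}, int i)" if "?I i T" for i T
    using rep_var[OF that, of x] d by simp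
  have "runs (While ?j (c ;; Mv ?j Move_Right)) T (n * (B + 3) + 1) (?I (N + 1))"
    if "n \<le> N + 1" "?I (N + 1 - n) T" for n T
    using that
  proof (induction n arbitrary: T)
    case 0
    from 0(2) have "?I (N + 1) T" unfolding diff_zero .
    from pos[OF this] have "read_tape (T ?j) = 0" by (simp add: cells_def)
    from exec.WhileFalse[of T ?j, OF this] show ?case by (rule runsI) (use 0 in auto)
  next
    case (Suc n)
    let ?i = "N - n"
    have i: "N + 1 - Suc n = ?i" "N + 1 - n = Suc ?i" "?i \<le> N" using Suc.prems by auto
    have body: "runs (c ;; Mv ?j Move_Right) T (B + 1) (?I (Suc ?i))"
    proof (rule runs_Seq)
      show "runs c T B (rep N V e Y ((g (Suc ?i))(x := int ?i)) v (A (Suc ?i)))"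
        using Suc.prems(2) unfolding i(1) by (rule step[OF i(3)])
      show "runs (Mv ?j Move_Right) T' 1 (?I (Suc ?i))"
        if "rep N V e Y ((g (Suc ?i))(x := int ?i)) v (A (Suc ?i)) T'" for T'
        by (rule runs_move_var[OF that d]) (simp add: add.commute)
    qed simp
    have rest: "runs (While ?j (c ;; Mv ?j Move_Right)) T' (n * (B + 3) + 1) (?I (N + 1))"
      if "?I (Suc ?i) T'" for T'
      by (rule Suc.IH, use Suc.prems(1) in simp, unfold i(2), rule that)
    have "read_tape (T ?j) \<noteq> 0"
      using pos[OF Suc.prems(2)] i(3) unfolding i(1) by (simp add: cells_def)
    then show ?case by (rule runs_While[OF _ body rest]) simp_all
  qed
  from this[of "N + 1"] have loop: "runs (While ?j (c ;; Mv ?j Move_Right)) T ((N + 1) * (B + 3) + 1) (?I (N + 1))"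
    if "?I 0 T" for T using that by simp
  have first: "runs (Mv ?j Move_Right) T 1 (?I 0)"
    by (rule runs_move_var[OF rep d]) (simp add: g)
  have left: "runs (Mv ?j Move_Left) T' 1 (rep N V e Y ((g (N + 1))(x := int N)) v (A (N + 1)))"
    if "?I (N + 1) T'" for T' by (rule runs_move_var[OF that d]) simp
  have "g (N + 1) = (g (N + 1))(x := -1)" using g by (simp add: fun_upd_idem)
  then have rewind: "runs (While ?j (Mv ?j Move_Left)) T' (3 * N + 4) (rep N V e Y (g (N + 1)) v (A (N + 1)))"
    if "rep N V e Y ((g (N + 1))(x := int N)) v (A (N + 1)) T'" for T'
    by (intro runs_rewind_var[OF that d, where n = "N + 1"]) simp_all
  show ?thesis
    unfolding scan_def
    by (rule runs_Seq[OF first runs_Seq[OF loop runs_Seq[OF left rewind le_refl] le_refl]]) (simp_all add: algebra_simps)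
qed

lemma realizes_Exist:
  assumes \<phi>: "realizes (insert x V) (x + 2) Y \<phi> p" and "d \<le> x"
  shows "realizes V d Y (Exist x \<phi>) ([:1, 1:] * (p + 9) + [:12, 3:])"
  unfolding realizes_def compile.simps
proof (intro allI impI)
  fix N h v A T
  assume rep: "rep N V d Y h v A T"
  then have d: "3 \<le> d" "\<forall>y\<in>V. y < d" "h x = -1" "h (x + 1) = -1"
    using \<open>d \<le> x\<close> by (auto simp: rep_def)
  let ?j = "2 * x + 1" and ?y = "2 * (x + 1) + 1"
  \<comment> \<open>The counter head stands at the number of witnesses found so far minus one. At
    most \<open>N + 1\<close> witnesses exist, so once it has left -1 it stays on nonblank
    cells.\<close>
  let ?S = "\<lambda>i. {u. u < i \<and> sem N \<phi> (v(x := u)) A}"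
  define g where "g i = h(x + 1 := int (card (?S i)) - 1)" for i
  have S: "?S (Suc i) = (if sem N \<phi> (v(x := i)) A then insert i (?S i) else ?S i)" for i
    by (auto simp: less_Suc_eq)
  have g0: "g 0 = h" using d by (simp add: g_def fun_upd_idem)
  have scan: "runs (scan ?j (compile \<phi> ;; IfEq 1 2 (Mv ?y Move_Right) skip)) T
      ((N + 1) * ((poly p N + 3) + 6) + 4) (rep N V (x + 2) Y (g (N + 1)) v A)"
  proof (rule runs_scan[where d = d and A = "\<lambda>_. A"])
    fix i T
    assume i: "i \<le> N" "rep N V (x + 2) Y ((g i)(x := int i)) v A T"
    have "rep N (insert x V) (x + 2) Y ((g i)(x := int i)) (v(x := i)) A T"
      by (rule rep_bind[where d = d]) (use i d \<open>d \<le> x\<close> in auto)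
    from realizesD[OF \<phi> this]
    show "runs (compile \<phi> ;; IfEq 1 2 (Mv ?y Move_Right) skip) T (poly p N + 3)
        (rep N V (x + 2) Y ((g (Suc i))(x := int i)) v A)"
    proof (rule runs_Seq)
      fix T'
      assume T': "answers N (insert x V) (x + 2) Y ((g i)(x := int i)) (v(x := i)) A (sem N \<phi> (v(x := i)) A) T'"
      then have rep': "rep N V (x + 2) Y ((g i)(x := int i)) v A T'"
        using rep_unbind[of N x V] \<open>d \<le> x\<close> d unfolding answers_def by blast
      have flag: "read_tape (T' 1) = 2 \<longleftrightarrow> sem N \<phi> (v(x := i)) A" using T' by (simp add: answers_def)
      show "runs (IfEq 1 2 (Mv ?y Move_Right) skip) T' 3 (rep N V (x + 2) Y ((g (Suc i))(x := int i)) v A)"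
      proof (rule runs_IfEq)
        assume "read_tape (T' 1) = 2"
        then have "(g (Suc i))(x := int i) = ((g i)(x := int i))(x + 1 := ((g i)(x := int i)) (x + 1) + offset Move_Right)"
          using flag by (simp add: g_def S fun_upd_twist)
        then show "runs (Mv ?y Move_Right) T' 1 (rep N V (x + 2) Y ((g (Suc i))(x := int i)) v A)"
          by (intro runs_move_var[OF rep', where d = d]) (use d \<open>d \<le> x\<close> in auto)
      next
        assume "read_tape (T' 1) \<noteq> 2"
        then have "g (Suc i) = g i" using flag by (simp add: g_def S)
        then show "runs skip T' 1 (rep N V (x + 2) Y ((g (Suc i))(x := int i)) v A)"
          using rep' by (intro runs_skip) simp_all
      qed simp
    qed simp
  next
    show "rep N V (x + 2) Y (g 0) v A T" unfolding g0 by (rule rep_deepen[OF rep]) (use \<open>d \<le> x\<close> in simp)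
    show "g i x = -1" for i using d by (simp add: g_def)
  qed (use d \<open>d \<le> x\<close> in auto)
  have fin: "finite (?S (N + 1))" by simp
  have card: "card (?S (N + 1)) \<le> N + 1"
    using card_mono[of "{..<N + 1}" "?S (N + 1)"] by auto
  have sem: "sem N (Exist x \<phi>) v A \<longleftrightarrow> card (?S (N + 1)) \<noteq> 0"
    unfolding card_0_eq[OF fin] by (auto simp: less_Suc_eq_le)
  let ?Q = "answers N V d Y h v A (sem N (Exist x \<phi>) v A)"
  have "runs (IfEq ?y 0 (Wr 1 1) (While ?y (Mv ?y Move_Left) ;; Wr 1 2)) T' (3 * N + 7) ?Q"
    if T': "rep N V (x + 2) Y (g (N + 1)) v A T'" for T'
  proof (rule runs_IfEq)
    have y: "T' ?y = (cells N {}, int (card (?S (N + 1))) - 1)"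
      using rep_var[OF T', of "x + 1"] unfolding g_def by simp
    {
      assume "read_tape (T' ?y) = 0"
      then have c: "card (?S (N + 1)) = 0" using card unfolding y by (simp add: cells_def split: if_splits)
      then have "g (N + 1) = h" using d by (simp add: g_def fun_upd_idem)
      then have "runs (Wr 1 1) T' 1 ?Q"
        by (intro runs_answer rep_shallow[OF rep]) (use T' c sem in auto)
      then show "runs (Wr 1 1) T' (3 * N + 5) ?Q" by (rule runs_mono) auto
    next
      assume nonblank: "read_tape (T' ?y) \<noteq> 0"
      have c: "card (?S (N + 1)) \<noteq> 0"
      proof
        assume c: "card (?S (N + 1)) = 0"
        show False using nonblank unfolding y c by (simp add: cells_def)
      qed
      have "runs (While ?y (Mv ?y Move_Left)) T' (3 * N + 4) (rep N V (x + 2) Y h v A)"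
        by (rule runs_rewind_var[OF T', where d = d and n = "card (?S (N + 1))"])
          (use d \<open>d \<le> x\<close> card in \<open>auto simp: g_def fun_upd_idem\<close>)
      then show "runs (While ?y (Mv ?y Move_Left) ;; Wr 1 2) T' (3 * N + 5) ?Q"
      proof (rule runs_Seq)
        show "runs (Wr 1 2) T'' 1 ?Q" if "rep N V (x + 2) Y h v A T''" for T''
          by (rule runs_answer[OF rep_shallow[OF rep that]]) (use c sem in simp)
      qed simp
    }
  qed simp
  from runs_Seq[OF scan this]
  show "runs (scan ?j (compile \<phi> ;; IfEq 1 2 (Mv ?y Move_Right) skip) ;;
      IfEq ?y 0 (Wr 1 1) (While ?y (Mv ?y Move_Left) ;; Wr 1 2)) T (poly ([:1, 1:] * (p + 9) + [:12, 3:]) N) ?Q"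
    by (simp add: algebra_simps)
qed

lemma rep_write:
  assumes "rep N V e Y h v A T" "a \<notin> Y"
  shows "rep N V e (insert a Y) h v (A(a := S)) (T(2 * a := (cells N S, -1)))"
proof -
  let ?T = "T(2 * a := (cells N S, -1))"
  have "2 * x + 1 \<noteq> 2 * a" for x by presburger
  then have odd: "?T (2 * x + 1) = T (2 * x + 1)" for x by (metis fun_upd_other)
  have even: "?T (2 * b) = (if b = a then (cells N S, -1) else T (2 * b))" for b by simp
  show ?thesis using assms unfolding rep_def even odd by auto
qed

lemma rep_array_in: "rep N V e Y h v A T \<Longrightarrow> a \<in> Y \<Longrightarrow> T (2 * a) = (cells N (A a), -1)"
  by (simp add: rep_def)

lemma rep_array: "rep N V e Y h v A T \<Longrightarrow> \<exists>S. T (2 * a) = (cells N S, -1)"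
  by (simp add: rep_def)

lemma rep_know:
  assumes "rep N V e Y h v A T" "T (2 * a) = (cells N S, -1)" "a \<notin> Y"
  shows "rep N V e (insert a Y) h v (A(a := S)) T"
  using assms unfolding rep_def by auto

lemma rep_forget: "rep N V e (insert a Y) h v (A(a := S)) T \<Longrightarrow> a \<notin> Y \<Longrightarrow> rep N V e Y h v A T"
  unfolding rep_def by auto

lemma runs_write_at:
  assumes rep: "rep N V e (insert a Y) h v (A(a := S)) T" "a \<notin> Y" and x: "3 \<le> x" "h x = int u" "u \<le> N"
    and S': "cells N S' = (cells N S)(int u := s)"
  shows "runs (write_at (2 * x + 1) (2 * a) s) T (18 * N + 23) (rep N V e (insert a Y) h v (A(a := S')))"
proof -
  let ?j = "2 * x + 1" and ?k = "2 * a"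
  have j: "T ?j = (cells N {}, int u)" using rep_var[OF rep(1), of x] x by simp
  have k: "T ?k = (cells N S, -1)" using rep_array_in[OF rep(1), of a] by simp
  have ne: "?j \<noteq> ?k" "?j \<noteq> 3" "?k \<noteq> 3" using x by (simp_all, presburger+)
  let ?T1 = "T(?k := (cells N S, int u))" and ?T2 = "T(?k := (cells N S', int u))"
  have 1: "runs (shift ?j ?k Move_Right) T (9 * N + 11) (\<lambda>T'. T' = ?T1)"
    by (rule runs_shift[where x = u]) (use j k ne x rep_temp[OF rep(1)] in auto)
  have 2: "runs (Wr ?k s) T' 1 (\<lambda>T'. T' = ?T2)" if "T' = ?T1" for T'
    by (rule runs_Wr) (simp add: that S')
  have 3: "runs (shift ?j ?k Move_Left) T' (9 * N + 11) (rep N V e (insert a Y) h v (A(a := S')))"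
    if "T' = ?T2" for T'
  proof (rule runs_shift[where x = u])
    have "rep N V e (insert a Y) h v ((A(a := S))(a := S')) (T(?k := (cells N S', -1)))"
      using rep_write[OF rep_forget[OF rep] rep(2), of S'] by simp
    then show "rep N V e (insert a Y) h v (A(a := S')) (T'(?k := (fst (T' ?k), snd (T' ?k) + offset Move_Left * (int u + 1))))"
      by (simp add: that)
  qed (use j k ne x rep_temp[OF rep(1)] that in auto)
  show ?thesis unfolding write_at_def by (rule runs_Seq[OF 1 runs_Seq[OF 2 3 le_refl]]) simp_all
qed

text \<open>The tape may still hold the result of an earlier evaluation of the same
  \<open>Close\<close>, so it is erased before the first sweep.\<close>

lemma runs_clear:
  assumes rep: "rep N V d Y h v A T" and "d \<le> x" "a \<notin> Y"
  shows "runs (scan (2 * x + 1) (write_at (2 * x + 1) (2 * a) 1)) T ((N + 1) * (18 * N + 29) + 4)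
    (rep N V d (insert a Y) h v (A(a := {})))"
proof -
  from rep have d: "3 \<le> d" "\<forall>y\<in>V. y < d" "h x = -1" using \<open>d \<le> x\<close> by (auto simp: rep_def)
  obtain S where S: "T (2 * a) = (cells N S, -1)" using rep_array[OF rep] by blast
  have "runs (scan (2 * x + 1) (write_at (2 * x + 1) (2 * a) 1)) T ((N + 1) * ((18 * N + 23) + 6) + 4)
      (rep N V (x + 2) (insert a Y) h v (A(a := S - {..<N + 1})))"
  proof (rule runs_scan[where d = d and g = "\<lambda>_. h" and A = "\<lambda>i. A(a := S - {..<i})"])
    fix i T assume i: "i \<le> N" "rep N V (x + 2) (insert a Y) (h(x := int i)) v (A(a := S - {..<i})) T"
    have "S - {..<Suc i} = (S - {..<i}) - {i}" by auto
    then show "runs (write_at (2 * x + 1) (2 * a) 1) T (18 * N + 23)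
        (rep N V (x + 2) (insert a Y) (h(x := int i)) v (A(a := S - {..<Suc i})))"
      by (intro runs_write_at[OF i(2)]) (use i d assms in \<open>auto simp: cells_remove\<close>)
  next
    show "rep N V (x + 2) (insert a Y) h v (A(a := S - {..<0})) T"
      using rep_deepen[OF rep_know[OF rep S assms(3)], of "x + 2"] \<open>d \<le> x\<close> by simp
  qed (use d \<open>d \<le> x\<close> in auto)
  then show ?thesis
  proof (rule runs_mono)
    fix T' assume T': "rep N V (x + 2) (insert a Y) h v (A(a := S - {..<N + 1})) T'"
    have "cells N (S - {..<N + 1}) = cells N {}" by (auto simp: cells_def fun_eq_iff)
    with rep_array_in[OF T', of a] have "T' (2 * a) = (cells N {}, -1)" by simp
    with rep_shallow[OF rep rep_forget[OF T' assms(3)]]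
    show "rep N V d (insert a Y) h v (A(a := {})) T'" using assms(3) by (rule rep_know)
  qed simp
qed

lemma runs_sweep:
  assumes \<phi>: "realizes (insert x V) (x + 2) (insert a Y) \<phi> p"
    and rep: "rep N V (x + 2) (insert a Y) h v (A(a := S)) T"
    and d: "d \<le> x" "3 \<le> d" "\<forall>y\<in>V. y < d" "a \<notin> Y" "h x = -1"
  shows "runs (scan (2 * x + 1) (compile \<phi> ;; IfEq 1 2 (write_at (2 * x + 1) (2 * a) 2) skip)) T
    ((N + 1) * (poly p N + 18 * N + 31) + 4)
    (rep N V (x + 2) (insert a Y) h v
      (A(a := sweep (N + 1) (\<lambda>u S. sem N \<phi> (v(x := u)) (A(a := S))) S)))"
proof -
  let ?P = "\<lambda>u S. sem N \<phi> (v(x := u)) (A(a := S))"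
  let ?w = "write_at (2 * x + 1) (2 * a) 2"
  have "runs (scan (2 * x + 1) (compile \<phi> ;; IfEq 1 2 ?w skip)) T ((N + 1) * ((poly p N + 18 * N + 25) + 6) + 4)
      (rep N V (x + 2) (insert a Y) h v (A(a := sweep (N + 1) ?P S)))"
  proof (rule runs_scan[where d = d and g = "\<lambda>_. h" and A = "\<lambda>i. A(a := sweep i ?P S)"])
    fix i T
    assume i: "i \<le> N" "rep N V (x + 2) (insert a Y) (h(x := int i)) v (A(a := sweep i ?P S)) T"
    let ?S = "sweep i ?P S" and ?R = "\<lambda>S. rep N V (x + 2) (insert a Y) (h(x := int i)) v (A(a := S))"
    have S': "sweep (Suc i) ?P S = (if ?P i ?S then insert i ?S else ?S)" by (simp add: sweep_def)
    have "rep N (insert x V) (x + 2) (insert a Y) (h(x := int i)) (v(x := i)) (A(a := ?S)) T"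
      by (rule rep_bind[where d = d]) (use i d in auto)
    from realizesD[OF \<phi> this]
    show "runs (compile \<phi> ;; IfEq 1 2 ?w skip) T (poly p N + 18 * N + 25) (?R (sweep (Suc i) ?P S))"
    proof (rule runs_Seq)
      fix T'
      assume T': "answers N (insert x V) (x + 2) (insert a Y) (h(x := int i)) (v(x := i)) (A(a := ?S)) (?P i ?S) T'"
      then have rep': "?R ?S T'" using rep_unbind[of N x V] d unfolding answers_def by blast
      have flag: "read_tape (T' 1) = 2 \<longleftrightarrow> ?P i ?S" using T' by (simp add: answers_def)
      show "runs (IfEq 1 2 ?w skip) T' (18 * N + 25) (?R (sweep (Suc i) ?P S))"
      proof (rule runs_IfEq)
        assume "read_tape (T' 1) = 2"
        then have "sweep (Suc i) ?P S = insert i ?S" using flag S' by simp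
        then show "runs ?w T' (18 * N + 23) (?R (sweep (Suc i) ?P S))"
          by (intro runs_write_at[OF rep']) (use i d in \<open>auto simp: cells_insert\<close>)
      next
        assume "read_tape (T' 1) \<noteq> 2"
        then have "sweep (Suc i) ?P S = ?S" using flag S' by simp
        then show "runs skip T' (18 * N + 23) (?R (sweep (Suc i) ?P S))"
          using rep' by (intro runs_skip) simp_all
      qed simp
    qed simp
  qed (use rep d in \<open>auto simp: sweep_def\<close>)
  then show ?thesis by (rule runs_mono) auto
qed

text \<open>The outer scan over the tape of \<open>x + 1\<close> only repeats the inner sweep; its
  \<open>N + 1\<close> rounds are the exponent in \<open>generated\<close>.\<close>

lemma realizes_Close:
  assumes \<phi>: "realizes (insert x V) (x + 2) (insert a Y) \<phi> p"
    and \<psi>: "realizes V d (insert a Y) \<psi> q" and "d \<le> x" "a \<notin> Y"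
  shows "realizes V d Y (Close a x \<phi> \<psi>)
    ([:1, 1:] * [:29, 18:] + 4 + ([:1, 1:] * ([:1, 1:] * (p + [:31, 18:]) + 10) + 4) + q)"
  unfolding realizes_def compile.simps
proof (intro allI impI)
  fix N h v A T
  assume rep: "rep N V d Y h v A T"
  then have d: "3 \<le> d" "\<forall>y\<in>V. y < d" "h x = -1" "h (x + 1) = -1"
    using \<open>d \<le> x\<close> by (auto simp: rep_def)
  let ?j = "2 * x + 1" and ?y = "2 * (x + 1) + 1"
  let ?f = "sweep (N + 1) (\<lambda>u S. sem N \<phi> (v(x := u)) (A(a := S)))"
  let ?c = "scan ?j (compile \<phi> ;; IfEq 1 2 (write_at ?j (2 * a) 2) skip)"
  let ?B = "(N + 1) * (poly p N + 18 * N + 31) + 4"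
  note clear = runs_clear[OF rep \<open>d \<le> x\<close> \<open>a \<notin> Y\<close>]
  have iterate: "runs (scan ?y ?c) T' ((N + 1) * (?B + 6) + 4) (rep N V d (insert a Y) h v (A(a := (?f ^^ (N + 1)) {})))"
    if T': "rep N V d (insert a Y) h v (A(a := {})) T'" for T'
  proof (rule runs_mono)
    show "runs (scan ?y ?c) T' ((N + 1) * (?B + 6) + 4) (rep N V (x + 2) (insert a Y) h v (A(a := (?f ^^ (N + 1)) {})))"
    proof (rule runs_scan[where d = d and g = "\<lambda>_. h" and A = "\<lambda>i. A(a := (?f ^^ i) {})"])
      fix i T
      assume "i \<le> N" "rep N V (x + 2) (insert a Y) (h(x + 1 := int i)) v (A(a := (?f ^^ i) {})) T"
      from runs_sweep[OF \<phi> this(2) \<open>d \<le> x\<close> d(1,2) \<open>a \<notin> Y\<close>] d(3)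
      show "runs ?c T ?B (rep N V (x + 2) (insert a Y) (h(x + 1 := int i)) v (A(a := (?f ^^ Suc i) {})))"
        by simp
    next
      show "rep N V (x + 2) (insert a Y) h v (A(a := (?f ^^ 0) {})) T'"
        using rep_deepen[OF T', of "x + 2"] \<open>d \<le> x\<close> by simp
    qed (use d \<open>d \<le> x\<close> in auto)
    fix T'' assume T'': "rep N V (x + 2) (insert a Y) h v (A(a := (?f ^^ (N + 1)) {})) T''"
    from rep_shallow[OF rep rep_forget[OF T'' \<open>a \<notin> Y\<close>]] rep_array_in[OF T'', of a] \<open>a \<notin> Y\<close>
    show "rep N V d (insert a Y) h v (A(a := (?f ^^ (N + 1)) {})) T''" by (intro rep_know) simp_all
  qed simp
  let ?Q = "answers N V d Y h v A (sem N (Close a x \<phi> \<psi>) v A)"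
  have last: "runs (compile \<psi>) T' (poly q N) ?Q"
    if "rep N V d (insert a Y) h v (A(a := (?f ^^ (N + 1)) {})) T'" for T'
  proof (rule runs_mono[OF realizesD[OF \<psi> that] le_refl])
    fix T'' assume "answers N V d (insert a Y) h v (A(a := (?f ^^ (N + 1)) {}))
      (sem N \<psi> v (A(a := (?f ^^ (N + 1)) {}))) T''"
    then show "?Q T''"
      using rep_forget[of N V d a Y h v A "(?f ^^ (N + 1)) {}" T''] \<open>a \<notin> Y\<close>
      unfolding answers_def sem.simps generated_def by blast
  qed
  show "runs (scan ?j (write_at ?j (2 * a) 1) ;; scan ?y ?c ;; compile \<psi>) T
    (poly ([:1, 1:] * [:29, 18:] + 4 + ([:1, 1:] * ([:1, 1:] * (p + [:31, 18:]) + 10) + 4) + q) N) ?Q"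
    by (rule runs_Seq[OF clear runs_Seq[OF iterate last le_refl]]) (simp_all add: algebra_simps)
qed

lemma ex_realizes: "scoped V d Y \<phi> \<Longrightarrow> \<exists>p. realizes V d Y \<phi> p"
proof (induction \<phi> arbitrary: V d Y)
  case (Mem a x)
  then show ?case using realizes_Mem[of a Y x V d] by auto
next
  case (Lin xs c ys)
  then show ?case using realizes_Lin[of xs V ys d Y c] by auto
next
  case (Neg \<phi>)
  then show ?case using realizes_Neg by (metis scoped.simps(3))
next
  case (Conj \<phi> \<psi>)
  then show ?case using realizes_Conj by (metis scoped.simps(4))
next
  case (Exist x \<phi>)
  then show ?case using realizes_Exist by (metis scoped.simps(5))
next
  case (Close a x \<phi> \<psi>)
  then show ?case using realizes_Close by (metis scoped.simps(6))
qed

section \<open>From the input word to the initial tapes\<close>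

definition each :: "(nat \<Rightarrow> com) \<Rightarrow> nat list \<Rightarrow> com" where
  "each f ks = foldr (\<lambda>k c. f k ;; c) ks skip"

lemma runs_each:
  assumes "distinct ks" "\<And>k T. k \<in> set ks \<Longrightarrow> T k = T0 k \<Longrightarrow> runs (f k) T B (\<lambda>T'. T' = T(k := g k))"
    "\<forall>k\<in>set ks. T k = T0 k" "(\<lambda>k. if k \<in> set ks then g k else T k) = T''"
  shows "runs (each f ks) T (length ks * B + 1) (\<lambda>T'. T' = T'')"
  using assms
proof (induction ks arbitrary: T)
  case Nil
  then show ?case unfolding each_def by (auto intro: runs_skip)
next
  case (Cons k ks)
  have "T k = T0 k" "k \<in> set (k # ks)" using Cons.prems(3) by auto
  note first = Cons.prems(2)[of k T, OF this(2,1)]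
  have rest: "runs (each f ks) T' (length ks * B + 1) (\<lambda>T'. T' = T'')" if "T' = T(k := g k)" for T'
  proof (rule Cons.IH)
    show "(\<lambda>l. if l \<in> set ks then g l else T' l) = T''"
      unfolding Cons.prems(4)[symmetric] that by (rule ext) auto
  qed (use Cons.prems(1-3) that in auto)
  show ?case unfolding each_def foldr.simps o_apply
    by (rule runs_Seq[OF first rest[unfolded each_def]]) (simp_all add: fun_eq_iff)
qed

text \<open>Blank work tapes become unary rulers while the input is read. The write of 1 on cell
  \<open>N\<close> then adds the end position to every tape; on tape 0 it makes the end of the word
  a nonmember. The input bits already use the symbols of a bit vector.\<close>

definition prepare :: "nat \<Rightarrow> com" where
  "prepare K = While 0 (each (\<lambda>k. if k = 0 then Mv 0 Move_Right else Wr k 1 ;; Mv k Move_Right) [0..<K]) ;;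
     each (\<lambda>k. Wr k 1) [0..<K] ;; each (\<lambda>k. While k (Mv k Move_Left)) [0..<K]"

lemma prepare_loop:
  fixes w :: "bool list" and K :: nat and T0 :: "nat \<Rightarrow> tape"
  defines "St \<equiv> \<lambda>i k. if k = 0 then (fst (input_tape w), int i)
      else if k < K then (\<lambda>z. if 0 \<le> z \<and> z < int i then 1 else 0, int i) else T0 k"
  assumes "n \<le> length w" "0 < K"
  shows "runs (While 0 (each (\<lambda>k. if k = 0 then Mv 0 Move_Right else Wr k 1 ;; Mv k Move_Right) [0..<K]))
    (St (length w - n)) (n * (K * 2 + 3) + 1) (\<lambda>T'. T' = St (length w))"
  using assms(2)
proof (induction n)
  case 0
  have "read_tape (St (length w) 0) = 0" by (simp add: St_def input_tape_def)
  from exec.WhileFalse[of "St (length w)" 0, OF this] show ?case unfolding diff_zero by (rule runsI) auto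
next
  case (Suc n)
  let ?i = "length w - Suc n"
  let ?f = "\<lambda>k. if k = 0 then Mv 0 Move_Right else Wr k 1 ;; Mv k Move_Right"
  have i: "Suc ?i = length w - n" using Suc.prems by simp
  have f: "runs (?f k) T 2 (\<lambda>T'. T' = T(k := St (Suc ?i) k))" if k: "k \<in> set [0..<K]" "T k = St ?i k" for k T
  proof (cases "k = 0")
    case True
    have "runs (Mv 0 Move_Right) T 2 (\<lambda>T'. T' = T(0 := St (Suc ?i) 0))"
      by (rule runsI[OF exec_Mv[OF refl]]) (use k True in \<open>simp_all add: St_def add.commute\<close>)
    then show ?thesis using True by simp
  next
    case False
    have "runs (Wr k 1 ;; Mv k Move_Right) T 2 (\<lambda>T'. T' = T(k := St (Suc ?i) k))"
      by (rule runsI[OF exec.Seq[OF exec_Wr[OF refl] exec_Mv[OF refl]]])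
        (use k False in \<open>auto simp: St_def fun_eq_iff\<close>)
    then show ?thesis using False by simp
  qed
  have body: "runs (each ?f [0..<K]) (St ?i) (length [0..<K] * 2 + 1) (\<lambda>T'. T' = St (Suc ?i))"
    by (rule runs_each[where ?T0.0 = "St ?i", OF _ f]) (use \<open>0 < K\<close> in \<open>auto simp: St_def fun_eq_iff\<close>)
  have nz: "read_tape (St ?i 0) \<noteq> 0"
    using Suc.prems by (simp add: St_def input_tape_def bit_symbol_def)
  have rest: "runs (While 0 (each ?f [0..<K])) T' (n * (K * 2 + 3) + 1) (\<lambda>T'. T' = St (length w))"
    if "T' = St (Suc ?i)" for T' using Suc that i by simp
  show ?case by (rule runs_While[OF nz body rest]) simp_all
qed

definition ones :: "bool list \<Rightarrow> nat set" where
  "ones w = {i. i < length w \<and> w ! i}"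

lemma runs_prepare:
  assumes "2 \<le> K"
  shows "\<exists>T. map T [0..<K] = input_tape w # replicate (K - 1) blank_tape \<and>
    runs (prepare K) T (length w * (K * 2 + 3) + K * (3 * length w + 4) + K + 4)
      (rep (length w) {} 3 {0} (\<lambda>_. -1) v (\<lambda>_. ones w))"
proof (intro exI conjI)
  let ?N = "length w"
  let ?X = "\<lambda>k :: nat. (cells ?N {}, -1 :: int)"
  let ?S = "\<lambda>k :: nat. if k = 0 then ones w else {}"
  \<comment> \<open>Tapes from \<open>K\<close> on do not belong to the machine and are taken as
    prepared from the start, because \<open>rep\<close> speaks of all tapes.\<close>
  define St where "St \<equiv> \<lambda>i k. if k = 0 then (fst (input_tape w), int i)
      else if k < K then (\<lambda>z. if 0 \<le> z \<and> z < int i then 1 else 0, int i) else ?X k"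
  define T2 where "T2 \<equiv> \<lambda>k. if k < K then (cells ?N (?S k), int ?N) else ?X k"
  define T3 where "T3 \<equiv> \<lambda>k. (cells ?N (?S k), -1 :: int)"
  show "map (St 0) [0..<K] = input_tape w # replicate (K - 1) blank_tape"
    using assms by (intro nth_equalityI) (auto simp: St_def input_tape_def blank_tape_def nth_Cons')
  have "runs (While 0 (each (\<lambda>k. if k = 0 then Mv 0 Move_Right else Wr k 1 ;; Mv k Move_Right) [0..<K]))
      (St (?N - ?N)) (?N * (K * 2 + 3) + 1) (\<lambda>T'. T' = St ?N)"
    unfolding St_def by (rule prepare_loop) (use assms in auto)
  note 1 = this[unfolded diff_self_eq_0]
  have 2: "runs (each (\<lambda>k. Wr k 1) [0..<K]) T (length [0..<K] * 1 + 1) (\<lambda>T'. T' = T2)" if "T = St ?N" for T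
  proof (rule runs_each[where ?T0.0 = "St ?N"])
    show "runs (Wr k 1) T 1 (\<lambda>T'. T' = T(k := T2 k))" if "k \<in> set [0..<K]" "T k = St ?N k" for k T
      by (rule runs_Wr) (use that in \<open>auto simp: St_def T2_def input_tape_def bit_symbol_def cells_def ones_def fun_eq_iff\<close>)
  qed (use that assms in \<open>auto simp: St_def T2_def fun_eq_iff\<close>)
  have 3: "runs (each (\<lambda>k. While k (Mv k Move_Left)) [0..<K]) T (length [0..<K] * (3 * ?N + 4) + 1) (\<lambda>T'. T' = T3)"
    if "T = T2" for T
  proof (rule runs_each[where ?T0.0 = T2])
    show "runs (While k (Mv k Move_Left)) T (3 * ?N + 4) (\<lambda>T'. T' = T(k := T3 k))"
      if "k \<in> set [0..<K]" "T k = T2 k" for k T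
      by (rule runs_rewind[where S = "?S k" and n = "?N + 1"]) (use that in \<open>auto simp: T2_def T3_def\<close>)
  qed (use that assms in \<open>auto simp: T2_def T3_def fun_eq_iff\<close>)
  have "runs (prepare K) (St 0) (?N * (K * 2 + 3) + K * (3 * ?N + 4) + K + 4) (\<lambda>T'. T' = T3)"
    unfolding prepare_def by (rule runs_Seq[OF 1 runs_Seq[OF 2 3 le_refl]]) simp_all
  then show "runs (prepare K) (St 0) (?N * (K * 2 + 3) + K * (3 * ?N + 4) + K + 4)
      (rep ?N {} 3 {0} (\<lambda>_. -1) v (\<lambda>_. ones w))"
    by (rule runs_mono) (auto simp: T3_def rep_def)
qed

fun tape_bound :: "com \<Rightarrow> nat" where
  "tape_bound (Mv k m) = Suc k"
| "tape_bound (Wr k s) = Suc k"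
| "tape_bound (c ;; c') = max (tape_bound c) (tape_bound c')"
| "tape_bound (IfEq k s c c') = max (Suc k) (max (tape_bound c) (tape_bound c'))"
| "tape_bound (While k c) = max (Suc k) (tape_bound c)"

fun writes_symbols :: "com \<Rightarrow> bool" where
  "writes_symbols (Mv k m) \<longleftrightarrow> True"
| "writes_symbols (Wr k s) \<longleftrightarrow> s < 3"
| "writes_symbols (c ;; c') \<longleftrightarrow> writes_symbols c \<and> writes_symbols c'"
| "writes_symbols (IfEq k s c c') \<longleftrightarrow> writes_symbols c \<and> writes_symbols c'"
| "writes_symbols (While k c) \<longleftrightarrow> writes_symbols c"

lemma well_formed_tape_bound: "writes_symbols c \<Longrightarrow> well_formed (tape_bound c) c"
  by (induction c) (auto elim: well_formed_mono)

lemma writes_symbols_compile: "writes_symbols (compile \<phi>)"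
proof -
  have "writes_symbols (shift_sum xs m)" for xs m
    by (induction xs) (auto simp: shift_sum_def shift_def)
  moreover have "writes_symbols (repeat_mv n m)" for n m
    by (induction n) (auto simp: repeat_mv_def)
  ultimately show ?thesis
    by (induction \<phi>) (auto simp: scan_def shift_def write_at_def test_zero_def)
qed

lemma well_formed_prepare: "0 < K \<Longrightarrow> well_formed K (prepare K)"
proof -
  have "well_formed K (each f ks)" if "0 < K" "\<forall>k\<in>set ks. well_formed K (f k)" for f ks
    using that by (induction ks) (auto simp: each_def)
  then show "0 < K \<Longrightarrow> well_formed K (prepare K)" unfolding prepare_def well_formed.simps by simp
qed

text \<open>After this it remains to express the language by one formula, whose only free set is the
  word under the name 0. Variables start at 3 because the tapes of 0, 1 and 2 are the answer tape
  and the two scratch tapes.\<close>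

theorem PTIME_sem:
  assumes "scoped {} 3 {0} \<phi>"
    and "\<And>w. w \<in> L \<longleftrightarrow> sem (length w) \<phi> (\<lambda>_. 0) (\<lambda>_. ones w)"
  shows "L \<in> PTIME"
proof -
  obtain p where p: "realizes {} 3 {0} \<phi> p" using ex_realizes[OF assms(1)] by blast
  define K where "K = max (tape_bound (compile \<phi>)) 2"
  have K: "2 \<le> K" "well_formed K (prepare K ;; compile \<phi>)"
    using well_formed_mono[OF well_formed_tape_bound[OF writes_symbols_compile[of \<phi>]], of K]
      well_formed_prepare[of K] by (simp_all add: K_def)
  let ?p = "[:0, K * 2 + 3:] + [:K:] * [:4, 3:] + [:K + 4:] + p"
  show ?thesis
  proof (rule PTIME_I[OF K(2,1), where p = ?p])
    fix w
    obtain T where T: "map T [0..<K] = input_tape w # replicate (K - 1) blank_tape"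
      "runs (prepare K) T (length w * (K * 2 + 3) + K * (3 * length w + 4) + K + 4)
        (rep (length w) {} 3 {0} (\<lambda>_. -1) (\<lambda>_. 0) (\<lambda>_. ones w))"
      using runs_prepare[OF K(1), of w "\<lambda>_. 0"] by (elim exE conjE) (rule that)
    have "runs (compile \<phi>) T' (poly p (length w)) (\<lambda>T'. read_tape (T' 1) = 2 \<longleftrightarrow> w \<in> L)"
      if "rep (length w) {} 3 {0} (\<lambda>_. -1) (\<lambda>_. 0) (\<lambda>_. ones w) T'" for T'
      by (rule runs_mono[OF realizesD[OF p that] le_refl]) (simp add: answers_def assms(2))
    then have "runs (prepare K ;; compile \<phi>) T (poly ?p (length w)) (\<lambda>T'. read_tape (T' 1) = 2 \<longleftrightarrow> w \<in> L)"
      by (rule runs_Seq[OF T(2)]) (simp_all add: algebra_simps)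
    with T(1) show "\<exists>T t T'. map T [0..<K] = input_tape w # replicate (K - 1) blank_tape \<and>
      exec (prepare K ;; compile \<phi>) T t T' \<and> t \<le> poly ?p (length w) \<and> (read_tape (T' 1) = 2 \<longleftrightarrow> w \<in> L)"
      unfolding runs_def by (elim exE conjE) (intro exI conjI)
  qed
qed

section \<open>Repeated sweeps compute least fixpoints\<close>

lemma sweep_Suc: "sweep (Suc n) P S = (if P n (sweep n P S) then insert n (sweep n P S) else sweep n P S)"
  by (simp add: sweep_def)

lemma sweep_0: "sweep 0 P S = S"
  by (simp add: sweep_def)

lemma sweep_increasing: "S \<subseteq> sweep n P S"
  by (induction n) (auto simp: sweep_Suc sweep_0)

lemma sweep_bounded: "sweep n P S \<subseteq> S \<union> {..<n}"
  by (induction n) (auto simp: sweep_Suc sweep_0)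

text \<open>A set of positions cannot grow more than \<open>N + 1\<close> times, so one of the
  stages 0 to \<open>N + 1\<close> is fixed by a sweep, and all later stages agree with it.\<close>

lemma generated_closed:
  assumes mono: "\<And>u S S'. P u S \<Longrightarrow> S \<subseteq> S' \<Longrightarrow> P u S'" and "u \<le> N" "P u (generated N P)"
  shows "u \<in> generated N P"
proof -
  let ?f = "sweep (N + 1) P"
  define C where "C i = (?f ^^ i) {}" for i
  have C: "C i \<subseteq> {..N}" for i
  proof (induction i)
    case (Suc i)
    then show ?case using sweep_bounded[of "N + 1" P "C i"] by (fastforce simp: C_def)
  qed (simp add: C_def)
  have inc: "C i \<subseteq> C (Suc i)" for i using sweep_increasing by (simp add: C_def)
  have "\<exists>i\<le>N + 1. ?f (C i) = C i"
  proof (rule ccontr)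
    assume *: "\<not> (\<exists>i\<le>N + 1. ?f (C i) = C i)"
    have "i \<le> card (C i)" if "i \<le> N + 2" for i using that
    proof (induction i)
      case (Suc i)
      then have "C i \<subset> C (Suc i)" using * inc[of i] by (auto simp: C_def)
      then have "card (C i) < card (C (Suc i))"
        using C finite_subset[OF C] by (intro psubset_card_mono) auto
      then show ?case using Suc by simp
    qed simp
    then have "N + 2 \<le> card (C (N + 2))" by blast
    also have "\<dots> \<le> card {..N}" using C by (intro card_mono) auto
    finally show False by simp
  qed
  then obtain i where i: "i \<le> N + 1" "?f (C i) = C i" by blast
  have "C (i + j) = C i" for j using i(2) by (induction j) (auto simp: C_def)
  from this[of "N + 1 - i"] i have fixed: "?f (generated N P) = generated N P"
    by (simp add: generated_def C_def)
  let ?G = "generated N P"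
  \<comment> \<open>A whole sweep without effect has no effect in any prefix, because sweeping only
    adds elements.\<close>
  have "sweep n P ?G \<subseteq> ?G" if "n \<le> N + 1" for n
  proof -
    have "sweep n P ?G \<subseteq> sweep (n + j) P ?G" for j
      by (induction j) (auto simp: sweep_Suc)
    from this[of "N + 1 - n"] that show ?thesis using fixed by simp
  qed
  then have "sweep u P ?G = ?G" "sweep (Suc u) P ?G = ?G"
    using sweep_increasing[of ?G] assms(2) by (simp_all add: subset_antisym)
  then show "u \<in> ?G" using assms(3) by (metis insertCI sweep_Suc)
qed

lemma generated_least:
  assumes "\<And>u S. u \<le> N \<Longrightarrow> S \<subseteq> X \<Longrightarrow> P u S \<Longrightarrow> u \<in> X"
  shows "generated N P \<subseteq> X"
proof -
  have sweep: "sweep n P S \<subseteq> X" if "n \<le> N + 1" "S \<subseteq> X" for n S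
    using that by (induction n) (auto simp: sweep_Suc sweep_0 assms)
  have "(sweep (N + 1) P ^^ i) {} \<subseteq> X" for i
    by (induction i) (auto simp del: One_nat_def intro: sweep[THEN subsetD])
  then show ?thesis unfolding generated_def .
qed

text \<open>For monotone \<open>P\<close> the outcome of the sweeps is the least set closed under
  \<open>P\<close>; this is how \<open>cl\<close> and \<open>line_hull\<close> are recognized
  later.\<close>

lemma generated_unfold:
  assumes mono: "\<And>u S S'. P u S \<Longrightarrow> S \<subseteq> S' \<Longrightarrow> P u S'"
    and closed: "\<And>u. u \<le> N \<Longrightarrow> P u X \<Longrightarrow> u \<in> X"
    and least: "\<And>Y. (\<And>u. u \<le> N \<Longrightarrow> P u Y \<Longrightarrow> u \<in> Y) \<Longrightarrow> X \<subseteq> Y"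
  shows "generated N P = X"
  using generated_closed[of P _ N] generated_least[of N X P] mono closed least
  by (meson subset_antisym)

lemma generated_const: "generated N (\<lambda>u S. Q u) = {u. u \<le> N \<and> Q u}"
  by (rule generated_unfold) auto

section \<open>Local conditions for modularity\<close>

locale implication_system =
  fixes E :: "'a set" and \<Sigma> :: "'a implication set"
  assumes finite_E: "finite E" and implications: "implications_on E \<Sigma>"
begin

text \<open>Improper implications impose nothing here, since the empty conclusion lies in every set.
  The closed sets thus form a closure system with top \<open>E\<close>, and the exclusions are left
  to \<open>cons\<close>.\<close>

definition closed :: "'a set \<Rightarrow> bool" where
  "closed X \<longleftrightarrow> X \<subseteq> E \<and> (\<forall>A B. (A, B) \<in> \<Sigma> \<longrightarrow> A \<subseteq> X \<longrightarrow> B \<subseteq> X)"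

definition cl :: "'a set \<Rightarrow> 'a set" where
  "cl S = \<Inter> {X. closed X \<and> S \<subseteq> X}"

definition cons :: "'a set \<Rightarrow> bool" where
  "cons X \<longleftrightarrow> (\<forall>A. (A, {}) \<in> \<Sigma> \<longrightarrow> \<not> A \<subseteq> X)"

lemma family_iff: "X \<in> implication_family E \<Sigma> \<longleftrightarrow> closed X \<and> cons X"
  unfolding implication_family_def closed_def cons_def by blast

lemma closed_E: "closed E"
  using implications by (auto simp: closed_def implications_on_def)

lemma closed_subset: "closed X \<Longrightarrow> X \<subseteq> E"
  by (simp add: closed_def)

lemma closed_Int: "closed X \<Longrightarrow> closed Y \<Longrightarrow> closed (X \<inter> Y)"
  unfolding closed_def by blast

lemma closed_Inter: "\<X> \<noteq> {} \<Longrightarrow> (\<And>X. X \<in> \<X> \<Longrightarrow> closed X) \<Longrightarrow> closed (\<Inter> \<X>)"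
  unfolding closed_def by blast

lemma closed_cl: "S \<subseteq> E \<Longrightarrow> closed (cl S)"
  unfolding cl_def using closed_E by (intro closed_Inter) auto

lemma cl_least: "closed X \<Longrightarrow> S \<subseteq> X \<Longrightarrow> cl S \<subseteq> X"
  by (auto simp: cl_def)

lemma subset_cl: "S \<subseteq> cl S"
  by (auto simp: cl_def)

lemma in_cl: "x \<in> S \<Longrightarrow> x \<in> cl S"
  using subset_cl by auto

lemma cl_mono: "S \<subseteq> S' \<Longrightarrow> cl S \<subseteq> cl S'"
  by (auto simp: cl_def)

lemma cl_closed: "closed X \<Longrightarrow> cl X = X"
  using cl_least subset_cl by blast

lemma cl_subset_E: "S \<subseteq> E \<Longrightarrow> cl S \<subseteq> E"
  by (simp add: cl_least closed_E)

lemma cl_subset_cl: "S \<subseteq> cl S' \<Longrightarrow> S' \<subseteq> E \<Longrightarrow> cl S \<subseteq> cl S'"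
  by (simp add: cl_least closed_cl)

lemma cl_Un_cl:
  assumes "S \<subseteq> E" "T \<subseteq> E"
  shows "cl (S \<union> cl T) = cl (S \<union> T)"
proof
  have "cl T \<subseteq> cl (S \<union> T)" by (rule cl_mono) simp
  then show "cl (S \<union> cl T) \<subseteq> cl (S \<union> T)"
    using assms subset_cl[of "S \<union> T"] by (intro cl_subset_cl) simp_all
  show "cl (S \<union> T) \<subseteq> cl (S \<union> cl T)"
    using subset_cl[of T] by (intro cl_mono) blast
qed

lemma cl_Un_cl_cl:
  assumes "S \<subseteq> E" "T \<subseteq> E"
  shows "cl (cl S \<union> cl T) = cl (S \<union> T)"
  using cl_Un_cl[OF cl_subset_E[OF assms(1)] assms(2)] cl_Un_cl[OF assms(2,1)] by (simp add: Un_commute)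

lemma cons_mono: "cons X \<Longrightarrow> Y \<subseteq> X \<Longrightarrow> cons Y"
  unfolding cons_def by blast

text \<open>These points generate the consistent join-irreducible closed sets: the members of
  \<open>cl {p}\<close> that generate something smaller do not recover \<open>p\<close>. Different
  points may generate the same closed set, and then \<open>J\<close> contains all of them or
  none.\<close>

definition J :: "'a set" where
  "J = {p \<in> E. cons (cl {p}) \<and> p \<notin> cl {f \<in> cl {p}. p \<notin> cl {f}}}"

lemma J_E: "p \<in> J \<Longrightarrow> p \<in> E" by (simp add: J_def)

lemma J_cons: "p \<in> J \<Longrightarrow> cons (cl {p})" by (simp add: J_def)

text \<open>The unique lower cover of the join-irreducible closed set \<open>cl {p}\<close>.\<close>

definition cover :: "'a \<Rightarrow> 'a set" where
  "cover p = cl {f \<in> cl {p}. p \<notin> cl {f}}"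

lemma closed_cover: "p \<in> E \<Longrightarrow> closed (cover p)"
  unfolding cover_def using cl_subset_E[of "{p}"] by (intro closed_cl) auto

lemma cover_subset: "p \<in> E \<Longrightarrow> cover p \<subseteq> cl {p}"
  unfolding cover_def by (intro cl_least closed_cl) auto

lemma J_not_in_cover: "p \<in> J \<Longrightarrow> p \<notin> cover p"
  by (simp add: J_def cover_def)

lemma subset_cover: "closed X \<Longrightarrow> X \<subseteq> cl {p} \<Longrightarrow> p \<notin> X \<Longrightarrow> X \<subseteq> cover p"
proof
  fix f assume "closed X" "X \<subseteq> cl {p}" "p \<notin> X" "f \<in> X"
  moreover from this have "cl {f} \<subseteq> X" by (simp add: cl_least)
  ultimately have "f \<in> {f \<in> cl {p}. p \<notin> cl {f}}" by blast
  then show "f \<in> cover p" unfolding cover_def by (rule in_cl)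
qed

text \<open>If \<open>p\<close> were in \<open>cl {}\<close>, every closure would contain it, and
  the set of points in the definition of \<open>J\<close> would be empty.\<close>

lemma J_not_in_cl_empty: "p \<in> J \<Longrightarrow> p \<notin> cl {}"
proof
  assume "p \<in> J" "p \<in> cl {}"
  then have "{f \<in> cl {p}. p \<notin> cl {f}} = {}" using cl_mono[of "{}"] by blast
  with \<open>p \<in> J\<close> \<open>p \<in> cl {}\<close> show False by (simp add: J_def)
qed

text \<open>Induction on the size of \<open>cl {e}\<close>: a point outside \<open>J\<close> is
  generated by points of strictly smaller closure. Consistency of \<open>X\<close> excludes the
  other reason for being outside \<open>J\<close>.\<close>

lemma cl_J:
  assumes "closed X" "cons X"
  shows "cl (X \<inter> J) = X"
proof
  show "cl (X \<inter> J) \<subseteq> X" by (rule cl_least[OF assms(1)]) simp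
  have "e \<in> X \<Longrightarrow> e \<in> cl (X \<inter> J)" for e
  proof (induction "card (cl {e})" arbitrary: e rule: less_induct)
    case less
    have eE: "e \<in> E" "cl {e} \<subseteq> X" using less.prems assms(1) by (auto simp: closed_def cl_least)
    have XE: "X \<inter> J \<subseteq> E" using assms(1) by (auto simp: closed_def)
    show ?case
    proof (cases "e \<in> J")
      case True
      then show ?thesis using less.prems by (auto intro: in_cl)
    next
      case False
      then have e: "e \<in> cl {f \<in> cl {e}. e \<notin> cl {f}}"
        using eE cons_mono[OF assms(2) eE(2)] by (auto simp: J_def)
      have "{f \<in> cl {e}. e \<notin> cl {f}} \<subseteq> cl (X \<inter> J)"
      proof
        fix f assume f: "f \<in> {f \<in> cl {e}. e \<notin> cl {f}}"
        then have "cl {f} \<subset> cl {e}"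
          using cl_subset_cl[of "{f}" "{e}"] in_cl[of e "{e}"] eE by auto
        moreover have "finite (cl {e})" using finite_E cl_subset_E[of "{e}"] eE finite_subset by blast
        ultimately have "card (cl {f}) < card (cl {e})" by (simp add: psubset_card_mono)
        then show "f \<in> cl (X \<inter> J)" using less.hyps f eE by blast
      qed
      from cl_subset_cl[OF this XE] e show ?thesis by blast
    qed
  qed
  then show "X \<subseteq> cl (X \<inter> J)" by blast
qed

text \<open>The two defining properties of a modular semilattice, expressed by the closure operator:
  the join of closed sets is the closure of their union, and it exists in the family if and only
  if that closure is consistent.\<close>

definition modular_law :: bool where
  "modular_law \<longleftrightarrow> (\<forall>A B C. closed A \<and> closed B \<and> closed C \<and> cons (cl (A \<union> B \<union> C)) \<and> A \<subseteq> C \<longrightarrow>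
     cl (A \<union> B) \<inter> C \<subseteq> cl (A \<union> (B \<inter> C)))"

definition triple_law :: bool where
  "triple_law \<longleftrightarrow> (\<forall>X Y Z. closed X \<and> closed Y \<and> closed Z \<and> cons (cl (X \<union> Y)) \<and>
     cons (cl (Y \<union> Z)) \<and> cons (cl (Z \<union> X)) \<longrightarrow> cons (cl (X \<union> Y \<union> Z)))"

lemma modular_lawD:
  assumes modular_law "closed Z" "cons Z" "A \<subseteq> C" "closed A" "closed B" "closed C" "B \<subseteq> Z" "C \<subseteq> Z"
  shows "cl (A \<union> B) \<inter> C \<subseteq> cl (A \<union> (B \<inter> C))"
proof -
  have "cl (A \<union> B \<union> C) \<subseteq> Z" using assms by (intro cl_least) auto
  then have "cons (cl (A \<union> B \<union> C))" using assms(3) by (rule cons_mono[rotated])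
  then show ?thesis using assms unfolding modular_law_def by simp
qed

text \<open>\<open>cl {q, r}\<close> plays the part of the line through two points, and line-closed
  sets are the subspaces. The case \<open>q = r\<close> takes in the points of \<open>J\<close>
  below \<open>q\<close>.\<close>

definition line_closed :: "'a set \<Rightarrow> bool" where
  "line_closed S \<longleftrightarrow> (\<forall>q\<in>S. \<forall>r\<in>S. J \<inter> cl {q, r} \<subseteq> S)"

definition line_hull :: "'a set \<Rightarrow> 'a set" where
  "line_hull G = \<Inter> {S. line_closed S \<and> G \<subseteq> S}"

text \<open>A relative of the Veblen-Young axiom. Four generators suffice, since its purpose is to
  show that the points on lines between two closed sets form a line-closed set, and two such points
  come from two lines.\<close>

definition projectivity :: bool where
  "projectivity \<longleftrightarrow> (\<forall>p\<in>J. \<forall>q1\<in>J. \<forall>q2\<in>J. \<forall>r1\<in>J. \<forall>r2\<in>J.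
     cons (cl {q1, q2, r1, r2}) \<and> p \<in> cl {q1, q2, r1, r2} \<longrightarrow>
     (\<exists>q\<in>J \<inter> cl {q1, q2}. \<exists>r\<in>J \<inter> cl {r1, r2}. p \<in> cl {q, r}))"

text \<open>This is the modular law for \<open>cl {r}\<close> below \<open>cl {p, r}\<close> with
  \<open>cl {q}\<close> as the third element, read at the point \<open>p\<close>.\<close>

definition exchange :: bool where
  "exchange \<longleftrightarrow> (\<forall>p\<in>J. \<forall>q\<in>J. \<forall>r\<in>J. cons (cl {q, r}) \<and> p \<in> cl {q, r} \<longrightarrow>
     p \<in> cl (cl {q} \<inter> cl {p, r} \<union> {r}))"

text \<open>The name recalls flag complexes. Together with \<open>generation\<close>, passing from
  pairs to triples is enough to reach arbitrary sets of points.\<close>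

definition flag :: bool where
  "flag \<longleftrightarrow> (\<forall>p\<in>J. \<forall>q\<in>J. \<forall>r\<in>J. cons (cl {p, q}) \<and> cons (cl {q, r}) \<and> cons (cl {p, r}) \<longrightarrow>
     cons (cl {p, q, r}))"

definition seed :: "'a set \<Rightarrow> 'a set" where
  "seed A = {j \<in> J. \<exists>a\<in>A. j \<in> cl {a}}"

text \<open>A line-closed pairwise consistent set that covers the premise must cover a nonempty
  conclusion. The line hull of the seed is the smallest candidate, so it is the only one to check.
  For an improper implication the condition says that the assumption fails.\<close>

definition generation :: bool where
  "generation \<longleftrightarrow> (\<forall>(A, B) \<in> \<Sigma>. (\<forall>a\<in>A. cons (cl {a})) \<and>
     (\<forall>p\<in>line_hull (seed A). \<forall>q\<in>line_hull (seed A). cons (cl {p, q})) \<longrightarrow>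
     B \<noteq> {} \<and> (\<forall>b\<in>B. cons (cl {b}) \<and> J \<inter> cl {b} \<subseteq> line_hull (seed A)))"

text \<open>If \<open>cl {}\<close> is inconsistent, the family is empty and both laws hold
  vacuously.\<close>

definition local_conditions :: bool where
  "local_conditions \<longleftrightarrow> cons (cl {}) \<longrightarrow> projectivity \<and> exchange \<and> flag \<and> generation"

section \<open>From the two laws to the local conditions\<close>

lemma line_closed_J: "line_closed J"
  by (simp add: line_closed_def)

lemma line_hull_closed: "line_closed (line_hull G)"
  unfolding line_hull_def line_closed_def by blast

lemma line_hull_least: "line_closed S \<Longrightarrow> G \<subseteq> S \<Longrightarrow> line_hull G \<subseteq> S"
  by (auto simp: line_hull_def)

lemma subset_line_hull: "G \<subseteq> line_hull G"
  by (auto simp: line_hull_def)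

lemma line_hull_J: "G \<subseteq> J \<Longrightarrow> line_hull G \<subseteq> J"
  by (rule line_hull_least[OF line_closed_J])

text \<open>A minimal closed \<open>X\<close> below \<open>A\<close> whose join with
  \<open>B\<close> is above \<open>p\<close> must be join-irreducible. In a modular lattice the
  interval from \<open>cl {p} \<inter> B\<close> to \<open>cl {p}\<close> is transposed to the one
  from \<open>B\<close> to the join of both, so the unique lower cover of \<open>cl {p}\<close>
  provides a largest proper element of the upper interval.\<close>

lemma join_irreducible_part:
  assumes M: modular_law and p: "p \<in> J" "p \<in> cl (A \<union> B)" "p \<notin> B"
    and AB: "closed A" "closed B" "cons (cl (A \<union> B))"
  shows "\<exists>q\<in>J \<inter> A. p \<in> cl (cl {q} \<union> B)"
proof -
  let ?P = "\<lambda>X. closed X \<and> X \<subseteq> A \<and> p \<in> cl (X \<union> B)"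
  have E: "A \<subseteq> E" "B \<subseteq> E" "p \<in> E" using AB p by (auto simp: closed_def J_E)
  have "finite {X. ?P X}" by (rule finite_subset[of _ "Pow E"]) (use finite_E E in auto)
  moreover have "A \<in> {X. ?P X}" using AB p by auto
  ultimately obtain X where X: "?P X" and min: "\<And>Y. ?P Y \<Longrightarrow> Y \<subseteq> X \<Longrightarrow> Y = X"
    using finite_has_minimal[of "{X. ?P X}"] by (metis (no_types, lifting) empty_iff mem_Collect_eq)
  have cons: "cons Y" if "Y \<subseteq> cl (A \<union> B)" for Y using cons_mono[OF AB(3) that] .
  have XB: "cl (X \<union> B) \<subseteq> cl (A \<union> B)" using X by (intro cl_mono) auto
  let ?P1 = "cl {p}"
  have XE: "X \<subseteq> E" using X E by blast
  have P1: "closed ?P1" "?P1 \<subseteq> cl (X \<union> B)"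
    using E X XE by (simp_all add: closed_cl cl_subset_cl)
  have BX: "B \<subseteq> cl (X \<union> B)" "X \<subseteq> cl (X \<union> B)" using subset_cl by blast+
  define C where "C = cl (?P1 \<union> B)"
  have C: "closed C" "B \<subseteq> C" "?P1 \<subseteq> C" "C \<subseteq> cl (X \<union> B)"
    unfolding C_def using P1 E BX XE subset_cl[of "?P1 \<union> B"] cl_subset_E[of "{p}"]
    by (simp_all add: closed_cl cl_subset_cl)
  have Z: "closed (cl (A \<union> B))" using E by (simp add: closed_cl)
  have AZ: "A \<subseteq> cl (A \<union> B)" "B \<subseteq> cl (A \<union> B)" using subset_cl[of "A \<union> B"] by blast+
  note law = modular_lawD[OF M Z AB(3)]
  \<comment> \<open>By the modular law \<open>p\<close> lies below the join of \<open>B\<close> and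
    \<open>X \<inter> C\<close>, so minimality forces \<open>X \<inter> C = X\<close>.\<close>
  have "X \<subseteq> C"
  proof -
    have "cl (B \<union> X) \<inter> C \<subseteq> cl (B \<union> (X \<inter> C))"
      by (rule law) (use X AB C XB AZ in auto)
    moreover have "p \<in> C" using C in_cl[of p "{p}"] by blast
    ultimately have "p \<in> cl ((X \<inter> C) \<union> B)" using X by (auto simp: Un_commute)
    then have "X \<inter> C = X" using X C by (intro min) (auto intro: closed_Int)
    then show ?thesis by blast
  qed
  \<comment> \<open>Two smaller parts would both lie below the join of \<open>cover p\<close> and
    \<open>B\<close>, hence so would \<open>X\<close> and with it \<open>p\<close>. The modular law
    then puts \<open>p\<close> into \<open>cover p\<close>.\<close>
  have irred: "cl (A1 \<union> A2) \<noteq> X" if A12: "closed A1" "closed A2" "A1 \<subset> X" "A2 \<subset> X" for A1 A2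
  proof
    assume X12: "cl (A1 \<union> A2) = X"
    have not: "p \<notin> cl (D \<union> B)" if "closed D" "D \<subset> X" for D
      using min[of D] that X by blast
    have part: "cl (D \<union> B) \<subseteq> cl (cover p \<union> B)" if D: "closed D" "D \<subset> X" for D
    proof -
      let ?U = "cl (D \<union> B)"
      have DE: "D \<union> B \<subseteq> E" using D E XE by blast
      have "D \<union> B \<subseteq> C" using D \<open>X \<subseteq> C\<close> C by blast
      then have U: "closed ?U" "?U \<subseteq> C" "B \<subseteq> ?U"
        using DE C(1) subset_cl[of "D \<union> B"] by (simp_all add: closed_cl cl_least)
      have "cl (B \<union> ?P1) \<inter> ?U \<subseteq> cl (B \<union> (?P1 \<inter> ?U))"
        by (rule law) (use U AB C P1 XB in auto)
      then have "?U \<subseteq> cl (B \<union> (?P1 \<inter> ?U))" using U(2) unfolding C_def by (auto simp: Un_commute)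
      also have "\<dots> \<subseteq> cl (cover p \<union> B)"
        using subset_cover[of "?P1 \<inter> ?U" p] not[OF D] closed_Int[OF P1(1) U(1)] by (intro cl_mono) blast
      finally show ?thesis .
    qed
    have coverE: "cover p \<subseteq> E" "closed (cover p)" "cover p \<subseteq> ?P1"
      using closed_cover[OF E(3)] cover_subset[OF E(3)] by (auto simp: closed_def)
    let ?V = "cl (cover p \<union> B)"
    have V: "closed ?V" using coverE E by (simp add: closed_cl)
    have V': "B \<subseteq> ?V" "A1 \<subseteq> ?V" "A2 \<subseteq> ?V"
      using part[OF A12(1,3)] part[OF A12(2,4)] subset_cl[of "A1 \<union> B"] subset_cl[of "A2 \<union> B"]
        subset_cl[of "cover p \<union> B"] by blast+
    then have "X \<subseteq> ?V" using X12 cl_least[OF V, of "A1 \<union> A2"] by simp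
    then have "p \<in> ?V" using X V' cl_least[OF V, of "X \<union> B"] by blast
    moreover have "cl (cover p \<union> B) \<inter> ?P1 \<subseteq> cl (cover p \<union> (B \<inter> ?P1))"
      by (rule law) (use coverE AB P1 XB AZ in auto)
    moreover have "B \<inter> ?P1 \<subseteq> cover p"
      by (rule subset_cover) (use AB P1 p in \<open>auto intro: closed_Int\<close>)
    ultimately have "p \<in> cl (cover p)" using in_cl[of p "{p}"] by (auto simp: Un_absorb2)
    then show False using J_not_in_cover[OF p(1)] cl_closed[OF coverE(2)] by simp
  qed
  \<comment> \<open>From two parts to finitely many. The empty join is excluded because
    \<open>X = cl {}\<close> would lie in \<open>B\<close>, which misses \<open>p\<close>.\<close>
  have join: "cl (\<Union>\<Y>) \<noteq> X" if "finite \<Y>" "\<forall>Y\<in>\<Y>. closed Y \<and> Y \<subset> X" for \<Y>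
    using that
  proof (induction rule: finite_induct)
    case empty
    show ?case
    proof
      assume "cl (\<Union>{}) = X"
      then have "X \<subseteq> B" using cl_least[OF AB(2)] by auto
      then have "X \<union> B = B" by blast
      then show False using X p(3) cl_closed[OF AB(2)] by simp
    qed
  next
    case (insert Y \<Y>)
    have sub: "\<Union>\<Y> \<subseteq> X" "Y \<subseteq> X" using insert.prems by auto
    have "cl (\<Union>\<Y>) \<subset> X" using insert cl_least[of X "\<Union>\<Y>"] X sub by blast
    moreover have "closed (cl (\<Union>\<Y>))" using sub XE by (intro closed_cl) auto
    ultimately have "cl (Y \<union> cl (\<Union>\<Y>)) \<noteq> X" using insert.prems by (intro irred) auto
    moreover have "cl (Y \<union> cl (\<Union>\<Y>)) = cl (\<Union>(insert Y \<Y>))"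
      using cl_Un_cl[of Y "\<Union>\<Y>"] sub XE by auto
    ultimately show ?case by simp
  qed
  have "finite {Y. closed Y \<and> Y \<subset> X}"
    by (rule finite_subset[of _ "Pow E"]) (use finite_E XE in auto)
  then have "cl (\<Union>{Y. closed Y \<and> Y \<subset> X}) \<noteq> X" by (rule join) simp
  moreover have D: "cl (\<Union>{Y. closed Y \<and> Y \<subset> X}) \<subseteq> X" using X by (intro cl_least) auto
  \<comment> \<open>A point of \<open>X\<close> outside the join of all smaller closed sets
    generates \<open>X\<close>.\<close>
  ultimately obtain q where q: "q \<in> X" "q \<notin> cl (\<Union>{Y. closed Y \<and> Y \<subset> X})" by blast
  have clq: "cl {q} \<subseteq> X" "closed (cl {q})" 
    using X q XE cl_least[of X "{q}"] closed_cl[of "{q}"] by blast+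
  have eq: "cl {q} = X"
  proof (rule ccontr)
    assume "cl {q} \<noteq> X"
    then have "q \<in> \<Union>{Y. closed Y \<and> Y \<subset> X}" using clq in_cl[of q "{q}"] by blast
    from in_cl[OF this] show False using q by simp
  qed
  have "{f \<in> cl {q}. q \<notin> cl {f}} \<subseteq> \<Union>{Y. closed Y \<and> Y \<subset> X}"
  proof
    fix f assume f: "f \<in> {f \<in> cl {q}. q \<notin> cl {f}}"
    then have "closed (cl {f})" "cl {f} \<subset> X" "f \<in> cl {f}"
      using XE X q clq cl_least[of X "{f}"] closed_cl[of "{f}"] in_cl[of f "{f}"] by blast+
    then show "f \<in> \<Union>{Y. closed Y \<and> Y \<subset> X}" by blast
  qed
  from cl_mono[OF this] have "q \<notin> cl {f \<in> cl {q}. q \<notin> cl {f}}" using q by blast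
  moreover have "cons (cl {q})" using clq BX XB by (intro cons) blast
  moreover have "q \<in> E" using q XE by blast
  ultimately have "q \<in> J" unfolding J_def by blast
  then show ?thesis using X q eq by auto
qed

text \<open>The previous lemma is applied twice: it replaces \<open>A\<close> by a point
  \<open>q\<close>, and then \<open>B\<close> by a point \<open>r\<close>, with
  \<open>cl {q}\<close> in the place of the other side.\<close>

lemma projection:
  assumes M: modular_law and p: "p \<in> J" "p \<in> cl (A \<union> B)" "p \<notin> A" "p \<notin> B"
    and AB: "closed A" "closed B" "cons (cl (A \<union> B))"
  shows "\<exists>q\<in>J \<inter> A. \<exists>r\<in>J \<inter> B. p \<in> cl {q, r}"
proof -
  obtain q where q: "q \<in> J" "q \<in> A" "p \<in> cl (cl {q} \<union> B)"
    using join_irreducible_part[OF M p(1,2,4) AB] by auto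
  have qE: "{q} \<subseteq> E" using q J_E by auto
  have clq: "closed (cl {q})" "cl {q} \<subseteq> A" 
    using closed_cl[OF qE] cl_least[OF AB(1), of "{q}"] q by simp_all
  have "cl (B \<union> cl {q}) \<subseteq> cl (A \<union> B)" using clq(2) by (intro cl_mono) blast
  then have "\<exists>r\<in>J \<inter> B. p \<in> cl (cl {r} \<union> cl {q})"
    using q clq p(3) AB cons_mono[OF AB(3)]
    by (intro join_irreducible_part[OF M p(1)]) (auto simp: Un_commute)
  then obtain r where r: "r \<in> J" "r \<in> B" "p \<in> cl (cl {r} \<union> cl {q})" by blast
  have "cl (cl {r} \<union> cl {q}) = cl {q, r}"
    using cl_Un_cl_cl[of "{r}" "{q}"] q r J_E by (simp add: insert_commute)
  with r(3) have "p \<in> cl {q, r}" by simp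
  then show ?thesis using q r by blast
qed

text \<open>The points of \<open>G\<close> are joined to \<open>X\<close> one at a time. The triple
  law for \<open>X\<close>, \<open>cl {g}\<close> and \<open>cl {h}\<close> keeps the hypothesis
  true for each remaining \<open>h\<close> once \<open>g\<close> has been added.\<close>

lemma cons_cl_flag:
  assumes T: triple_law
    and "finite G" "closed X" "cons X" "G \<subseteq> E"
    and "\<And>g. g \<in> G \<Longrightarrow> cons (cl (X \<union> {g}))" "\<And>g h. g \<in> G \<Longrightarrow> h \<in> G \<Longrightarrow> cons (cl {g, h})"
  shows "cons (cl (X \<union> G))"
  using assms(2-)
proof (induction arbitrary: X rule: finite_induct)
  case empty
  then show ?case using cl_closed by simp
next
  case (insert g G)
  let ?X = "cl (X \<union> {g})"
  have E: "X \<subseteq> E" "g \<in> E" "G \<subseteq> E" using insert.prems by (auto simp: closed_def)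
  have "cons (cl (?X \<union> G))"
  proof (rule insert.IH)
    fix h assume h: "h \<in> G"
    then have hE: "h \<in> E" using E by blast
    have "cons (cl (X \<union> cl {g} \<union> cl {h}))"
    proof (rule T[unfolded triple_law_def, rule_format], intro conjI)
      show "cons (cl (X \<union> cl {g}))" using insert.prems(4)[of g] cl_Un_cl[of X "{g}"] E by simp
      show "cons (cl (cl {g} \<union> cl {h}))"
        using insert.prems(5)[of g h] cl_Un_cl_cl[of "{g}" "{h}"] E hE h by (simp add: insert_commute)
      show "cons (cl (cl {h} \<union> X))"
        using insert.prems(4)[of h] cl_Un_cl[of X "{h}"] E hE h by (simp add: Un_commute)
    qed (use insert.prems(1) E hE in \<open>simp_all add: closed_cl\<close>)
    moreover have "cl (?X \<union> {h}) \<subseteq> cl (X \<union> cl {g} \<union> cl {h})"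
    proof (rule cl_subset_cl)
      have "?X \<subseteq> cl (X \<union> cl {g} \<union> cl {h})" using subset_cl[of "{g}"] by (intro cl_mono) blast
      moreover have "h \<in> cl (X \<union> cl {g} \<union> cl {h})" using in_cl[of h "{h}"] by (intro in_cl) simp
      ultimately show "?X \<union> {h} \<subseteq> cl (X \<union> cl {g} \<union> cl {h})" by simp
      show "X \<union> cl {g} \<union> cl {h} \<subseteq> E" using E hE cl_subset_E[of "{g}"] cl_subset_E[of "{h}"] by simp
    qed
    ultimately show "cons (cl (?X \<union> {h}))" by (rule cons_mono)
  next
    show "cons ?X" using insert.prems(4)[of g] by simp
    show "closed ?X" using E by (simp add: closed_cl)
    show "G \<subseteq> E" by (rule E)
    show "cons (cl {a, b})" if "a \<in> G" "b \<in> G" for a b using insert.prems(5) that by simp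
  qed
  moreover have "cl (X \<union> insert g G) \<subseteq> cl (?X \<union> G)"
    using subset_cl[of "X \<union> {g}"] by (intro cl_mono) blast
  ultimately show ?case by (rule cons_mono)
qed

text \<open>Induction on a finite generating set: a point below the join of \<open>cl {g}\<close>
  and \<open>cl G\<close>, but below neither, lies on a line between points of the two, and both of
  these are already in \<open>S\<close>.\<close>

lemma line_closed_cl:
  assumes M: modular_law and S: "line_closed S" "S \<subseteq> J" "cons (cl S)"
  shows "J \<inter> cl S \<subseteq> S"
proof -
  have SE: "S \<subseteq> E" using S(2) J_E by auto
  have "J \<inter> cl G \<subseteq> S" if "finite G" "G \<subseteq> S" for G
    using that
  proof (induction rule: finite_induct)
    case empty
    then show ?case using J_not_in_cl_empty by auto
  next
    case (insert g G)
    show ?case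
    proof
      fix p assume p: "p \<in> J \<inter> cl (insert g G)"
      have E: "g \<in> E" "G \<subseteq> E" using insert.prems SE by auto
      have cl: "closed (cl {g})" "closed (cl G)" using E by (auto intro: closed_cl)
      have eq: "cl (cl {g} \<union> cl G) = cl (insert g G)" using cl_Un_cl_cl[of "{g}" G] E by simp
      then have cons: "cons (cl (cl {g} \<union> cl G))"
        using cons_mono[OF S(3) cl_mono[OF insert.prems]] by simp
      have p': "p \<in> cl (cl {g} \<union> cl G)" using p eq by simp
      have sub: "J \<inter> cl {g} \<subseteq> S"
        using S(1) insert.prems unfolding line_closed_def by (metis insert_absorb2 insert_subset)
      show "p \<in> S"
      proof (cases "p \<in> cl {g} \<or> p \<in> cl G")
        case True
        then show ?thesis using p sub insert.IH insert.prems by blast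
      next
        case False
        then obtain q r where "q \<in> J \<inter> cl {g}" "r \<in> J \<inter> cl G" "p \<in> cl {q, r}"
          using projection[OF M _ p' _ _ cl cons] p by blast
        moreover have "q \<in> S" "r \<in> S" using calculation sub insert.IH insert.prems by blast+
        ultimately show ?thesis using S(1) p unfolding line_closed_def by blast
      qed
    qed
  qed
  from this[of S] show ?thesis using finite_subset[OF SE finite_E] by blast
qed

lemma local_conditions_if_modular:
  assumes M: modular_law and T: triple_law and empty: "cons (cl {})"
  shows "projectivity \<and> exchange \<and> flag \<and> generation"
proof (intro conjI)
  show projectivity
    unfolding projectivity_def
  proof (intro ballI impI)
    fix p q1 q2 r1 r2
    assume J: "p \<in> J" "q1 \<in> J" "q2 \<in> J" "r1 \<in> J" "r2 \<in> J"
      and p: "cons (cl {q1, q2, r1, r2}) \<and> p \<in> cl {q1, q2, r1, r2}"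
    let ?A = "cl {q1, q2}" and ?B = "cl {r1, r2}"
    have E: "{q1, q2} \<subseteq> E" "{r1, r2} \<subseteq> E" using J J_E by simp_all
    have eq: "cl (?A \<union> ?B) = cl {q1, q2, r1, r2}" using cl_Un_cl_cl[OF E] by (simp add: insert_commute)
    show "\<exists>q\<in>J \<inter> ?A. \<exists>r\<in>J \<inter> ?B. p \<in> cl {q, r}"
    proof (cases "p \<in> ?A \<or> p \<in> ?B")
      case True
      then show ?thesis
      proof
        assume "p \<in> ?A"
        then show ?thesis using J in_cl[of r1 "{r1, r2}"] in_cl[of p "{p, r1}"] by blast
      next
        assume "p \<in> ?B"
        then show ?thesis using J in_cl[of q1 "{q1, q2}"] in_cl[of p "{q1, p}"] by blast
      qed
    next
      case False
      then show ?thesis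
        using projection[OF M J(1), of ?A ?B] p closed_cl[OF E(1)] closed_cl[OF E(2)] eq by simp
    qed
  qed
  show exchange
    unfolding exchange_def
  proof (intro ballI impI)
    fix p q r assume J: "p \<in> J" "q \<in> J" "r \<in> J" and p: "cons (cl {q, r}) \<and> p \<in> cl {q, r}"
    have E: "p \<in> E" "q \<in> E" "r \<in> E" using J J_E by auto
    have sub: "cl {r} \<subseteq> cl {p, r}" "cl {q} \<subseteq> cl {q, r}" "cl {p, r} \<subseteq> cl {q, r}" "cl {r} \<subseteq> cl {q, r}"
      using E p by (simp_all add: cl_subset_cl in_cl)
    have "cl (cl {r} \<union> cl {q}) \<inter> cl {p, r} \<subseteq> cl (cl {r} \<union> (cl {q} \<inter> cl {p, r}))"
      by (rule modular_lawD[OF M, of "cl {q, r}"]) (use E sub p in \<open>simp_all add: closed_cl\<close>)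
    moreover have "cl (cl {r} \<union> cl {q}) = cl {q, r}"
      using cl_Un_cl_cl[of "{r}" "{q}"] E by (simp add: insert_commute)
    ultimately have "p \<in> cl (cl {r} \<union> (cl {q} \<inter> cl {p, r}))" using p in_cl[of p "{p, r}"] by auto
    moreover have "cl (cl {q} \<inter> cl {p, r} \<union> cl {r}) = cl (cl {q} \<inter> cl {p, r} \<union> {r})"
      by (rule cl_Un_cl) (use E cl_subset_E[of "{q}"] in auto)
    ultimately show "p \<in> cl (cl {q} \<inter> cl {p, r} \<union> {r})" by (simp add: Un_commute)
  qed
  \<comment> \<open>The joining starts at \<open>cl {}\<close>, the least closed set; its
    consistency is the guard in \<open>local_conditions\<close>.\<close>
  have J_pairs: "cons (cl (G :: 'a set))" if "G \<subseteq> E" "\<And>g h. g \<in> G \<Longrightarrow> h \<in> G \<Longrightarrow> cons (cl {g, h})" for G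
  proof -
    have "cons (cl (cl {} \<union> G))"
    proof (rule cons_cl_flag[OF T])
      fix g assume g: "g \<in> G"
      have "cl (cl {} \<union> {g}) = cl {g, g}"
        using g that(1) cl_Un_cl[of "{g}" "{}"] by (auto simp: Un_commute)
      then show "cons (cl (cl {} \<union> {g}))" using that(2)[OF g g] by simp
    next
      show "finite G" using that(1) finite_E by (rule finite_subset)
    qed (use that empty in \<open>simp_all add: closed_cl\<close>)
    moreover have "cl G \<subseteq> cl (cl {} \<union> G)" by (rule cl_mono) simp
    ultimately show ?thesis by (rule cons_mono)
  qed
  show flag
    unfolding flag_def
  proof (intro ballI impI)
    fix p q r assume J: "p \<in> J" "q \<in> J" "r \<in> J"
      and c: "cons (cl {p, q}) \<and> cons (cl {q, r}) \<and> cons (cl {p, r})"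
    show "cons (cl {p, q, r})"
      by (rule J_pairs) (use J J_E J_cons c in \<open>auto simp: insert_commute\<close>)
  qed
  show generation
    unfolding generation_def
  proof (intro ballI, clarify)
    fix A B assume AB: "(A, B) \<in> \<Sigma>" and A: "\<forall>a\<in>A. cons (cl {a})"
      and pairs: "\<forall>p\<in>line_hull (seed A). \<forall>q\<in>line_hull (seed A). cons (cl {p, q})"
    let ?S = "line_hull (seed A)"
    have SJ: "?S \<subseteq> J" by (rule line_hull_J) (auto simp: seed_def)
    then have SE: "?S \<subseteq> E" using J_E by auto
    have E: "A \<subseteq> E" "B \<subseteq> E" using AB implications by (auto simp: implications_on_def)
    have cons: "cons (cl ?S)" by (rule J_pairs[OF SE]) (use pairs in blast)
    \<comment> \<open>Each consistent \<open>cl {a}\<close> is generated by its points in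
      \<open>J\<close>, and these belong to the seed.\<close>
    have "A \<subseteq> cl ?S"
    proof
      fix a assume a: "a \<in> A"
      then have "cl (cl {a} \<inter> J) = cl {a}" using A E by (intro cl_J closed_cl) blast+
      moreover have "cl {a} \<inter> J \<subseteq> ?S" using a subset_line_hull[of "seed A"] by (auto simp: seed_def)
      ultimately show "a \<in> cl ?S" using cl_mono[of "cl {a} \<inter> J" ?S] in_cl[of a "{a}"] by blast
    qed
    \<comment> \<open>As a member of the family, \<open>cl ?S\<close> respects the implication.
      \<open>line_closed_cl\<close> then brings the points below the conclusion back into
      \<open>?S\<close>.\<close>
    then have "B \<noteq> {}" "B \<subseteq> cl ?S"
      using AB cons closed_cl[OF SE] unfolding cons_def closed_def by blast+
    moreover have "cons (cl {b}) \<and> J \<inter> cl {b} \<subseteq> ?S" if b: "b \<in> B" for b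
    proof -
      have "cl {b} \<subseteq> cl ?S" using b \<open>B \<subseteq> cl ?S\<close> SE by (intro cl_subset_cl) auto
      then show ?thesis
        using cons_mono[OF cons] line_closed_cl[OF M line_hull_closed SJ cons] by blast
    qed
    ultimately show "B \<noteq> {} \<and> (\<forall>b\<in>B. cons (cl {b}) \<and> J \<inter> cl {b} \<subseteq> ?S)" by blast
  qed
qed


section \<open>From the local conditions to the two laws\<close>

lemma family_of_line_closed:
  assumes generation "line_closed S" "S \<subseteq> J" "\<forall>p\<in>S. \<forall>q\<in>S. cons (cl {p, q})"
  defines "X \<equiv> {e \<in> E. cons (cl {e}) \<and> J \<inter> cl {e} \<subseteq> S}"
  shows "closed X" "cons X" "J \<inter> X = S"
proof -
  \<comment> \<open>A premise inside \<open>X\<close> has its seed, and therefore its line hull,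
    inside \<open>S\<close>. Then \<open>generation\<close> gives closedness of \<open>X\<close>
    and, by forbidding empty conclusions, also its consistency.\<close>
  have gen: "B \<noteq> {} \<and> B \<subseteq> X" if AB: "(A, B) \<in> \<Sigma>" "A \<subseteq> X" for A B
  proof -
    have "seed A \<subseteq> S" using AB(2) by (auto simp: seed_def X_def)
    then have hull: "line_hull (seed A) \<subseteq> S" by (rule line_hull_least[OF assms(2)])
    have "B \<noteq> {} \<and> (\<forall>b\<in>B. cons (cl {b}) \<and> J \<inter> cl {b} \<subseteq> line_hull (seed A))"
    proof -
      have "\<forall>a\<in>A. cons (cl {a})" using AB(2) by (auto simp: X_def)
      moreover have "\<forall>p\<in>line_hull (seed A). \<forall>q\<in>line_hull (seed A). cons (cl {p, q})"
        using hull assms(4) by blast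
      ultimately show ?thesis using assms(1) AB(1) unfolding generation_def by blast
    qed
    moreover have "B \<subseteq> E" using AB(1) implications by (auto simp: implications_on_def)
    ultimately show ?thesis using hull unfolding X_def by blast
  qed
  show "closed X" using gen unfolding closed_def X_def by blast
  show "cons X" using gen unfolding cons_def by blast
  show "J \<inter> X = S"
  proof
    show "J \<inter> X \<subseteq> S" using in_cl by (auto simp: X_def)
    show "S \<subseteq> J \<inter> X"
    proof
      fix s assume s: "s \<in> S"
      then have "J \<inter> cl {s} \<subseteq> S" using assms(2) unfolding line_closed_def by (metis insert_absorb2)
      then show "s \<in> J \<inter> X" using s assms(3) J_E J_cons by (auto simp: X_def)
    qed
  qed
qed

text \<open>The line hull might use lines of inconsistent pairs, so \<open>R\<close> asks only for
  lines of consistent pairs. That all pairs of the result are consistent is shown in two rounds,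
  first against a point of \<open>G\<close>, then against all points; only then is the result known
  to be line-closed.\<close>

lemma flag_line_hull:
  assumes flag "G \<subseteq> J" and pairs: "\<And>p q. p \<in> G \<Longrightarrow> q \<in> G \<Longrightarrow> cons (cl {p, q})"
  shows "\<exists>S. line_closed S \<and> G \<subseteq> S \<and> S \<subseteq> J \<and> (\<forall>p\<in>S. \<forall>q\<in>S. cons (cl {p, q}))"
proof -
  define R where "R X \<longleftrightarrow> G \<subseteq> X \<and> (\<forall>q\<in>X. \<forall>r\<in>X. cons (cl {q, r}) \<longrightarrow> J \<inter> cl {q, r} \<subseteq> X)" for X
  define S where "S = \<Inter> {X. R X}"
  have RS: "R S" unfolding R_def S_def by blast
  have least: "S \<subseteq> X" if "R X" for X using that by (auto simp: S_def)
  have SJ: "S \<subseteq> J" by (rule least) (use assms(2) in \<open>auto simp: R_def\<close>)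
  have third: "cons (cl {p, s})" if "p \<in> J" "q \<in> S" "r \<in> S" "s \<in> S" "p \<in> cl {q, r}"
    "cons (cl {q, r})" "cons (cl {q, s})" "cons (cl {r, s})" for p q r s
  proof -
    have "cons (cl {q, r, s})" using assms(1) that SJ unfolding flag_def by blast
    moreover have "cl {p, s} \<subseteq> cl {q, r, s}"
    proof (rule cl_subset_cl)
      have "p \<in> cl {q, r, s}" using that(5) cl_mono[of "{q, r}" "{q, r, s}"] by blast
      then show "{p, s} \<subseteq> cl {q, r, s}" using in_cl[of s "{q, r, s}"] by simp
      show "{q, r, s} \<subseteq> E" using that SJ J_E by blast
    qed
    ultimately show ?thesis by (rule cons_mono)
  qed
  have sub: "J \<inter> cl {q, r} \<subseteq> S" if "q \<in> S" "r \<in> S" "cons (cl {q, r})" for q r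
    using RS that unfolding R_def by blast
  have GS: "G \<subseteq> S" using RS by (simp add: R_def)
  have inner: "cons (cl {s, g})" if g: "g \<in> G" and "s \<in> S" for g s
  proof -
    have "R {s \<in> S. cons (cl {s, g})}"
      unfolding R_def
    proof (intro conjI ballI impI subsetI)
      show "x \<in> {s \<in> S. cons (cl {s, g})}" if "x \<in> G" for x using that GS pairs g by blast
      show "p \<in> {s \<in> S. cons (cl {s, g})}" if "q \<in> {s \<in> S. cons (cl {s, g})}"
        "r \<in> {s \<in> S. cons (cl {s, g})}" "cons (cl {q, r})" "p \<in> J \<inter> cl {q, r}" for q r p
        using third[of p q r g] sub[of q r] GS g that by blast
    qed
    from least[OF this] that(2) show ?thesis by blast
  qed
  have "R {s \<in> S. \<forall>s'\<in>S. cons (cl {s, s'})}"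
    unfolding R_def
  proof (intro conjI ballI impI subsetI)
    show "x \<in> {s \<in> S. \<forall>s'\<in>S. cons (cl {s, s'})}" if "x \<in> G" for x
      using that GS inner[OF that] by (auto simp: insert_commute)
    show "p \<in> {s \<in> S. \<forall>s'\<in>S. cons (cl {s, s'})}" if "q \<in> {s \<in> S. \<forall>s'\<in>S. cons (cl {s, s'})}"
      "r \<in> {s \<in> S. \<forall>s'\<in>S. cons (cl {s, s'})}" "cons (cl {q, r})" "p \<in> J \<inter> cl {q, r}" for q r p
      using third[of p q r] sub[of q r] that by blast
  qed
  from least[OF this] have all: "\<forall>p\<in>S. \<forall>q\<in>S. cons (cl {p, q})" by blast
  then have "line_closed S" using sub unfolding line_closed_def by blast
  then show ?thesis using GS SJ all by blast
qed

lemma cons_cl_if_pairs: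
  assumes flag generation "G \<subseteq> J" and pairs: "\<And>p q. p \<in> G \<Longrightarrow> q \<in> G \<Longrightarrow> cons (cl {p, q})"
  shows "cons (cl G)"
proof -
  obtain S where S: "line_closed S" "G \<subseteq> S" "S \<subseteq> J" "\<forall>p\<in>S. \<forall>q\<in>S. cons (cl {p, q})"
    using flag_line_hull[OF assms(1,3) pairs] by blast
  note X = family_of_line_closed[OF assms(2) S(1,3,4)]
  have "cl G \<subseteq> {e \<in> E. cons (cl {e}) \<and> J \<inter> cl {e} \<subseteq> S}"
    using X(3) S(2) by (intro cl_least[OF X(1)]) blast
  with X(2) show ?thesis by (rule cons_mono)
qed

text \<open>By \<open>projectivity\<close> the points on lines between \<open>A\<close> and
  \<open>B\<close> form a line-closed set. The closed set built from it contains \<open>A\<close>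
  and \<open>B\<close>, hence their join, so the join has no other points.\<close>

lemma projection_if_local:
  assumes projectivity generation
    and AB: "closed A" "closed B" "cons (cl (A \<union> B))" and ne: "A \<inter> J \<noteq> {}" "B \<inter> J \<noteq> {}"
    and p: "p \<in> J" "p \<in> cl (A \<union> B)"
  shows "\<exists>q\<in>A \<inter> J. \<exists>r\<in>B \<inter> J. p \<in> cl {q, r}"
proof -
  have E: "A \<union> B \<subseteq> E" using AB by (auto simp: closed_def)
  have below: "cl {q, r} \<subseteq> cl (A \<union> B)" if "q \<in> cl (A \<union> B)" "r \<in> cl (A \<union> B)" for q r
    using that by (intro cl_subset_cl E) simp
  define S where "S = {p \<in> J. \<exists>q\<in>A \<inter> J. \<exists>r\<in>B \<inter> J. p \<in> cl {q, r}}"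
  have Scl: "S \<subseteq> cl (A \<union> B)"
  proof
    fix s assume "s \<in> S"
    then obtain q r where "q \<in> A" "r \<in> B" "s \<in> cl {q, r}" by (auto simp: S_def)
    then show "s \<in> cl (A \<union> B)" using below[of q r] in_cl[of q "A \<union> B"] in_cl[of r "A \<union> B"] by auto
  qed
  have "line_closed S"
    unfolding line_closed_def
  proof (intro ballI subsetI)
    fix p1 p2 p assume *: "p1 \<in> S" "p2 \<in> S" "p \<in> J \<inter> cl {p1, p2}"
    obtain q1 r1 where 1: "q1 \<in> A \<inter> J" "r1 \<in> B \<inter> J" "p1 \<in> cl {q1, r1}" using *(1) by (auto simp: S_def)
    obtain q2 r2 where 2: "q2 \<in> A \<inter> J" "r2 \<in> B \<inter> J" "p2 \<in> cl {q2, r2}" using *(2) by (auto simp: S_def)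
    have "{q1, q2, r1, r2} \<subseteq> E" using 1 2 J_E by blast
    moreover have "cl {q1, r1} \<subseteq> cl {q1, q2, r1, r2}" "cl {q2, r2} \<subseteq> cl {q1, q2, r1, r2}"
      by (intro cl_mono; simp)+
    ultimately have "cl {p1, p2} \<subseteq> cl {q1, q2, r1, r2}" using 1 2 by (intro cl_subset_cl) blast+
    then have "p \<in> cl {q1, q2, r1, r2}" using *(3) by blast
    moreover have "cl {q1, q2, r1, r2} \<subseteq> cl (A \<union> B)" using 1 2 by (intro cl_mono) blast
    then have "cons (cl {q1, q2, r1, r2})" by (rule cons_mono[OF AB(3)])
    ultimately obtain q r where "q \<in> J \<inter> cl {q1, q2}" "r \<in> J \<inter> cl {r1, r2}" "p \<in> cl {q, r}"
      using assms(1) 1 2 *(3) unfolding projectivity_def by blast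
    moreover have "cl {q1, q2} \<subseteq> A" "cl {r1, r2} \<subseteq> B"
      using 1 2 cl_least[OF AB(1), of "{q1, q2}"] cl_least[OF AB(2), of "{r1, r2}"] by blast+
    ultimately show "p \<in> S" using *(3) unfolding S_def by blast
  qed
  moreover have "S \<subseteq> J" by (auto simp: S_def)
  moreover have "\<forall>p\<in>S. \<forall>q\<in>S. cons (cl {p, q})"
    using cons_mono[OF AB(3) below] Scl by blast
  ultimately have S: "line_closed S" "S \<subseteq> J" "\<forall>p\<in>S. \<forall>q\<in>S. cons (cl {p, q})" .
  let ?X = "{e \<in> E. cons (cl {e}) \<and> J \<inter> cl {e} \<subseteq> S}"
  note X = family_of_line_closed(1,3)[OF assms(2) S]
  \<comment> \<open>A point of \<open>A\<close> lies on the line to any point of \<open>B\<close>;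
    this is where both sides must contain points.\<close>
  have AS: "A \<inter> J \<subseteq> S"
  proof
    fix a assume a: "a \<in> A \<inter> J"
    obtain b where "b \<in> B \<inter> J" using ne(2) by blast
    then show "a \<in> S" using a in_cl[of a "{a, b}"] unfolding S_def by blast
  qed
  have BS: "B \<inter> J \<subseteq> S"
  proof
    fix b assume b: "b \<in> B \<inter> J"
    obtain a where "a \<in> A \<inter> J" using ne(1) by blast
    then show "b \<in> S" using b in_cl[of b "{a, b}"] unfolding S_def by blast
  qed
  have "A \<subseteq> cl (A \<union> B)" "B \<subseteq> cl (A \<union> B)" using subset_cl[of "A \<union> B"] by blast+
  then have "cons A" "cons B" using cons_mono[OF AB(3)] by blast+
  moreover have "S \<subseteq> ?X" using X(2) by blast
  then have "cl (A \<inter> J) \<subseteq> ?X" "cl (B \<inter> J) \<subseteq> ?X"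
    using AS BS cl_least[OF X(1), of "A \<inter> J"] cl_least[OF X(1), of "B \<inter> J"] by blast+
  ultimately have "A \<subseteq> ?X" "B \<subseteq> ?X" using cl_J[OF AB(1)] cl_J[OF AB(2)] by simp_all
  then have "cl (A \<union> B) \<subseteq> ?X" by (intro cl_least[OF X(1)]) blast
  then have "p \<in> S" using p X(2) by blast
  then show ?thesis unfolding S_def by blast
qed

lemma modular_if_local_conditions:
  assumes projectivity exchange generation
  shows modular_law
  unfolding modular_law_def
proof (intro allI impI, elim conjE)
  fix A B C
  assume closed: "closed A" "closed B" "closed C" and cons: "cons (cl (A \<union> B \<union> C))" and "A \<subseteq> C"
  let ?X = "cl (A \<union> B) \<inter> C" and ?Y = "cl (A \<union> (B \<inter> C))"
  have E: "A \<subseteq> E" "B \<subseteq> E" "C \<subseteq> E" using closed by (simp_all add: closed_def)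
  have AB: "cons (cl (A \<union> B))" by (rule cons_mono[OF cons]) (intro cl_mono, blast)
  have X: "closed ?X" "cons ?X" using E closed cons_mono[OF AB] by (simp_all add: closed_Int closed_cl)
  have Y: "closed ?Y" using E by (intro closed_cl) blast
  \<comment> \<open>Points suffice, because the consistent closed set \<open>?X\<close> is generated
    by its points in \<open>J\<close>.\<close>
  have "?X \<inter> J \<subseteq> ?Y"
  proof
    fix p assume p: "p \<in> ?X \<inter> J"
    have AY: "A \<subseteq> ?Y" "B \<inter> C \<subseteq> ?Y" using subset_cl[of "A \<union> (B \<inter> C)"] by blast+
    have consAB: "cons A" "cons B" using cons_mono[OF AB] subset_cl[of "A \<union> B"] by simp_all
    show "p \<in> ?Y"
    proof (cases "A \<inter> J = {} \<or> B \<inter> J = {}")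
      case True
      \<comment> \<open>A side without points is \<open>cl {}\<close>, so the join is the other
        side.\<close>
      then have "cl (A \<union> B) = B \<or> cl (A \<union> B) = A"
      proof
        assume "A \<inter> J = {}"
        then have "A = cl {}" using cl_J[OF closed(1) consAB(1)] by simp
        then have "A \<subseteq> B" using cl_least[OF closed(2)] by simp
        then show ?thesis using cl_closed[OF closed(2)] by (simp add: Un_absorb1)
      next
        assume "B \<inter> J = {}"
        then have "B = cl {}" using cl_J[OF closed(2) consAB(2)] by simp
        then have "B \<subseteq> A" using cl_least[OF closed(1)] by simp
        then show ?thesis using cl_closed[OF closed(1)] by (simp add: Un_absorb2)
      qed
      then show ?thesis using p AY by blast
    next
      case False
      then obtain q r where qr: "r \<in> A \<inter> J" "q \<in> B \<inter> J" "p \<in> cl {r, q}"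
        using projection_if_local[OF assms(1,3) closed(1,2) AB, of p] p by blast
      have "cl {q, r} \<subseteq> cl (A \<union> B)" using qr by (intro cl_mono) blast
      then have "cons (cl {q, r})" by (rule cons_mono[OF AB])
      then have "p \<in> cl (cl {q} \<inter> cl {p, r} \<union> {r})"
        using assms(2) qr p unfolding exchange_def by (simp add: insert_commute)
      moreover have "cl {q} \<subseteq> B" "cl {p, r} \<subseteq> C"
        using qr p \<open>A \<subseteq> C\<close> cl_least[OF closed(2), of "{q}"] cl_least[OF closed(3), of "{p, r}"] by blast+
      then have "cl (cl {q} \<inter> cl {p, r} \<union> {r}) \<subseteq> ?Y"
        using qr(1) AY by (intro cl_least[OF Y]) blast
      ultimately show ?thesis by blast
    qed
  qed
  then have "cl (?X \<inter> J) \<subseteq> ?Y" by (rule cl_least[OF Y])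
  then show "?X \<subseteq> ?Y" using cl_J[OF X] by simp
qed

text \<open>Two points from three sets come from at most two of them, so the hypotheses make all
  points pairwise consistent.\<close>

lemma triple_if_local_conditions:
  assumes flag generation
  shows triple_law
  unfolding triple_law_def
proof (intro allI impI, elim conjE)
  fix X Y Z
  assume closed: "closed X" "closed Y" "closed Z"
    and cons: "cons (cl (X \<union> Y))" "cons (cl (Y \<union> Z))" "cons (cl (Z \<union> X))"
  let ?G = "(X \<union> Y \<union> Z) \<inter> J"
  have E: "?G \<subseteq> E" using J_E by blast
  have "cons X" "cons Y" "cons Z"
    using cons_mono[OF cons(1)] cons_mono[OF cons(2)] subset_cl[of "X \<union> Y"] subset_cl[of "Y \<union> Z"] by simp_all
  then have "X = cl (X \<inter> J)" "Y = cl (Y \<inter> J)" "Z = cl (Z \<inter> J)" using closed cl_J by simp_all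
  moreover have "cl (X \<inter> J) \<subseteq> cl ?G" "cl (Y \<inter> J) \<subseteq> cl ?G" "cl (Z \<inter> J) \<subseteq> cl ?G"
    by (intro cl_mono; blast)+
  ultimately have sub: "X \<union> Y \<union> Z \<subseteq> cl ?G" by simp
  have "cons (cl ?G)"
  proof (rule cons_cl_if_pairs[OF assms])
    fix p q assume "p \<in> ?G" "q \<in> ?G"
    then have "{p, q} \<subseteq> X \<union> Y \<or> {p, q} \<subseteq> Y \<union> Z \<or> {p, q} \<subseteq> Z \<union> X" by blast
    then show "cons (cl {p, q})"
      by (elim disjE) (rule cons_mono[OF cons(1) cl_mono] cons_mono[OF cons(2) cl_mono]
        cons_mono[OF cons(3) cl_mono], assumption)+
  qed simp
  then show "cons (cl (X \<union> Y \<union> Z))" using cl_subset_cl[OF sub E] by (rule cons_mono)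
qed

theorem laws_iff_local_conditions: "modular_law \<and> triple_law \<longleftrightarrow> local_conditions"
proof (cases "cons (cl {})")
  case True
  then show ?thesis
    using local_conditions_if_modular modular_if_local_conditions triple_if_local_conditions
    unfolding local_conditions_def by blast
next
  case False
  then have "\<not> cons (cl S)" for S using cons_mono cl_mono[of "{}" S] by blast
  then show ?thesis unfolding local_conditions_def modular_law_def triple_law_def by simp
qed

end

section \<open>Modular semilattices of closed sets\<close>

lemma inclusion_order_simps [simp]:
  "carrier (inclusion_order F) = F"
  "X \<sqsubseteq>\<^bsub>inclusion_order F\<^esub> Y \<longleftrightarrow> X \<subseteq> Y"
  "X .=\<^bsub>inclusion_order F\<^esub> Y \<longleftrightarrow> X = Y"
  by (simp_all add: inclusion_order_def)

lemma principal_ideal_inclusion_order: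
  "principal_ideal (inclusion_order F) X = inclusion_order {Y \<in> F. Y \<subseteq> X}"
  by (simp add: principal_ideal_def inclusion_order_def)

lemma partial_order_inclusion_order: "partial_order (inclusion_order F)"
  by unfold_locales (auto simp: inclusion_order_def)

lemma least_Upper_iff:
  assumes "A \<subseteq> F"
  shows "least (inclusion_order F) U (Upper (inclusion_order F) A) \<longleftrightarrow>
    U \<in> F \<and> (\<forall>X\<in>A. X \<subseteq> U) \<and> (\<forall>V\<in>F. (\<forall>X\<in>A. X \<subseteq> V) \<longrightarrow> U \<subseteq> V)"
proof -
  have "Upper (inclusion_order F) A = {V \<in> F. \<forall>X\<in>A. X \<subseteq> V}"
    using assms by (auto simp: Upper_def)
  then show ?thesis by (simp add: least_def) blast
qed

lemma greatest_Lower_iff: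
  assumes "A \<subseteq> F"
  shows "greatest (inclusion_order F) U (Lower (inclusion_order F) A) \<longleftrightarrow>
    U \<in> F \<and> (\<forall>X\<in>A. U \<subseteq> X) \<and> (\<forall>V\<in>F. (\<forall>X\<in>A. V \<subseteq> X) \<longrightarrow> V \<subseteq> U)"
proof -
  have "Lower (inclusion_order F) A = {V \<in> F. \<forall>X\<in>A. V \<subseteq> X}"
    using assms by (auto simp: Lower_def)
  then show ?thesis by (simp add: greatest_def) blast
qed

context implication_system
begin

abbreviation (input) family :: "'a set set" where
  "family \<equiv> implication_family E \<Sigma>"

text \<open>The closure of the union is the only candidate for the join, and only inconsistency can
  keep it out of the family.\<close>

lemma least_Upper_family_iff:
  assumes "\<A> \<subseteq> family"
  shows "least (inclusion_order family) U (Upper (inclusion_order family) \<A>) \<longleftrightarrow>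
    cons (cl (\<Union>\<A>)) \<and> U = cl (\<Union>\<A>)"
proof -
  have "X \<subseteq> E" if "X \<in> \<A>" for X using that assms closed_subset[of X] family_iff[of X] by blast
  then have "\<Union>\<A> \<subseteq> E" by blast
  then have closed: "closed (cl (\<Union>\<A>))" by (rule closed_cl)
  have sub: "X \<subseteq> cl (\<Union>\<A>)" if "X \<in> \<A>" for X using that subset_cl[of "\<Union>\<A>"] by blast
  have least: "cl (\<Union>\<A>) \<subseteq> V" if "V \<in> family" "\<forall>X\<in>\<A>. X \<subseteq> V" for V
    using that by (intro cl_least) (auto simp: family_iff)
  show ?thesis
  proof (subst least_Upper_iff[OF assms], intro iffI conjI; (elim conjE)?)
    assume U: "U \<in> family" "\<forall>X\<in>\<A>. X \<subseteq> U" "\<forall>V\<in>family. (\<forall>X\<in>\<A>. X \<subseteq> V) \<longrightarrow> U \<subseteq> V"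
    have "cl (\<Union>\<A>) \<subseteq> U" by (rule least[OF U(1,2)])
    then show cons: "cons (cl (\<Union>\<A>))" using U(1) cons_mono[of U] by (simp add: family_iff)
    then have "cl (\<Union>\<A>) \<in> family" using closed by (simp add: family_iff)
    then have "U \<subseteq> cl (\<Union>\<A>)" using U(3) sub by blast
    with \<open>cl (\<Union>\<A>) \<subseteq> U\<close> show "U = cl (\<Union>\<A>)" by blast
  next
    assume "cons (cl (\<Union>\<A>))" "U = cl (\<Union>\<A>)"
    then show "U \<in> family" "\<forall>X\<in>\<A>. X \<subseteq> U" "\<forall>V\<in>family. (\<forall>X\<in>\<A>. X \<subseteq> V) \<longrightarrow> U \<subseteq> V"
      using closed sub least by (simp_all add: family_iff)
  qed
qed

lemma join_exists_family_iff:
  "\<A> \<subseteq> family \<Longrightarrow> join_exists (inclusion_order family) \<A> \<longleftrightarrow> cons (cl (\<Union>\<A>))"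
  by (simp add: join_exists_def least_Upper_family_iff)

lemma lower_semilattice_family: "lower_semilattice (inclusion_order family)"
proof -
  interpret partial_order "inclusion_order family" by (rule partial_order_inclusion_order)
  show ?thesis
  proof
    fix X Y assume "X \<in> carrier (inclusion_order family)" "Y \<in> carrier (inclusion_order family)"
    then have "X \<in> family" "Y \<in> family" "X \<inter> Y \<in> family"
      using closed_Int cons_mono[of X "X \<inter> Y"] by (auto simp: family_iff)
    then have "greatest (inclusion_order family) (X \<inter> Y) (Lower (inclusion_order family) {X, Y})"
      by (subst greatest_Lower_iff) auto
    then show "\<exists>S. greatest (inclusion_order family) S (Lower (inclusion_order family) {X, Y})" ..
  qed
qed

lemma ideal_operations:
  assumes X: "X \<in> family" and AB: "A \<in> family" "A \<subseteq> X" "B \<in> family" "B \<subseteq> X"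
  defines "I \<equiv> inclusion_order {Y \<in> family. Y \<subseteq> X}"
  shows "least I (cl (A \<union> B)) (Upper I {A, B})" "greatest I (A \<inter> B) (Lower I {A, B})"
    "A \<squnion>\<^bsub>I\<^esub> B = cl (A \<union> B)" "A \<sqinter>\<^bsub>I\<^esub> B = A \<inter> B"
proof -
  have clAB: "closed (cl (A \<union> B))" "cl (A \<union> B) \<subseteq> X" "A \<union> B \<subseteq> cl (A \<union> B)"
    using AB X closed_subset[of A] closed_subset[of B] subset_cl[of "A \<union> B"]
    by (simp_all add: family_iff closed_cl cl_least)
  then have in_family: "cl (A \<union> B) \<in> family" "A \<inter> B \<in> family"
    using X AB cons_mono[of X "cl (A \<union> B)"] cons_mono[of A "A \<inter> B"] closed_Int
    by (simp_all add: family_iff)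
  interpret partial_order I unfolding I_def by (rule partial_order_inclusion_order)
  show least: "least I (cl (A \<union> B)) (Upper I {A, B})"
    unfolding I_def using AB clAB in_family cl_least[of _ "A \<union> B"]
    by (subst least_Upper_iff) (simp_all add: family_iff)
  show greatest: "greatest I (A \<inter> B) (Lower I {A, B})"
    unfolding I_def using AB in_family by (subst greatest_Lower_iff) auto
  \<comment> \<open>\<open>join\<close> and \<open>meet\<close> are defined by choice, so uniqueness
    of least and greatest elements is needed to compute them.\<close>
  show "A \<squnion>\<^bsub>I\<^esub> B = cl (A \<union> B)"
    unfolding join_def sup_def 
    by (rule some_equality[where P = "\<lambda>U. least I U (Upper I {A, B})", OF least])
      (rule least_unique[OF _ least])
  show "A \<sqinter>\<^bsub>I\<^esub> B = A \<inter> B"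
    unfolding meet_def inf_def 
    by (rule some_equality[where P = "\<lambda>U. greatest I U (Lower I {A, B})", OF greatest])
      (rule greatest_unique[OF _ greatest])
qed

lemma modular_lattice_ideal_iff:
  assumes X: "X \<in> family"
  shows "modular_lattice (principal_ideal (inclusion_order family) X) \<longleftrightarrow>
    (\<forall>A\<in>{Y. closed Y \<and> Y \<subseteq> X}. \<forall>B\<in>{Y. closed Y \<and> Y \<subseteq> X}. \<forall>C\<in>{Y. closed Y \<and> Y \<subseteq> X}.
      A \<subseteq> C \<longrightarrow> cl (A \<union> (B \<inter> C)) = cl (A \<union> B) \<inter> C)"
proof -
  let ?I = "inclusion_order {Y \<in> family. Y \<subseteq> X}"
  \<comment> \<open>Subsets of the consistent set \<open>X\<close> are consistent, so the ideal
    consists of all closed sets below \<open>X\<close>.\<close>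
  have carrier: "carrier ?I = {Y. closed Y \<and> Y \<subseteq> X}"
    using X cons_mono[of X] by (auto simp: family_iff)
  have ops: "least ?I (cl (A \<union> B)) (Upper ?I {A, B})" "greatest ?I (A \<inter> B) (Lower ?I {A, B})"
    "A \<squnion>\<^bsub>?I\<^esub> B = cl (A \<union> B)" "A \<sqinter>\<^bsub>?I\<^esub> B = A \<inter> B"
    if "A \<in> carrier ?I" "B \<in> carrier ?I" for A B
    using ideal_operations[OF X] that by simp_all
  interpret partial_order ?I by (rule partial_order_inclusion_order)
  have "Lattice.lattice ?I"
    by unfold_locales (use ops(1,2) in blast)+
  moreover have closed_ops: "A \<inter> B \<in> carrier ?I" "cl (A \<union> B) \<in> carrier ?I"
    if "A \<in> carrier ?I" "B \<in> carrier ?I" for A B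
    using ops(1,2)[OF that] by (simp_all only: least_closed greatest_closed)
  ultimately have "modular_lattice ?I \<longleftrightarrow> (\<forall>A\<in>carrier ?I. \<forall>B\<in>carrier ?I. \<forall>C\<in>carrier ?I.
      A \<subseteq> C \<longrightarrow> cl (A \<union> (B \<inter> C)) = cl (A \<union> B) \<inter> C)"
    unfolding modular_lattice_def by (simp only: ops closed_ops inclusion_order_simps simp_thms cong: ball_cong)
  then show ?thesis unfolding principal_ideal_inclusion_order carrier .
qed

text \<open>An instance of \<open>modular_law\<close> lives in the ideal below
  \<open>cl (A \<union> B \<union> C)\<close>, the least member above the three sets. The law states
  one inclusion only, as the other holds in every lattice.\<close>

theorem modular_semilattice_iff_laws:
  "modular_semilattice (inclusion_order family) \<longleftrightarrow> modular_law \<and> triple_law"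
proof -
  let ?ex = "join_exists (inclusion_order family)"
  have "(\<forall>X\<in>family. modular_lattice (principal_ideal (inclusion_order family) X)) \<longleftrightarrow> modular_law"
  proof
    assume *: "\<forall>X\<in>family. modular_lattice (principal_ideal (inclusion_order family) X)"
    show modular_law
      unfolding modular_law_def
    proof (intro allI impI, elim conjE)
      fix A B C
      assume ABC: "closed A" "closed B" "closed C" "cons (cl (A \<union> B \<union> C))" "A \<subseteq> C"
      let ?X = "cl (A \<union> B \<union> C)"
      have X: "?X \<in> family"
        using ABC by (simp add: family_iff closed_cl closed_subset)
      have "A \<subseteq> ?X" "B \<subseteq> ?X" "C \<subseteq> ?X" using subset_cl[of "A \<union> B \<union> C"] by simp_all
      then have "cl (A \<union> (B \<inter> C)) = cl (A \<union> B) \<inter> C"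
        using bspec[OF * X] ABC unfolding modular_lattice_ideal_iff[OF X] by simp
      then show "cl (A \<union> B) \<inter> C \<subseteq> cl (A \<union> (B \<inter> C))" by simp
    qed
  next
    assume M: modular_law
    show "\<forall>X\<in>family. modular_lattice (principal_ideal (inclusion_order family) X)"
    proof
      fix X assume X: "X \<in> family"
      show "modular_lattice (principal_ideal (inclusion_order family) X)"
        unfolding modular_lattice_ideal_iff[OF X]
      proof (intro ballI impI)
        fix A B C
        assume "A \<in> {Y. closed Y \<and> Y \<subseteq> X}" "B \<in> {Y. closed Y \<and> Y \<subseteq> X}" "C \<in> {Y. closed Y \<and> Y \<subseteq> X}"
          and "A \<subseteq> C"
        then have ABC: "closed A" "closed B" "closed C" "A \<subseteq> X" "B \<subseteq> X" "C \<subseteq> X" "A \<subseteq> C" by simp_all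
        have "cl (A \<union> B) \<inter> C \<subseteq> cl (A \<union> (B \<inter> C))"
          by (rule modular_lawD[OF M, of X]) (use X ABC in \<open>simp_all add: family_iff\<close>)
        moreover have "cl (A \<union> (B \<inter> C)) \<subseteq> cl (A \<union> B)" by (rule cl_mono) blast
        moreover have "cl (A \<union> (B \<inter> C)) \<subseteq> C" using ABC by (intro cl_least) simp_all
        ultimately show "cl (A \<union> (B \<inter> C)) = cl (A \<union> B) \<inter> C" by blast
      qed
    qed
  qed
  moreover have "(\<forall>X\<in>family. \<forall>Y\<in>family. \<forall>Z\<in>family. ?ex {X, Y} \<and> ?ex {Y, Z} \<and> ?ex {Z, X} \<longrightarrow> ?ex {X, Y, Z}) \<longleftrightarrow>
    triple_law"
  proof -
    have join: "?ex {X, Y} \<longleftrightarrow> cons (cl (X \<union> Y))" "?ex {X, Y, Z} \<longleftrightarrow> cons (cl (X \<union> Y \<union> Z))"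
      if "X \<in> family" "Y \<in> family" "Z \<in> family" for X Y Z
      using join_exists_family_iff[of "{X, Y}"] join_exists_family_iff[of "{X, Y, Z}"] that
      by (simp_all add: Un_assoc)
    have "X \<in> family \<and> Y \<in> family \<and> Z \<in> family"
      if "closed X" "closed Y" "closed Z" "cons (cl (X \<union> Y))" "cons (cl (Z \<union> X))" for X Y Z
      using that subset_cl[of "X \<union> Y"] subset_cl[of "Z \<union> X"] unfolding family_iff by (meson Un_subset_iff cons_mono)
    then have "triple_law \<longleftrightarrow> (\<forall>X\<in>family. \<forall>Y\<in>family. \<forall>Z\<in>family. cons (cl (X \<union> Y)) \<and>
        cons (cl (Y \<union> Z)) \<and> cons (cl (Z \<union> X)) \<longrightarrow> cons (cl (X \<union> Y \<union> Z)))"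
      unfolding triple_law_def by (meson family_iff)
    then show ?thesis by (simp add: join cong: ball_cong_simp)
  qed
  ultimately show ?thesis
    using lower_semilattice_family unfolding modular_semilattice_def by simp
qed

text \<open>The laws speak of inclusion and closure only, so they can be pulled back along an
  injective renaming. This allows arbitrary names in the language while the recognizer works with
  indices.\<close>

lemma laws_relabel:
  fixes h :: "'a \<Rightarrow> 'b"
  assumes inj: "inj_on h E"
    and system: "implication_system (h ` E) ((\<lambda>(A, B). (h ` A, h ` B)) ` \<Sigma>)"
    and laws: "implication_system.modular_law (h ` E) ((\<lambda>(A, B). (h ` A, h ` B)) ` \<Sigma>)"
      "implication_system.triple_law (h ` E) ((\<lambda>(A, B). (h ` A, h ` B)) ` \<Sigma>)"
  shows "modular_law \<and> triple_law"
proof -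
  interpret h: implication_system "h ` E" "(\<lambda>(A, B). (h ` A, h ` B)) ` \<Sigma>" by (rule system)
  have sub: "h ` A \<subseteq> h ` X \<longleftrightarrow> A \<subseteq> X" if "A \<subseteq> E" "X \<subseteq> E" for A X
    using inj_on_image_mem_iff[OF inj _ that(2)] that(1) by blast
  have \<Sigma>: "A \<subseteq> E \<and> B \<subseteq> E" if "(A, B) \<in> \<Sigma>" for A B
    using implications that by (auto simp: implications_on_def)
  have all: "(\<forall>A B. (A, B) \<in> (\<lambda>(A, B). (h ` A, h ` B)) ` \<Sigma> \<longrightarrow> P A B) \<longleftrightarrow>
      (\<forall>A B. (A, B) \<in> \<Sigma> \<longrightarrow> P (h ` A) (h ` B))" for P
    by force
  have closed: "h.closed (h ` X) \<longleftrightarrow> closed X" if X: "X \<subseteq> E" for X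
  proof -
    have "(h ` A \<subseteq> h ` X \<longrightarrow> h ` B \<subseteq> h ` X) \<longleftrightarrow> (A \<subseteq> X \<longrightarrow> B \<subseteq> X)" if "(A, B) \<in> \<Sigma>" for A B
      using sub[OF _ X] \<Sigma>[OF that] by simp
    then show ?thesis unfolding h.closed_def closed_def all using X by (simp add: image_mono)
  qed
  have cons: "h.cons (h ` X) \<longleftrightarrow> cons X" if X: "X \<subseteq> E" for X
  proof -
    have img: "h ` A \<subseteq> h ` X \<longleftrightarrow> A \<subseteq> X" if "(A, {}) \<in> \<Sigma>" for A
      using sub[OF _ X] \<Sigma>[OF that] by simp
    have "h.cons (h ` X) \<longleftrightarrow>
        (\<forall>A B. (A, B) \<in> (\<lambda>(A, B). (h ` A, h ` B)) ` \<Sigma> \<longrightarrow> B = {} \<longrightarrow> \<not> A \<subseteq> h ` X)"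
      unfolding h.cons_def by simp
    also have "\<dots> \<longleftrightarrow> (\<forall>A B. (A, B) \<in> \<Sigma> \<longrightarrow> h ` B = {} \<longrightarrow> \<not> h ` A \<subseteq> h ` X)"
      by (rule all)
    also have "\<dots> \<longleftrightarrow> cons X"
      unfolding cons_def using img by (auto simp: image_mono)
    finally show ?thesis .
  qed
  have cl: "h.cl (h ` S) = h ` cl S" if S: "S \<subseteq> E" for S
  proof
    have "closed (cl S)" "cl S \<subseteq> E" using S by (simp_all add: closed_cl cl_subset_E)
    then show "h.cl (h ` S) \<subseteq> h ` cl S"
      using subset_cl[of S] by (intro h.cl_least) (auto simp: closed)
    \<comment> \<open>Every subset of the image is an image itself, so a preimage \<open>X\<close>
      of the closure can be compared with \<open>cl S\<close>.\<close>
    have clE: "h.cl (h ` S) \<subseteq> h ` E" using S by (intro h.cl_subset_E) auto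
    then obtain X where X: "X \<subseteq> E" "h.cl (h ` S) = h ` X" by (auto simp: subset_image_iff)
    have "h.closed (h ` X)" using h.closed_cl[of "h ` S"] S X by auto
    moreover have "S \<subseteq> X" using h.subset_cl[of "h ` S"] X S sub by simp
    ultimately have "cl S \<subseteq> X" using X closed by (intro cl_least) auto
    then show "h ` cl S \<subseteq> h.cl (h ` S)" using X by auto
  qed
  show ?thesis
  proof
    show modular_law
      unfolding modular_law_def
    proof (intro allI impI, elim conjE)
      fix A B C
      assume ABC: "closed A" "closed B" "closed C" "cons (cl (A \<union> B \<union> C))" "A \<subseteq> C"
      have E: "A \<subseteq> E" "B \<subseteq> E" "C \<subseteq> E" using ABC by (simp_all add: closed_subset)
      have BC: "h ` B \<inter> h ` C = h ` (B \<inter> C)" using inj_on_image_Int[OF inj E(2,3)] by simp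
      have clE: "cl (A \<union> B) \<subseteq> E" "cl (A \<union> (B \<inter> C)) \<subseteq> E" "cl (A \<union> B \<union> C) \<subseteq> E"
        using E by (intro cl_subset_E; auto)+
      have "h.cl (h ` A \<union> h ` B) \<inter> h ` C \<subseteq> h.cl (h ` A \<union> (h ` B \<inter> h ` C))"
        using laws(1) ABC E closed cons cl[of "A \<union> B \<union> C"] clE
        unfolding h.modular_law_def by (simp add: image_Un image_mono)
      then have "h ` (cl (A \<union> B) \<inter> C) \<subseteq> h ` cl (A \<union> (B \<inter> C))"
        unfolding BC using cl[of "A \<union> B"] cl[of "A \<union> (B \<inter> C)"] E inj_on_image_Int[OF inj clE(1) E(3)]
        by (simp add: image_Un le_supI1 le_infI1)
      then show "cl (A \<union> B) \<inter> C \<subseteq> cl (A \<union> (B \<inter> C))"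
        using sub[of "cl (A \<union> B) \<inter> C"] clE by auto
    qed
    show triple_law
      unfolding triple_law_def
    proof (intro allI impI, elim conjE)
      fix X Y Z
      assume XYZ: "closed X" "closed Y" "closed Z" "cons (cl (X \<union> Y))" "cons (cl (Y \<union> Z))" "cons (cl (Z \<union> X))"
      have E: "X \<subseteq> E" "Y \<subseteq> E" "Z \<subseteq> E" using XYZ by (simp_all add: closed_subset)
      have cons_cl: "h.cons (h.cl (h ` S)) \<longleftrightarrow> cons (cl S)" if "S \<subseteq> E" for S
        using that by (simp add: cl cons cl_subset_E)
      have "h.cons (h.cl (h ` X \<union> h ` Y \<union> h ` Z))"
        using laws(2) XYZ E closed cons_cl[of "X \<union> Y"] cons_cl[of "Y \<union> Z"] cons_cl[of "Z \<union> X"]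
        unfolding h.triple_law_def by (simp add: image_Un)
      then show "cons (cl (X \<union> Y \<union> Z))"
        using cons_cl[of "X \<union> Y \<union> Z"] E by (simp add: image_Un)
    qed
  qed
qed

end

section \<open>Code words\<close>

abbreviation block_start :: "nat \<Rightarrow> nat \<Rightarrow> nat" where
  "block_start n i \<equiv> n + 1 + i * (2 * n + 1)"

text \<open>The length is the address at which a further block \<open>m\<close> would begin. Bits of
  characteristic vectors are unrestricted.\<close>

definition code_word :: "nat \<Rightarrow> nat \<Rightarrow> bool list \<Rightarrow> bool" where
  "code_word n m w \<longleftrightarrow> length w = block_start n m \<and> (\<forall>i<n. w ! i) \<and> \<not> w ! n \<and>
     (\<forall>i<m. w ! (block_start n i))"

definition premise :: "nat \<Rightarrow> nat set \<Rightarrow> nat \<Rightarrow> nat set" where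
  "premise n W s = {e. e < n \<and> s + e + 1 \<in> W}"

definition conclusion :: "nat \<Rightarrow> nat set \<Rightarrow> nat \<Rightarrow> nat set" where
  "conclusion n W s = {e. e < n \<and> s + n + e + 1 \<in> W}"

definition word_implications :: "nat \<Rightarrow> nat set \<Rightarrow> nat set \<Rightarrow> nat implication set" where
  "word_implications n W T = (\<lambda>s. (premise n W s, conclusion n W s)) ` T"

definition block_starts :: "nat \<Rightarrow> nat \<Rightarrow> nat set" where
  "block_starts n m = (\<lambda>i. block_start n i) ` {..<m}"

lemma word_system: "implication_system {..<n} (word_implications n W T)"
  by unfold_locales
    (auto simp: implications_on_def word_implications_def premise_def conclusion_def)

lemma nth_concat_blocks:
  assumes "\<And>x. x \<in> set xs \<Longrightarrow> length (f x) = k" "i < length xs" "j < k"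
  shows "concat (map f xs) ! (i * k + j) = f (xs ! i) ! j"
  using assms
proof (induction xs arbitrary: i)
  case (Cons x xs)
  then show ?case by (cases i) (auto simp: nth_append add.assoc)
qed simp

lemma length_concat_blocks:
  "(\<And>x. x \<in> set xs \<Longrightarrow> length (f x) = k) \<Longrightarrow> length (concat (map f xs)) = length xs * k"
  by (induction xs) auto

lemma length_encode_implication: "length (encode_implication es I) = 2 * length es + 1"
  by (cases I) (simp add: char_vector_def)

lemma length_encode: "length (encode es \<Sigma>) = length es + 1 + length \<Sigma> * (2 * length es + 1)"
  unfolding encode_def
  by (simp add: length_concat_blocks[where k = "2 * length es + 1"] length_encode_implication)

lemma nth_encode_block:
  assumes "i < length \<Sigma>" "j < 2 * length es + 1"
  shows "encode es \<Sigma> ! (block_start (length es) i + j) = encode_implication es (\<Sigma> ! i) ! j"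
proof -
  have "encode es \<Sigma> ! (length es + 1 + k) = concat (map (encode_implication es) \<Sigma>) ! k" for k
    by (simp add: encode_def nth_append)
  from this[of "i * (2 * length es + 1) + j"] show ?thesis
    using nth_concat_blocks[OF length_encode_implication assms] by (simp add: add.assoc)
qed

lemma nth_encode_implication:
  assumes "e < length es"
  shows "encode_implication es I ! (e + 1) \<longleftrightarrow> es ! e \<in> fst I"
    "encode_implication es I ! (length es + e + 1) \<longleftrightarrow> es ! e \<in> snd I"
  using assms by (cases I; simp add: char_vector_def nth_append)+

lemma code_word_encode: "code_word (length es) (length \<Sigma>) (encode es \<Sigma>)"
proof -
  have "encode es \<Sigma> ! (block_start (length es) i)" if "i < length \<Sigma>" for i
    using nth_encode_block[OF that, of 0 es] by (cases "\<Sigma> ! i") simp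
  then show ?thesis
    unfolding code_word_def by (auto simp: length_encode) (simp_all add: encode_def nth_append)
qed

lemma image_nth_eq:
  assumes "P \<subseteq> {..<length es}" "S \<subseteq> set es" "\<And>e. e < length es \<Longrightarrow> e \<in> P \<longleftrightarrow> es ! e \<in> S"
  shows "(!) es ` P = S"
proof
  show "(!) es ` P \<subseteq> S" using assms by auto
  show "S \<subseteq> (!) es ` P"
  proof
    fix x assume "x \<in> S"
    then obtain e where "e < length es" "es ! e = x" using assms(2) by (metis in_set_conv_nth subsetD)
    then show "x \<in> (!) es ` P" using assms(3) \<open>x \<in> S\<close> by blast
  qed
qed

lemma mem_word_encode:
  assumes "i < length \<Sigma>" "e < length es"
  defines "s \<equiv> block_start (length es) i"
  shows "e \<in> premise (length es) (ones (encode es \<Sigma>)) s \<longleftrightarrow> es ! e \<in> fst (\<Sigma> ! i)"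
    "e \<in> conclusion (length es) (ones (encode es \<Sigma>)) s \<longleftrightarrow> es ! e \<in> snd (\<Sigma> ! i)"
proof -
  let ?l = "2 * length es + 1"
  have "Suc i * ?l \<le> length \<Sigma> * ?l" using assms(1) by (intro mult_le_mono1) simp
  then have "i * ?l + ?l \<le> length \<Sigma> * ?l" by simp
  then have "s + e + 1 < length (encode es \<Sigma>)" "s + length es + e + 1 < length (encode es \<Sigma>)"
    unfolding length_encode s_def using assms(2) by linarith+
  moreover have "encode es \<Sigma> ! (s + (e + 1)) \<longleftrightarrow> es ! e \<in> fst (\<Sigma> ! i)"
    "encode es \<Sigma> ! (s + (length es + e + 1)) \<longleftrightarrow> es ! e \<in> snd (\<Sigma> ! i)"
    unfolding s_def using assms(1,2)
      nth_encode_block[OF assms(1), of "e + 1" es] nth_encode_block[OF assms(1), of "length es + e + 1" es]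
      nth_encode_implication[OF assms(2), of "\<Sigma> ! i"]
    by simp_all
  ultimately show "e \<in> premise (length es) (ones (encode es \<Sigma>)) s \<longleftrightarrow> es ! e \<in> fst (\<Sigma> ! i)"
    "e \<in> conclusion (length es) (ones (encode es \<Sigma>)) s \<longleftrightarrow> es ! e \<in> snd (\<Sigma> ! i)"
    using assms(2) by (simp_all add: premise_def conclusion_def ones_def add.assoc)
qed

text \<open>Every word of the right shape encodes a system on indices, so the recognizer has to
  check the shape and nothing else about the encoding.\<close>

lemma encode_decode:
  assumes "code_word n m w"
  defines "W \<equiv> ones w"
  defines "\<Sigma> \<equiv> map (\<lambda>i. (premise n W (block_start n i), conclusion n W (block_start n i))) [0..<m]"
  shows "encode [0..<n] \<Sigma> = w"
proof (rule nth_equalityI)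
  have len: "length w = block_start n m" using assms(1) by (simp add: code_word_def)
  show "length (encode [0..<n] \<Sigma>) = length w" using len by (simp add: length_encode \<Sigma>_def)
  fix k assume "k < length (encode [0..<n] \<Sigma>)"
  then have k: "k < block_start n m" by (simp add: length_encode \<Sigma>_def)
  consider "k < n" | "k = n" | "n + 1 \<le> k" by linarith
  then show "encode [0..<n] \<Sigma> ! k = w ! k"
  proof cases
    case 1
    then show ?thesis using assms(1) by (simp add: encode_def nth_append code_word_def)
  next
    case 2
    then show ?thesis using assms(1) by (simp add: encode_def nth_append code_word_def)
  next
    case 3
    let ?l = "2 * n + 1"
    define i where "i = (k - (n + 1)) div ?l"
    define j where "j = (k - (n + 1)) mod ?l"
    have kij: "k = n + 1 + i * ?l + j"
      using 3 div_mult_mod_eq[of "k - (n + 1)" ?l] unfolding i_def j_def by linarith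
    have j: "j < 2 * length [0..<n] + 1" by (simp add: j_def)
    have i: "i < length \<Sigma>" using k 3 by (simp add: i_def \<Sigma>_def less_mult_imp_div_less)
    have block: "encode [0..<n] \<Sigma> ! k = encode_implication [0..<n] (\<Sigma> ! i) ! j"
      using nth_encode_block[OF i j] unfolding kij by simp
    have im: "i < m" using i by (simp add: \<Sigma>_def)
    consider "j = 0" | e where "j = e + 1" "e < n" | e where "j = n + e + 1" "e < n"
    proof -
      have "j = 0 \<or> (j = (j - 1) + 1 \<and> j - 1 < n) \<or> (j = n + (j - n - 1) + 1 \<and> j - n - 1 < n)"
        using j by auto
      then show ?thesis using that by blast
    qed
    then show ?thesis
    proof cases
      case 1
      then show ?thesis
        using block assms(1) im unfolding kij by (cases "\<Sigma> ! i") (auto simp: code_word_def)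
    next
      case 2
      then have "encode_implication [0..<n] (\<Sigma> ! i) ! j \<longleftrightarrow> e \<in> fst (\<Sigma> ! i)"
        using nth_encode_implication(1)[of e "[0..<n]"] by simp
      also have "\<dots> \<longleftrightarrow> k \<in> W" using 2 im kij by (simp add: \<Sigma>_def premise_def add.assoc)
      also have "\<dots> \<longleftrightarrow> w ! k" using k len by (simp add: W_def ones_def)
      finally show ?thesis using block by simp
    next
      case 3
      then have "encode_implication [0..<n] (\<Sigma> ! i) ! j \<longleftrightarrow> e \<in> snd (\<Sigma> ! i)"
        using nth_encode_implication(2)[of e "[0..<n]"] by simp
      also have "\<dots> \<longleftrightarrow> k \<in> W" using 3 im kij by (simp add: \<Sigma>_def conclusion_def add.assoc)
      also have "\<dots> \<longleftrightarrow> w ! k" using k len by (simp add: W_def ones_def)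
      finally show ?thesis using block by simp
    qed
  qed
qed

text \<open>The names in \<open>es\<close> are lost in the word. From left to right the laws are
  pulled back along the indexing of \<open>es\<close>; from right to left the indices themselves are
  the ground set.\<close>

theorem mem_language_iff:
  fixes w :: "bool list"
  defines "W \<equiv> ones w"
  shows "(\<exists>(es :: nat list) (\<Sigma> :: nat implication list). w = encode es \<Sigma> \<and> distinct es \<and>
      implications_on (set es) (set \<Sigma>) \<and>
      modular_semilattice (inclusion_order (implication_family (set es) (set \<Sigma>)))) \<longleftrightarrow>
    (\<exists>n m. code_word n m w \<and>
      implication_system.local_conditions {..<n} (word_implications n W (block_starts n m)))"
    (is "?L \<longleftrightarrow> ?R")
proof
  assume ?L
  then obtain es :: "nat list" and \<Sigma> :: "nat implication list"
    where w: "w = encode es \<Sigma>" and es: "distinct es" "implications_on (set es) (set \<Sigma>)"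
      and modular: "modular_semilattice (inclusion_order (implication_family (set es) (set \<Sigma>)))" by blast
  let ?n = "length es" and ?m = "length \<Sigma>" and ?h = "(!) es"
  let ?\<Sigma> = "word_implications ?n W (block_starts ?n ?m)"
  interpret I: implication_system "{..<?n}" ?\<Sigma> by (rule word_system)
  interpret H: implication_system "set es" "set \<Sigma>" by unfold_locales (use es in simp_all)
  have E: "?h ` {..<?n} = set es" by (auto simp: set_conv_nth)
  have inj: "inj_on ?h {..<?n}" using es(1) by (simp add: inj_on_nth)
  have block: "(\<lambda>(A, B). (?h ` A, ?h ` B)) (premise ?n W (block_start ?n i), conclusion ?n W (block_start ?n i)) = \<Sigma> ! i"
    if i: "i < ?m" for i
  proof -
    let ?s = "block_start ?n i"
    have sub: "fst (\<Sigma> ! i) \<subseteq> set es" "snd (\<Sigma> ! i) \<subseteq> set es"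
      using es(2) nth_mem[OF i] by (auto simp: implications_on_def split: prod.splits) (metis prod.collapse subsetD)+
    have "premise ?n W ?s \<subseteq> {..<?n}" "conclusion ?n W ?s \<subseteq> {..<?n}"
      by (auto simp: premise_def conclusion_def)
    then have "?h ` premise ?n W ?s = fst (\<Sigma> ! i)" "?h ` conclusion ?n W ?s = snd (\<Sigma> ! i)"
      using mem_word_encode[OF i, of _ es] sub unfolding W_def w
      by (intro image_nth_eq; blast)+
    then show ?thesis by simp
  qed
  have \<Sigma>: "(\<lambda>(A, B). (?h ` A, ?h ` B)) ` ?\<Sigma> = set \<Sigma>"
  proof -
    have "(\<lambda>(A, B). (?h ` A, ?h ` B)) ` ?\<Sigma> = (\<lambda>i. \<Sigma> ! i) ` {..<?m}"
      unfolding word_implications_def block_starts_def image_image by (rule image_cong) (simp_all only: block lessThan_iff)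
    then show ?thesis by (auto simp: set_conv_nth)
  qed
  have "I.modular_law \<and> I.triple_law"
    by (rule I.laws_relabel[OF inj]) (use modular in \<open>simp_all only: E \<Sigma> H.implication_system_axioms H.modular_semilattice_iff_laws\<close>)
  then have "I.local_conditions" using I.laws_iff_local_conditions by simp
  then show ?R using code_word_encode[of es \<Sigma>] w by blast
next
  assume ?R
  then obtain n m where nm: "code_word n m w"
    and local: "implication_system.local_conditions {..<n} (word_implications n W (block_starts n m))" by blast
  let ?\<Sigma> = "map (\<lambda>i. (premise n W (block_start n i), conclusion n W (block_start n i))) [0..<m]"
  interpret I: implication_system "{..<n}" "word_implications n W (block_starts n m)" by (rule word_system)
  have \<Sigma>: "set ?\<Sigma> = word_implications n W (block_starts n m)"
    by (auto simp: word_implications_def block_starts_def image_image)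
  have "w = encode [0..<n] ?\<Sigma>" using encode_decode[OF nm] by (simp add: W_def ones_def)
  moreover have "implications_on (set [0..<n]) (set ?\<Sigma>)"
    unfolding \<Sigma> using I.implications by (simp add: atLeast0LessThan)
  moreover have "modular_semilattice (inclusion_order (implication_family (set [0..<n]) (set ?\<Sigma>)))"
    unfolding \<Sigma> using local I.laws_iff_local_conditions I.modular_semilattice_iff_laws
    by (simp add: atLeast0LessThan)
  ultimately show ?L using distinct_upt by blast
qed

section \<open>The recognizing formula\<close>

fun avoids :: "nat \<Rightarrow> fm \<Rightarrow> bool" where
  "avoids b (Mem a x) \<longleftrightarrow> a \<noteq> b"
| "avoids b (Lin xs c ys) \<longleftrightarrow> True"
| "avoids b (Neg \<phi>) \<longleftrightarrow> avoids b \<phi>"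
| "avoids b (Conj \<phi> \<psi>) \<longleftrightarrow> avoids b \<phi> \<and> avoids b \<psi>"
| "avoids b (Exist x \<phi>) \<longleftrightarrow> avoids b \<phi>"
| "avoids b (Close a x \<phi> \<psi>) \<longleftrightarrow> a \<noteq> b \<and> avoids b \<phi> \<and> avoids b \<psi>"

lemma sem_avoids: "avoids b \<phi> \<Longrightarrow> sem N \<phi> v (A(b := S)) \<longleftrightarrow> sem N \<phi> v A"
proof (induction \<phi> arbitrary: v A)
  case (Close a x \<phi> \<psi>)
  have prems: "a \<noteq> b" "avoids b \<phi>" "avoids b \<psi>" using Close.prems by simp_all
  have twist: "A(b := S, a := X) = A(a := X, b := S)" for X using prems by (simp add: fun_upd_twist)
  show ?case unfolding sem.simps twist Close.IH(1)[OF prems(2)] Close.IH(2)[OF prems(3)] ..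
qed simp_all

text \<open>A step formula that does not mention its own set turns the fixpoint into a set
  comprehension.\<close>

lemma sem_comprehension:
  assumes "avoids a \<phi>"
  shows "sem N (Close a x \<phi> \<psi>) v A \<longleftrightarrow> sem N \<psi> v (A(a := {u. u \<le> N \<and> sem N \<phi> (v(x := u)) A}))"
  by (simp add: sem_avoids[OF assms] generated_const)

abbreviation Or :: "fm \<Rightarrow> fm \<Rightarrow> fm" where
  "Or \<phi> \<psi> \<equiv> Neg (Conj (Neg \<phi>) (Neg \<psi>))"

abbreviation Imp :: "fm \<Rightarrow> fm \<Rightarrow> fm" where
  "Imp \<phi> \<psi> \<equiv> Neg (Conj \<phi> (Neg \<psi>))"

abbreviation All :: "nat \<Rightarrow> fm \<Rightarrow> fm" where
  "All x \<phi> \<equiv> Neg (Exist x (Neg \<phi>))"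

abbreviation Exist_in :: "nat \<Rightarrow> nat \<Rightarrow> fm \<Rightarrow> fm" where
  "Exist_in a x \<phi> \<equiv> Exist x (Conj (Mem a x) \<phi>)"

abbreviation All_in :: "nat \<Rightarrow> nat \<Rightarrow> fm \<Rightarrow> fm" where
  "All_in a x \<phi> \<equiv> All x (Imp (Mem a x) \<phi>)"

lemma sem_Exist_in:
  assumes "A a \<subseteq> {..N}"
  shows "sem N (Exist_in a x \<phi>) v A \<longleftrightarrow> (\<exists>u\<in>A a. sem N \<phi> (v(x := u)) A)"
  using assms by auto

lemma sem_All_in:
  assumes "A a \<subseteq> {..N}"
  shows "sem N (All_in a x \<phi>) v A \<longleftrightarrow> (\<forall>u\<in>A a. sem N \<phi> (v(x := u)) A)"
  using assms by auto

text \<open>Conventions for the formulas below: variable 3 holds the size \<open>n\<close>; set 0 is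
  the word, 2 the starts of the implication blocks, 3 the ground set, and 4 the set
  \<open>J\<close>. The argument \<open>y\<close> is an auxiliary variable for the bit position.
  Nested bound variables are at least two apart, as each binder occupies two tapes.\<close>

definition Prem :: "nat \<Rightarrow> nat \<Rightarrow> nat \<Rightarrow> fm" where
  "Prem y s e = Exist y (Conj (Lin [s, e] 1 [y]) (Mem 0 y))"

definition Concl :: "nat \<Rightarrow> nat \<Rightarrow> nat \<Rightarrow> fm" where
  "Concl y s e = Exist y (Conj (Lin [s, 3, e] 1 [y]) (Mem 0 y))"

text \<open>The set \<open>b\<close> occurs only positively in the step formula, so the fixpoint is
  the closure; the test for set 3 discards positions that are not elements.\<close>

definition CL :: "nat \<Rightarrow> nat \<Rightarrow> nat \<Rightarrow> fm \<Rightarrow> fm" where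
  "CL b a x \<psi> = Close b x
     (Conj (Mem 3 x) (Or (Mem a x) (Exist_in 2 (x + 2) (Conj (Concl (x + 4) (x + 2) x)
       (All_in 3 (x + 4) (Imp (Prem (x + 6) (x + 2) (x + 4)) (Mem b (x + 4)))))))) \<psi>"

text \<open>\<open>Lin [] 1 []\<close> is the equation 1 = 0 and stands for falsity.\<close>

fun Among :: "nat \<Rightarrow> nat list \<Rightarrow> fm" where
  "Among x [] = Lin [] 1 []"
| "Among x (q # qs) = Or (Lin [x] 0 [q]) (Among x qs)"

text \<open>Two names are consumed: \<open>a\<close> for the generators and \<open>a + 1\<close> for
  their closure.\<close>

definition Span :: "nat \<Rightarrow> nat list \<Rightarrow> nat \<Rightarrow> fm \<Rightarrow> fm" where
  "Span a qs x \<psi> = Close a x (Among x qs) (CL (a + 1) a x \<psi>)"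

definition Cons :: "nat \<Rightarrow> nat \<Rightarrow> fm" where
  "Cons a x = All_in 2 x (Or (Exist_in 3 (x + 2) (Concl (x + 4) x (x + 2)))
     (Exist_in 3 (x + 2) (Conj (Prem (x + 4) x (x + 2)) (Neg (Mem a (x + 2))))))"

text \<open>Set \<open>a + 1\<close> is \<open>cl {p}\<close>, set \<open>a + 2\<close> its points
  whose closure misses \<open>p\<close>, and set \<open>a + 5\<close> is \<open>cover p\<close>.
  Membership in set 3 comes first, because \<open>sem_Span\<close> needs generators below
  \<open>n\<close>.\<close>

definition Irreducible :: "nat \<Rightarrow> nat \<Rightarrow> nat \<Rightarrow> fm" where
  "Irreducible p a x = Conj (Mem 3 p) (Span a [p] x (Conj (Cons (a + 1) x)
     (Close (a + 2) x (Conj (Mem (a + 1) x) (Span (a + 3) [x] (x + 2) (Neg (Mem (a + 4) p))))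
       (CL (a + 5) (a + 2) x (Neg (Mem (a + 5) p))))))"

lemma sem_Among: "sem N (Among x qs) v A \<longleftrightarrow> v x \<in> v ` set qs"
  by (induction qs) auto

lemma avoids_Among [simp]: "avoids a (Among x qs)"
  by (induction qs) auto

text \<open>A definition instead of an abbreviation, so that the simplifier uses the rule for a
  quantifier over a known set before it can unfold the formula into \<open>Exist\<close> and
  \<open>Neg\<close>.\<close>

definition Every :: "nat \<Rightarrow> nat \<Rightarrow> fm \<Rightarrow> fm" where
  "Every a x \<phi> = All_in a x \<phi>"

definition Any :: "nat \<Rightarrow> nat \<Rightarrow> fm \<Rightarrow> fm" where
  "Any a x \<phi> = Exist_in a x \<phi>"

lemma sem_Every: "A a \<subseteq> {..N} \<Longrightarrow> sem N (Every a x \<phi>) v A \<longleftrightarrow> (\<forall>u\<in>A a. sem N \<phi> (v(x := u)) A)"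
  unfolding Every_def by (rule sem_All_in)

lemma sem_Any: "A a \<subseteq> {..N} \<Longrightarrow> sem N (Any a x \<phi>) v A \<longleftrightarrow> (\<exists>u\<in>A a. sem N \<phi> (v(x := u)) A)"
  unfolding Any_def by (rule sem_Exist_in)

text \<open>Variables 10 to 18 are the five points. Sets 6, 8, 10 and 12 are the closures of all
  four generators, of the two pairs, and of the chosen \<open>q\<close> and
  \<open>r\<close>.\<close>

definition Projectivity :: fm where
  "Projectivity = Every 4 10 (Every 4 12 (Every 4 14 (Every 4 16 (Every 4 18
     (Span 5 [12, 14, 16, 18] 20 (Imp (Conj (Cons 6 20) (Mem 6 10))
       (Span 7 [12, 14] 20 (Span 9 [16, 18] 20
         (Any 4 20 (Conj (Mem 8 20) (Any 4 22 (Conj (Mem 10 22) (Span 11 [20, 22] 24 (Mem 12 10))))))))))))))"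

definition Exchange :: fm where
  "Exchange = Every 4 10 (Every 4 12 (Every 4 14
     (Span 5 [12, 14] 20 (Imp (Conj (Cons 6 20) (Mem 6 10))
       (Span 7 [12] 20 (Span 9 [10, 14] 20
         (Close 11 20 (Or (Conj (Mem 8 20) (Mem 10 20)) (Lin [20] 0 [14])) (CL 12 11 20 (Mem 12 10)))))))))"

definition Flag :: fm where
  "Flag = Every 4 10 (Every 4 12 (Every 4 14
     (Span 5 [10, 12] 20 (Span 7 [12, 14] 20 (Span 9 [10, 14] 20 (Span 11 [10, 12, 14] 20
       (Imp (Conj (Cons 6 20) (Conj (Cons 8 20) (Cons 10 20))) (Cons 12 20))))))))"

text \<open>The quantifiers run over \<open>J\<close> and test membership in the growing set 9
  separately: the bounds that \<open>sem_Any\<close> and \<open>sem_Span\<close> ask for are known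
  for \<open>J\<close>, but not for an arbitrary stage.\<close>

definition Hull_step :: fm where
  "Hull_step = Conj (Mem 4 20) (Or (Mem 6 20)
     (Any 4 22 (Conj (Mem 9 22) (Any 4 24 (Conj (Mem 9 24) (Span 10 [22, 24] 26 (Mem 11 20)))))))"

text \<open>Set 5 is the premise of the block at variable 10, set 6 its seed and set 9 the line
  hull; sets 7, 8, 10 and 11 serve closures of one or two points.\<close>

definition Generation :: fm where
  "Generation = Every 2 10
     (Close 5 20 (Conj (Mem 3 20) (Prem 22 10 20))
     (Close 6 20 (Conj (Mem 4 20) (Any 5 22 (Span 7 [22] 24 (Mem 8 20))))
     (Close 9 20 Hull_step
       (Imp (Conj (Every 5 20 (Span 10 [20] 22 (Cons 11 22)))
                  (Every 9 20 (Every 9 22 (Span 10 [20, 22] 24 (Cons 11 24)))))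
            (Conj (Any 3 20 (Concl 22 10 20))
                  (Every 3 20 (Imp (Concl 22 10 20)
                    (Span 10 [20] 22 (Conj (Cons 11 22) (Every 4 22 (Imp (Mem 11 22) (Mem 9 22))))))))))))"

definition Local :: fm where
  "Local = Imp (Span 5 [] 20 (Cons 6 20)) (Close 4 20 (Irreducible 20 5 22)
     (Conj Projectivity (Conj Exchange (Conj Flag Generation))))"

section \<open>Meaning of the formulas over a fixed word\<close>

locale word_structure =
  fixes N n :: nat and W T :: "nat set"
  assumes n_le: "n \<le> N" and W_le: "W \<subseteq> {..N}" and T_le: "T \<subseteq> {..N}"
begin

sublocale implication_system "{..<n}" "word_implications n W T"
  by (rule word_system)

lemma closed_word: "closed X \<longleftrightarrow> X \<subseteq> {..<n} \<and> (\<forall>s\<in>T. premise n W s \<subseteq> X \<longrightarrow> conclusion n W s \<subseteq> X)"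
  unfolding closed_def unfolding word_implications_def by auto

lemma cons_word: "cons X \<longleftrightarrow> (\<forall>s\<in>T. conclusion n W s = {} \<longrightarrow> \<not> premise n W s \<subseteq> X)"
  unfolding cons_def unfolding word_implications_def by auto

definition ctx :: "(nat \<Rightarrow> nat) \<Rightarrow> (nat \<Rightarrow> nat set) \<Rightarrow> bool" where
  "ctx v A \<longleftrightarrow> v 3 = n \<and> A 0 = W \<and> A 2 = T \<and> A 3 = {..<n}"

lemma ctx_upd:
  "x \<noteq> 3 \<Longrightarrow> ctx (v(x := u)) A \<longleftrightarrow> ctx v A"
  "a \<noteq> 0 \<Longrightarrow> a \<noteq> 2 \<Longrightarrow> a \<noteq> 3 \<Longrightarrow> ctx v (A(a := S)) \<longleftrightarrow> ctx v A"
  by (auto simp: ctx_def)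

lemma sem_Prem:
  assumes "ctx v A" "y \<noteq> s" "y \<noteq> e" "v e < n"
  shows "sem N (Prem y s e) v A \<longleftrightarrow> v e \<in> premise n W (v s)"
  using assms W_le by (auto simp: Prem_def ctx_def premise_def)

lemma sem_Concl:
  assumes "ctx v A" "y \<noteq> s" "y \<noteq> e" "y \<noteq> 3" "v e < n"
  shows "sem N (Concl y s e) v A \<longleftrightarrow> v e \<in> conclusion n W (v s)"
  using assms W_le by (auto simp: Concl_def ctx_def conclusion_def add_ac)

lemma sem_T:
  assumes "ctx v A"
  shows "sem N (Exist_in 2 x \<phi>) v A \<longleftrightarrow> (\<exists>s\<in>T. sem N \<phi> (v(x := s)) A)"
    "sem N (All_in 2 x \<phi>) v A \<longleftrightarrow> (\<forall>s\<in>T. sem N \<phi> (v(x := s)) A)"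
    "sem N (Exist_in 3 x \<phi>) v A \<longleftrightarrow> (\<exists>e<n. sem N \<phi> (v(x := e)) A)"
    "sem N (All_in 3 x \<phi>) v A \<longleftrightarrow> (\<forall>e<n. sem N \<phi> (v(x := e)) A)"
  using assms T_le n_le by (auto simp: ctx_def)

lemma sem_closure_step:
  assumes "ctx v A" "4 \<le> x" "u < n" "b \<noteq> 0" "b \<noteq> 2" "b \<noteq> 3"
  shows "sem N (Exist_in 2 (x + 2) (Conj (Concl (x + 4) (x + 2) x)
       (All_in 3 (x + 4) (Imp (Prem (x + 6) (x + 2) (x + 4)) (Mem b (x + 4)))))) (v(x := u)) (A(b := S)) \<longleftrightarrow>
    (\<exists>s\<in>T. u \<in> conclusion n W s \<and> premise n W s \<subseteq> S)"
proof -
  have ctx: "ctx (v(x := u)) (A(b := S))" using assms by (simp add: ctx_upd)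
  have "sem N (All_in 3 (x + 4) (Imp (Prem (x + 6) (x + 2) (x + 4)) (Mem b (x + 4)))) (v(x := u, x + 2 := s)) (A(b := S)) \<longleftrightarrow>
      premise n W s \<subseteq> S" for s
  proof -
    have "sem N (Prem (x + 6) (x + 2) (x + 4)) (v(x := u, x + 2 := s, x + 4 := e)) (A(b := S)) \<longleftrightarrow>
        e \<in> premise n W s" if "e < n" for e
      by (subst sem_Prem) (use assms ctx that in \<open>simp_all add: ctx_upd\<close>)
    moreover have "ctx (v(x := u, x + 2 := s)) (A(b := S))" using assms ctx by (simp add: ctx_upd)
    ultimately show ?thesis
      by (subst sem_T) (auto simp: premise_def)
  qed
  moreover have "sem N (Concl (x + 4) (x + 2) x) (v(x := u, x + 2 := s)) (A(b := S)) \<longleftrightarrow> u \<in> conclusion n W s" for s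
    by (subst sem_Concl) (use assms ctx in \<open>simp_all add: ctx_upd\<close>)
  ultimately show ?thesis
    by (subst sem_T(1)[OF ctx]) (simp only: sem.simps(4))
qed

lemma sem_CL:
  assumes "ctx v A" "4 \<le> x" "a \<noteq> b" "b \<noteq> 0" "b \<noteq> 2" "b \<noteq> 3"
  shows "sem N (CL b a x \<psi>) v A \<longleftrightarrow> sem N \<psi> v (A(b := cl (A a \<inter> {..<n})))"
proof -
  let ?P = "\<lambda>u S. u < n \<and> (u \<in> A a \<or> (\<exists>s\<in>T. u \<in> conclusion n W s \<and> premise n W s \<subseteq> S))"
  have "sem N (Conj (Mem 3 x) (Or (Mem a x) (Exist_in 2 (x + 2) (Conj (Concl (x + 4) (x + 2) x)
       (All_in 3 (x + 4) (Imp (Prem (x + 6) (x + 2) (x + 4)) (Mem b (x + 4)))))))) (v(x := u)) (A(b := S)) \<longleftrightarrow> ?P u S"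
    (is "sem N (Conj _ (Or _ ?\<phi>)) _ _ \<longleftrightarrow> _") for u S
  proof (cases "u < n")
    case True
    then have "sem N ?\<phi> (v(x := u)) (A(b := S)) \<longleftrightarrow> (\<exists>s\<in>T. u \<in> conclusion n W s \<and> premise n W s \<subseteq> S)"
      using assms by (intro sem_closure_step)
    moreover have "u \<in> (A(b := S)) 3" "(A(b := S)) a = A a" using True assms by (simp_all add: ctx_def)
    ultimately show ?thesis using True by (simp only: sem.simps fun_upd_same) blast
  next
    case False
    then show ?thesis using assms by (simp add: ctx_def)
  qed
  then have "sem N (CL b a x \<psi>) v A \<longleftrightarrow> sem N \<psi> v (A(b := generated N ?P))"
    unfolding CL_def by (simp only: sem.simps(6))
  also have "generated N ?P = cl (A a \<inter> {..<n})"
  proof (rule generated_unfold)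
    fix u assume "?P u (cl (A a \<inter> {..<n}))"
    moreover have "closed (cl (A a \<inter> {..<n}))" by (rule closed_cl) simp
    ultimately show "u \<in> cl (A a \<inter> {..<n})"
      unfolding closed_word by (auto intro: in_cl)
  next
    \<comment> \<open>A set closed under the step may contain numbers from \<open>n\<close> on; its
      part in the ground set is closed in the sense of the system.\<close>
    fix Y assume Y: "\<And>u. u \<le> N \<Longrightarrow> ?P u Y \<Longrightarrow> u \<in> Y"
    have "closed (Y \<inter> {..<n})"
      unfolding closed_word
    proof (intro conjI ballI impI)
      fix s assume s: "s \<in> T" "premise n W s \<subseteq> Y \<inter> {..<n}"
      have "u < n \<and> u \<in> Y" if "u \<in> conclusion n W s" for u
        using Y[of u] s that n_le by (auto simp: conclusion_def)
      then show "conclusion n W s \<subseteq> Y \<inter> {..<n}" by blast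
    qed simp
    then have "cl (A a \<inter> {..<n}) \<subseteq> Y \<inter> {..<n}"
      using Y n_le by (intro cl_least) auto
    then show "cl (A a \<inter> {..<n}) \<subseteq> Y" by blast
  qed blast
  finally show ?thesis .
qed

lemma sem_Span:
  assumes "ctx v A" "4 \<le> x" "x \<notin> set qs" "4 \<le> a" "\<forall>q\<in>set qs. v q < n"
  shows "sem N (Span a qs x \<psi>) v A \<longleftrightarrow> sem N \<psi> v (A(a := v ` set qs, a + 1 := cl (v ` set qs)))"
proof -
  have "(v(x := u)) ` set qs = v ` set qs" for u using assms(3) by (auto simp: image_iff)
  then have "{u. u \<le> N \<and> sem N (Among x qs) (v(x := u)) A} = {u. u \<le> N \<and> u \<in> v ` set qs}"
    by (simp add: sem_Among)
  also have "\<dots> = v ` set qs" using assms(5) n_le by (auto intro: less_imp_le less_le_trans)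
  finally have set: "{u. u \<le> N \<and> sem N (Among x qs) (v(x := u)) A} = v ` set qs" .
  have "v ` set qs \<inter> {..<n} = v ` set qs" using assms(5) by auto
  then show ?thesis
    unfolding Span_def sem_comprehension[OF avoids_Among] set
    using sem_CL[of v "A(a := v ` set qs)" x a "a + 1" \<psi>] assms by (simp add: ctx_upd)
qed

lemma sem_Cons:
  assumes "ctx v A" "4 \<le> x"
  shows "sem N (Cons a x) v A \<longleftrightarrow> cons (A a)"
proof -
  have ctx: "ctx (v(x := s)) A" for s using assms by (simp add: ctx_upd)
  have "sem N (Exist_in 3 (x + 2) (Concl (x + 4) x (x + 2))) (v(x := s)) A \<longleftrightarrow> conclusion n W s \<noteq> {}" for s
  proof -
    have "sem N (Concl (x + 4) x (x + 2)) (v(x := s, x + 2 := e)) A \<longleftrightarrow> e \<in> conclusion n W s" if "e < n" for e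
      by (subst sem_Concl) (use assms ctx that in \<open>simp_all add: ctx_upd\<close>)
    then show ?thesis by (subst sem_T[OF ctx]) (auto simp: conclusion_def)
  qed
  moreover have "sem N (Exist_in 3 (x + 2) (Conj (Prem (x + 4) x (x + 2)) (Neg (Mem a (x + 2))))) (v(x := s)) A \<longleftrightarrow>
      \<not> premise n W s \<subseteq> A a" for s
  proof -
    have "sem N (Prem (x + 4) x (x + 2)) (v(x := s, x + 2 := e)) A \<longleftrightarrow> e \<in> premise n W s" if "e < n" for e
      by (subst sem_Prem) (use assms ctx that in \<open>simp_all add: ctx_upd\<close>)
    then show ?thesis by (subst sem_T[OF ctx]) (auto simp: premise_def)
  qed
  ultimately show ?thesis
    unfolding Cons_def sem_T(2)[OF assms(1)] cons_word
    by (simp only: sem.simps(3,4)) blast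
qed

lemma cl_le: "S \<subseteq> {..<n} \<Longrightarrow> cl S \<subseteq> {..<n}"
  by (rule cl_subset_E)

lemma sem_Irreducible:
  assumes "ctx v A" "4 \<le> x" "x \<noteq> p" "x + 2 \<noteq> p" "4 \<le> a"
  shows "sem N (Irreducible p a x) v A \<longleftrightarrow> v p \<in> J"
proof (cases "v p < n")
  case False
  have "v p \<notin> J" using False J_E[of "v p"] by auto
  moreover have "v p \<notin> A 3" using False assms(1) by (simp add: ctx_def)
  ultimately show ?thesis unfolding Irreducible_def sem.simps(1,4) by simp
next
  case p: True
  let ?A1 = "A(a := {v p}, a + 1 := cl {v p})"
  have ctx1: "ctx v ?A1" using assms by (simp add: ctx_upd)
  let ?\<phi> = "Conj (Mem (a + 1) x) (Span (a + 3) [x] (x + 2) (Neg (Mem (a + 4) p)))"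
  have sub: "cl {v p} \<subseteq> {..<n}" using p by (intro cl_le) simp
  have \<phi>: "sem N ?\<phi> (v(x := u)) ?A1 \<longleftrightarrow> u \<in> cl {v p} \<and> v p \<notin> cl {u}" for u
  proof (cases "u \<in> cl {v p}")
    case True
    then have "sem N (Span (a + 3) [x] (x + 2) (Neg (Mem (a + 4) p))) (v(x := u)) ?A1 \<longleftrightarrow> v p \<notin> cl {u}"
      using sub assms ctx1 sem_Span[of "v(x := u)" ?A1 "x + 2" "[x]" "a + 3"]
      by (auto simp: ctx_upd)
    then show ?thesis unfolding sem.simps(1,4) using True by simp
  next
    case False
    then show ?thesis unfolding sem.simps(1,4) by simp
  qed
  let ?S = "{f \<in> cl {v p}. v p \<notin> cl {f}}"
  have S: "{u. u \<le> N \<and> sem N ?\<phi> (v(x := u)) ?A1} = ?S"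
    unfolding \<phi> using sub n_le by auto
  have "avoids (a + 2) ?\<phi>" by (simp add: Span_def CL_def Prem_def Concl_def) (use assms in simp)
  note comp = sem_comprehension[OF this, of N x _ v ?A1, unfolded S]
  have SI: "?S \<inter> {..<n} = ?S" using sub by auto
  have "sem N (Close (a + 2) x ?\<phi> (CL (a + 5) (a + 2) x (Neg (Mem (a + 5) p)))) v ?A1 \<longleftrightarrow> v p \<notin> cl ?S"
    unfolding comp by (subst sem_CL) (use assms ctx1 in \<open>simp_all add: ctx_upd SI\<close>)
  moreover have "sem N (Cons (a + 1) x) v ?A1 \<longleftrightarrow> cons (cl {v p})"
    using sem_Cons[OF ctx1 assms(2)] by simp
  moreover have "sem N (Irreducible p a x) v A \<longleftrightarrow> sem N (Conj (Cons (a + 1) x)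
     (Close (a + 2) x ?\<phi> (CL (a + 5) (a + 2) x (Neg (Mem (a + 5) p))))) v ?A1"
    using sem_Span[OF assms(1,2) _ assms(5), of "[p]"] assms p
    unfolding Irreducible_def sem.simps(1,4) by (simp add: ctx_def)
  ultimately show ?thesis using p by (simp add: J_def)
qed

lemma J_lt: "u \<in> J \<Longrightarrow> u < n"
  using J_E by auto

lemma J_le: "J \<subseteq> {..N}"
  using J_lt n_le by (meson atMost_iff le_trans less_imp_le subsetI)

lemma lt_n_le: "{..<n} \<subseteq> {..N}"
  using n_le by auto

lemmas sem_rules = sem_Every sem_Any sem_Span sem_Cons ctx_upd J_lt J_le T_le lt_n_le

lemma sem_Projectivity:
  assumes "ctx v A" "A 4 = J"
  shows "sem N Projectivity v A \<longleftrightarrow> projectivity"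
  unfolding Projectivity_def projectivity_def
  by (simp add: assms sem_rules del: sem.simps(6) cong: ball_cong_simp bex_cong_simp) blast

lemma sem_Exchange:
  assumes "ctx v A" "A 4 = J"
  shows "sem N Exchange v A \<longleftrightarrow> exchange"
proof -
  have "{u. u \<le> N \<and> (u \<in> cl {q} \<and> u \<in> cl {p, r} \<or> u = r)} \<inter> {..<n} = cl {q} \<inter> cl {p, r} \<union> {r}"
    if "p \<in> J" "q \<in> J" "r \<in> J" for p q r
    using that J_lt cl_le[of "{q}"] n_le by (auto intro: less_imp_le less_le_trans)
  then show ?thesis
    unfolding Exchange_def exchange_def
    by (simp add: assms sem_rules sem_comprehension sem_CL del: sem.simps(6) cong: ball_cong_simp bex_cong_simp) blast
qed

lemma sem_Flag:
  assumes "ctx v A" "A 4 = J"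
  shows "sem N Flag v A \<longleftrightarrow> flag"
  unfolding Flag_def flag_def
  by (simp add: assms sem_rules del: sem.simps(6) cong: ball_cong_simp bex_cong_simp) blast

lemma generated_line_hull:
  assumes "G \<subseteq> J"
  shows "generated N (\<lambda>u S. u \<in> J \<and> (u \<in> G \<or> (\<exists>q\<in>J. q \<in> S \<and> (\<exists>r\<in>J. r \<in> S \<and> u \<in> cl {q, r})))) = line_hull G"
proof (rule generated_unfold)
  fix u assume "u \<in> J \<and> (u \<in> G \<or> (\<exists>q\<in>J. q \<in> line_hull G \<and> (\<exists>r\<in>J. r \<in> line_hull G \<and> u \<in> cl {q, r})))"
  then show "u \<in> line_hull G"
    using line_hull_closed[of G] subset_line_hull[of G] unfolding line_closed_def by blast
next
  fix Y assume Y: "\<And>u. u \<le> N \<Longrightarrow>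
    u \<in> J \<and> (u \<in> G \<or> (\<exists>q\<in>J. q \<in> Y \<and> (\<exists>r\<in>J. r \<in> Y \<and> u \<in> cl {q, r}))) \<Longrightarrow> u \<in> Y"
  have le: "u \<le> N" if "u \<in> J" for u using J_le that by blast
  \<comment> \<open>Only the part of \<open>Y\<close> in \<open>J\<close> is controlled by the step,
    so the hull is compared with that part.\<close>
  have "line_closed (Y \<inter> J)" unfolding line_closed_def using Y le by blast
  moreover have "G \<subseteq> Y \<inter> J" using Y le assms by blast
  ultimately show "line_hull G \<subseteq> Y" using line_hull_least by blast
qed blast

lemma sem_Hull_step:
  assumes "ctx v A" "A 4 = J" "A 6 = G"
  shows "sem N Hull_step (v(20 := u)) (A(9 := S)) \<longleftrightarrow>
    u \<in> J \<and> (u \<in> G \<or> (\<exists>q\<in>J. q \<in> S \<and> (\<exists>r\<in>J. r \<in> S \<and> u \<in> cl {q, r})))"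
  unfolding Hull_step_def
  by (simp add: assms sem_rules del: sem.simps(6) cong: ball_cong_simp bex_cong_simp)

lemma sem_Generation:
  assumes "ctx v A" "A 4 = J"
  shows "sem N Generation v A \<longleftrightarrow> generation"
proof -
  let ?P = "\<lambda>s. premise n W s" and ?C = "\<lambda>s. conclusion n W s"
  have P: "?P s \<subseteq> {..<n}" and C: "?C s \<subseteq> {..<n}" for s by (auto simp: premise_def conclusion_def)
  have P_le: "?P s \<subseteq> {..N}" for s using P lt_n_le by blast
  have P_lt: "a \<in> ?P s \<Longrightarrow> a < n" for a s using P by blast
  have hull: "line_hull (seed B) \<subseteq> J" for B by (rule line_hull_J) (auto simp: seed_def)
  have hull_le: "line_hull (seed B) \<subseteq> {..N}" for B using hull J_le by blast
  have hull_lt: "a \<in> line_hull (seed B) \<Longrightarrow> a < n" for a B using hull J_lt by blast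
  have seed: "{u. u \<le> N \<and> u \<in> J \<and> (\<exists>a\<in>?P s. u \<in> cl {a})} = seed (?P s)" for s
    using J_le by (auto simp: seed_def)
  have prem: "{u. u \<le> N \<and> u < n \<and> sem N (Prem 22 10 20) (v(10 := s, 20 := u)) A} = ?P s" for s
  proof -
    have "sem N (Prem 22 10 20) (v(10 := s, 20 := u)) A \<longleftrightarrow> u \<in> ?P s" if "u < n" for u
      using sem_Prem[of "v(10 := s, 20 := u)" A 22 10 20] that assms(1) by (simp add: ctx_upd)
    then show ?thesis using P n_le by fastforce
  qed
  define main where "main s \<longleftrightarrow> (\<forall>a\<in>?P s. cons (cl {a})) \<and>
     (\<forall>p\<in>line_hull (seed (?P s)). \<forall>q\<in>line_hull (seed (?P s)). cons (cl {p, q})) \<longrightarrow>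
     ?C s \<noteq> {} \<and> (\<forall>b\<in>?C s. cons (cl {b}) \<and> J \<inter> cl {b} \<subseteq> line_hull (seed (?P s)))" for s
  let ?h1 = "Every 5 20 (Span 10 [20] 22 (Cons 11 22))"
  let ?h2 = "Every 9 20 (Every 9 22 (Span 10 [20, 22] 24 (Cons 11 24)))"
  let ?c1 = "Any 3 20 (Concl 22 10 20)"
  let ?\<chi> = "Span 10 [20] 22 (Conj (Cons 11 22) (Every 4 22 (Imp (Mem 11 22) (Mem 9 22))))"
  let ?c2 = "Every 3 20 (Imp (Concl 22 10 20) ?\<chi>)"
  have rest: "sem N (Imp (Conj ?h1 ?h2) (Conj ?c1 ?c2)) (v(10 := s))
      (A(5 := ?P s, 6 := seed (?P s), 9 := line_hull (seed (?P s)))) \<longleftrightarrow> main s" for s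
  proof -
    let ?H = "line_hull (seed (?P s))"
    let ?A = "A(5 := ?P s, 6 := seed (?P s), 9 := ?H)" and ?v = "v(10 := s)"
    let ?Q = "\<lambda>b. cons (cl {b}) \<and> J \<inter> cl {b} \<subseteq> ?H"
    have A: "ctx ?v ?A" "?A 3 = {..<n}" "?A 4 = J" using assms by (simp_all add: ctx_upd, simp_all add: ctx_def)
    have concl: "sem N (Concl 22 10 20) (?v(20 := u)) ?A \<longleftrightarrow> u \<in> ?C s" if "u < n" for u
      using sem_Concl[of "?v(20 := u)" ?A 22 10 20] that A(1) by (simp add: ctx_upd)
    have h1: "sem N ?h1 ?v ?A \<longleftrightarrow> (\<forall>a\<in>?P s. cons (cl {a}))"
      using assms by (simp add: sem_rules P_le P_lt cong: ball_cong_simp)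
    have h2: "sem N ?h2 ?v ?A \<longleftrightarrow> (\<forall>p\<in>?H. \<forall>q\<in>?H. cons (cl {p, q}))"
      using assms by (simp add: sem_rules hull_le hull_lt cong: ball_cong_simp)
    have "sem N ?c1 ?v ?A \<longleftrightarrow> (\<exists>u\<in>{..<n}. sem N (Concl 22 10 20) (?v(20 := u)) ?A)"
      using sem_Any[of ?A 3 N 20 "Concl 22 10 20" ?v] lt_n_le unfolding A(2) by blast
    also have "\<dots> \<longleftrightarrow> (\<exists>u\<in>{..<n}. u \<in> ?C s)"
      by (rule bex_cong[OF refl]) (simp only: concl lessThan_iff)
    finally have c1: "sem N ?c1 ?v ?A \<longleftrightarrow> ?C s \<noteq> {}" using C by blast
    have \<chi>: "sem N ?\<chi> (?v(20 := b)) ?A \<longleftrightarrow> ?Q b" if "b < n" for b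
      using assms that by (simp add: sem_rules cong: ball_cong_simp) blast
    have step: "sem N (Imp (Concl 22 10 20) ?\<chi>) (?v(20 := b)) ?A \<longleftrightarrow> (b \<in> ?C s \<longrightarrow> ?Q b)" if "b < n" for b
      unfolding sem.simps(3,4) concl[OF that] \<chi>[OF that] by blast
    have "sem N ?c2 ?v ?A \<longleftrightarrow> (\<forall>b\<in>{..<n}. b \<in> ?C s \<longrightarrow> ?Q b)"
      unfolding sem_Every[of ?A 3, unfolded A(2), OF lt_n_le]
      by (rule ball_cong[OF refl]) (rule step, simp only: lessThan_iff)
    then have c2: "sem N ?c2 ?v ?A \<longleftrightarrow> (\<forall>b\<in>?C s. ?Q b)" using C by blast
    show ?thesis unfolding main_def sem.simps(3,4) h1 h2 c1 c2 by blast
  qed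
  have "sem N Generation v A \<longleftrightarrow> (\<forall>s\<in>T. main s)"
  proof -
    \<comment> \<open>Premise and seed are comprehensions; the hull is the one proper fixpoint of
      the three.\<close>
    have av: "avoids 5 (Conj (Mem 3 20) (Prem 22 10 20))"
      "avoids 6 (Conj (Mem 4 20) (Any 5 22 (Span 7 [22] 24 (Mem 8 20))))"
      by (simp_all add: Prem_def Any_def Span_def CL_def Concl_def)
    have A: "A 2 = T" "A 3 = {..<n}" using assms(1) by (simp_all add: ctx_def)
    have first: "{u. u \<le> N \<and> sem N (Conj (Mem 3 20) (Prem 22 10 20)) (v(10 := s, 20 := u)) A} = ?P s" for s
      using prem[of s] by (simp add: A(2))
    have second: "{u. u \<le> N \<and> sem N (Conj (Mem 4 20) (Any 5 22 (Span 7 [22] 24 (Mem 8 20))))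
        (v(10 := s, 20 := u)) (A(5 := ?P s))} = seed (?P s)" for s
      unfolding seed[symmetric] using assms
      by (simp add: sem_rules P_le P_lt cong: bex_cong_simp)
    have third: "generated N (\<lambda>u S. sem N Hull_step (v(10 := s, 20 := u)) (A(5 := ?P s, 6 := seed (?P s), 9 := S)))
        = line_hull (seed (?P s))" for s
    proof -
      have "seed (?P s) \<subseteq> J" by (auto simp: seed_def)
      moreover have "sem N Hull_step ((v(10 := s))(20 := u)) ((A(5 := ?P s, 6 := seed (?P s)))(9 := S)) \<longleftrightarrow>
         u \<in> J \<and> (u \<in> seed (?P s) \<or> (\<exists>q\<in>J. q \<in> S \<and> (\<exists>r\<in>J. r \<in> S \<and> u \<in> cl {q, r})))" for u S
        by (rule sem_Hull_step) (use assms in \<open>simp_all add: ctx_upd\<close>)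
      ultimately show ?thesis by (simp only: generated_line_hull)
    qed
    show ?thesis
      unfolding Generation_def sem_Every[of A 2, unfolded A(1), OF T_le]
      by (rule ball_cong[OF refl])
        (simp only: sem_comprehension[OF av(1)] first, simp only: sem_comprehension[OF av(2)] second,
          simp only: sem.simps(6) third rest)
  qed
  also have "\<dots> \<longleftrightarrow> generation"
    unfolding generation_def unfolding word_implications_def main_def by simp
  finally show ?thesis .
qed

lemma sem_Local:
  assumes "ctx v A"
  shows "sem N Local v A \<longleftrightarrow> local_conditions"
proof -
  have empty: "sem N (Span 5 [] 20 (Cons 6 20)) v A \<longleftrightarrow> cons (cl {})"
    using assms by (simp add: sem_rules)
  have "avoids 4 (Irreducible 20 5 22)"
    by (simp add: Irreducible_def Cons_def Span_def CL_def Prem_def Concl_def)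
  moreover have "{u. u \<le> N \<and> sem N (Irreducible 20 5 22) (v(20 := u)) A} = J"
    using sem_Irreducible[of "v(20 := _)" A 22 20 5] assms J_le by (auto simp: ctx_upd)
  ultimately have "sem N (Close 4 20 (Irreducible 20 5 22) \<psi>) v A \<longleftrightarrow> sem N \<psi> v (A(4 := J))" for \<psi>
    by (simp only: sem_comprehension)
  moreover have "ctx v (A(4 := J))" "(A(4 := J)) 4 = J" using assms by (simp_all add: ctx_upd)
  ultimately show ?thesis
    unfolding Local_def local_conditions_def sem.simps(3,4) empty
    by (simp only: sem.simps(4) sem_Projectivity sem_Exchange sem_Flag sem_Generation) blast
qed

end

section \<open>Parsing the word and the final recognizer\<close>

definition Less :: "nat \<Rightarrow> nat \<Rightarrow> nat \<Rightarrow> fm" where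
  "Less z x y = Exist z (Lin [x, z] 1 [y])"

text \<open>Variable 3 is the position \<open>n\<close> of the first False bit. Variable 5 is forced
  to be the word length, the only position of which every position is a summand. Set 1 collects the
  addresses reached from \<open>n + 1\<close> in steps of \<open>2 * n + 1\<close>. Demanding the
  word length among them fixes the length, and set 2 drops it again, because no block begins
  there.\<close>

definition Recognizer :: fm where
  "Recognizer = Exist 3 (Conj (Neg (Mem 0 3)) (Conj (All 5 (Imp (Less 7 5 3) (Mem 0 5)))
     (Exist 5 (Conj (All 7 (Exist 9 (Lin [7, 9] 0 [5])))
       (Close 1 7 (Or (Lin [3] 1 [7]) (Exist 9 (Conj (Mem 1 9) (Lin [9, 3, 3] 1 [7]))))
         (Conj (Mem 1 5) (Conj (All 7 (Imp (Mem 1 7) (Or (Lin [7] 0 [5]) (Mem 0 7))))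
           (Close 2 7 (Conj (Mem 1 7) (Neg (Lin [7] 0 [5]))) (Close 3 7 (Less 9 7 3) Local)))))))))"

definition starts :: "nat \<Rightarrow> nat \<Rightarrow> nat set" where
  "starts N n = {u. u \<le> N \<and> (\<exists>i. u = block_start n i)}"

text \<open>The step has the form to which the simplifier reduces the formula for set 1 in
  \<open>Recognizer\<close>.\<close>

lemma generated_starts:
  "generated N (\<lambda>u S. Suc n = u \<or> (\<exists>s. s \<in> S \<and> s \<le> N \<and> Suc (s + (n + n)) = u)) = starts N n"
  unfolding starts_def
proof (rule generated_unfold)
  fix u assume u: "u \<le> N" and
    "Suc n = u \<or> (\<exists>s. s \<in> {u. u \<le> N \<and> (\<exists>i. u = block_start n i)} \<and> s \<le> N \<and> Suc (s + (n + n)) = u)"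
  then consider "u = n + 1 + 0 * (2 * n + 1)" | i where "Suc (block_start n i + (n + n)) = u" by auto
  then show "u \<in> {u. u \<le> N \<and> (\<exists>i. u = block_start n i)}"
  proof cases
    case 2
    then have "u = block_start n (Suc i)" by simp
    with u show ?thesis by blast
  qed (use u in blast)
next
  fix Y assume Y: "\<And>u. u \<le> N \<Longrightarrow> Suc n = u \<or> (\<exists>s. s \<in> Y \<and> s \<le> N \<and> Suc (s + (n + n)) = u) \<Longrightarrow> u \<in> Y"
  have "block_start n i \<in> Y" if "block_start n i \<le> N" for i
    using that
  proof (induction i)
    case (Suc i)
    then have "block_start n i \<le> N" "block_start n i \<in> Y" by simp_all
    moreover have "Suc (block_start n i + (n + n)) = block_start n (Suc i)" by simp
    ultimately show ?case using Y[OF Suc.prems] by blast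
  qed (use Y in simp)
  then show "{u. u \<le> N \<and> (\<exists>i. u = block_start n i)} \<subseteq> Y" by blast
qed blast

lemma starts_minus_end:
  assumes "N = block_start n m"
  shows "starts N n - {N} = block_starts n m"
proof -
  have "i * (2 * n + 1) < m * (2 * n + 1) \<longleftrightarrow> i < m" for i by (subst mult_less_cancel2) simp
  then have lt: "block_start n i \<le> N \<and> block_start n i \<noteq> N \<longleftrightarrow> i < m" for i
    unfolding assms by (metis add_left_cancel add_le_cancel_left nat_less_le)
  then show ?thesis
    unfolding starts_def block_starts_def by (intro subset_antisym subsetI) (blast, metis (mono_tags, lifting)
      DiffI imageE lessThan_iff mem_Collect_eq singletonD)
qed

lemma code_word_iff_starts:
  assumes N: "length w = block_start n m"
  shows "code_word n m w \<longleftrightarrow> n \<notin> ones w \<and> (\<forall>i<n. i \<in> ones w) \<and>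
    (\<forall>s\<in>starts (length w) n - {length w}. s \<in> ones w)"
proof -
  have n: "n < length w" using N by linarith
  have "s < length w" if "s \<in> block_starts n m" for s
    using that unfolding starts_minus_end[OF N, symmetric] by (auto simp: starts_def)
  then have "(\<forall>s\<in>block_starts n m. s \<in> ones w) \<longleftrightarrow> (\<forall>s\<in>block_starts n m. w ! s)"
    by (auto simp: ones_def)
  then show ?thesis
    using n unfolding code_word_def starts_minus_end[OF N] by (auto simp: N ones_def block_starts_def)
qed

lemma sem_Recognizer:
  "sem (length w) Recognizer (\<lambda>_. 0) (\<lambda>_. ones w) \<longleftrightarrow>
    (\<exists>n m. code_word n m w \<and>
      implication_system.local_conditions {..<n} (word_implications n (ones w) (block_starts n m)))"
proof -
  let ?N = "length w" and ?W = "ones w"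
  let ?U = "\<lambda>n. starts ?N n"
  let ?loc = "\<lambda>n T. implication_system.local_conditions {..<n} (word_implications n ?W T)"
  \<comment> \<open>This is what evaluation of the quantifier prefix leaves, with \<open>M\<close>
    still arbitrary; \<open>max\<close> then identifies \<open>M\<close> with the word
    length.\<close>
  let ?local = "\<lambda>n M. sem ?N Local ((\<lambda>_. 0)(3 := n, 5 := M)) ((\<lambda>_. ?W)(Suc 0 := ?U n,
      2 := {u. u \<le> ?N \<and> u \<in> ?U n \<and> u \<noteq> M}, 3 := {u. u \<le> ?N \<and> (\<exists>z\<le>?N. Suc (u + z) = n)}))"
  have less: "(\<exists>z\<le>?N. Suc (x + z) = y) \<longleftrightarrow> x < y" if "y \<le> ?N" for x y
    using that by (auto simp: less_iff_Suc_add)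
  have max: "(\<forall>x\<le>?N. \<exists>z\<le>?N. x + z = M) \<longleftrightarrow> M = ?N" if "M \<le> ?N" for M
  proof
    assume "\<forall>x\<le>?N. \<exists>z\<le>?N. x + z = M"
    then show "M = ?N" using that by (metis le_add1 le_antisym le_refl)
  next
    assume "M = ?N"
    then show "\<forall>x\<le>?N. \<exists>z\<le>?N. x + z = M" by (metis diff_le_self le_add_diff_inverse)
  qed
  have local: "?local n ?N \<longleftrightarrow> ?loc n (?U n - {?N})" if n: "n \<le> ?N" for n
  proof -
    interpret word_structure ?N n ?W "?U n - {?N}"
      by unfold_locales (use n in \<open>auto simp: ones_def starts_def\<close>)
    have "{u. u \<le> ?N \<and> (\<exists>z\<le>?N. Suc (u + z) = n)} = {..<n}" using less[OF n] n by auto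
    moreover have "{u. u \<le> ?N \<and> u \<in> ?U n \<and> u \<noteq> ?N} = ?U n - {?N}" by (auto simp: starts_def)
    ultimately show ?thesis by (intro sem_Local) (simp add: ctx_def)
  qed
  have "sem ?N Recognizer (\<lambda>_. 0) (\<lambda>_. ?W) \<longleftrightarrow>
    (\<exists>n\<le>?N. n \<notin> ?W \<and> (\<forall>i\<le>?N. (\<forall>z\<le>?N. Suc (i + z) \<noteq> n) \<or> i \<in> ?W) \<and>
      (\<exists>M\<le>?N. (\<forall>x\<le>?N. \<exists>z\<le>?N. x + z = M) \<and> M \<in> ?U n \<and>
        (\<forall>s. s \<in> ?U n \<longrightarrow> s \<le> ?N \<longrightarrow> s = M \<or> s \<in> ?W) \<and> ?local n M))"
    unfolding Recognizer_def Less_def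
    by (simp add: generated_starts generated_const fun_upd_twist)
  also have "\<dots> \<longleftrightarrow> (\<exists>n\<le>?N. n \<notin> ?W \<and> (\<forall>i<n. i \<in> ?W) \<and> ?N \<in> ?U n \<and>
      (\<forall>s\<in>?U n - {?N}. s \<in> ?W) \<and> ?loc n (?U n - {?N}))"
  proof -
    have bits: "(\<forall>i\<le>?N. (\<forall>z\<le>?N. Suc (i + z) \<noteq> n) \<or> i \<in> ?W) \<longleftrightarrow> (\<forall>i<n. i \<in> ?W)"
      if "n \<le> ?N" for n
    proof -
      have "(\<forall>i\<le>?N. (\<forall>z\<le>?N. Suc (i + z) \<noteq> n) \<or> i \<in> ?W) \<longleftrightarrow> (\<forall>i\<le>?N. i < n \<longrightarrow> i \<in> ?W)"
        using less[OF that] by blast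
      also have "\<dots> \<longleftrightarrow> (\<forall>i<n. i \<in> ?W)" using that by auto
      finally show ?thesis .
    qed
    have end_only: "(\<exists>M\<le>?N. (\<forall>x\<le>?N. \<exists>z\<le>?N. x + z = M) \<and> Q M) \<longleftrightarrow> Q ?N" for Q
      using max by blast
    have "s \<le> ?N" if "s \<in> ?U n" for s n using that by (simp add: starts_def)
    then show ?thesis unfolding end_only by (intro ex_cong1) (use bits local in blast)
  qed
  also have "\<dots> \<longleftrightarrow> (\<exists>n m. code_word n m w \<and> ?loc n (block_starts n m))"
  proof
    assume "\<exists>n\<le>?N. n \<notin> ?W \<and> (\<forall>i<n. i \<in> ?W) \<and> ?N \<in> ?U n \<and>
      (\<forall>s\<in>?U n - {?N}. s \<in> ?W) \<and> ?loc n (?U n - {?N})"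
    then obtain n m where n: "n \<notin> ?W" "\<forall>i<n. i \<in> ?W" "\<forall>s\<in>?U n - {?N}. s \<in> ?W" "?loc n (?U n - {?N})"
      and N: "?N = block_start n m" unfolding starts_def by blast
    have "code_word n m w" using n(1-3) unfolding code_word_iff_starts[OF N] by blast
    moreover have "?loc n (block_starts n m)" using n(4) unfolding starts_minus_end[OF N] .
    ultimately show "\<exists>n m. code_word n m w \<and> ?loc n (block_starts n m)" by blast
  next
    assume "\<exists>n m. code_word n m w \<and> ?loc n (block_starts n m)"
    then obtain n m where nm: "code_word n m w" "?loc n (block_starts n m)" by blast
    then have N: "?N = block_start n m" by (simp add: code_word_def)
    then have "?N \<in> ?U n" "n \<le> ?N" unfolding starts_def by (blast, linarith)
    then show "\<exists>n\<le>?N. n \<notin> ?W \<and> (\<forall>i<n. i \<in> ?W) \<and> ?N \<in> ?U n \<and>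
      (\<forall>s\<in>?U n - {?N}. s \<in> ?W) \<and> ?loc n (?U n - {?N})"
      using nm unfolding code_word_iff_starts[OF N] starts_minus_end[OF N, symmetric] by blast
  qed
  finally show ?thesis .
qed

lemma scoped_Recognizer: "scoped {} 3 {0} Recognizer"
  by (simp add: Recognizer_def Less_def Local_def Irreducible_def Projectivity_def Exchange_def
    Flag_def Generation_def Hull_step_def Every_def Any_def Span_def CL_def Cons_def Prem_def Concl_def)

text \<open>Natural numbers as names are no restriction: every finite ground set can be renamed into
  them, and the word does not record the names. Words that encode no instance lie outside the
  language and are rejected.\<close>

theorem theorem4p8:
  "{encode es \<Sigma> | (es :: nat list) (\<Sigma> :: nat implication list).
      distinct es \<and> implications_on (set es) (set \<Sigma>) \<and>
      modular_semilattice (inclusion_order (implication_family (set es) (set \<Sigma>)))} \<in> PTIME"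
proof (rule PTIME_sem[OF scoped_Recognizer])
  fix w
  show "w \<in> {encode es \<Sigma> | (es :: nat list) (\<Sigma> :: nat implication list).
      distinct es \<and> implications_on (set es) (set \<Sigma>) \<and>
      modular_semilattice (inclusion_order (implication_family (set es) (set \<Sigma>)))} \<longleftrightarrow>
    sem (length w) Recognizer (\<lambda>_. 0) (\<lambda>_. ones w)"
    unfolding sem_Recognizer mem_language_iff[symmetric] by simp
qed

end
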